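(* Let $R$ be an admissible ring and let $\mathcal{J}$ be a regular fractional ideal of $R$. The following are equivalent: (i) $\mathcal{J}$ is a canonical ideal; (ii) $E(\mathcal{J}:\mathcal{I})=\{\beta\in\mathbb{Z}^r:\ F(E(\mathcal{I}),\mathfrak{f}(\mathcal{J})-\beta)=\emptyset\}$ for all regular fractional ideals $\mathcal{I}$ of $R$.
   Context: Admissible rings: a noetherian, Cohen–Macaulay, one-dimensional local ring $(R,\mathfrak{M})$ with total ring of fractions $Q$ is admissible if it is analytically reduced (its $\mathfrak{M}$-adic completion is reduced), residually rational (each valuation ring of $Q$ over $R$ has residue field equal to $R/\mathfrak{M}$), and $\#(R/\mathfrak{M})\geq r$, where $r$ is the number of valuation rings of $Q$ over $R$. All these valuation rings are discrete (they correspond to the maximal ideals of the integral closure of $R$ in $Q$); let $v_1,\ldots,v_r$ be the associated valuations. Put $I=\{1,\ldots,r\}$, let $Q^{reg}$ be the set of regular elements of $Q$, and define $v:Q^{reg}\to\mathbb{Z}^r$ by $v(h)=(v_1(h),\ldots,v_r(h))$. $\mathbb{Z}^r$ has the componentwise partial order $\leq$. A fractional ideal is an $R$-submodule $\mathcal{I}$ of $Q$ such that $d\,\mathcal{I}\subset R$ for some regular $d\in R$; it is regular if it contains a regular element of $Q$. For regular fractional ideals, $\mathcal{J}:\mathcal{I}=\{x\in Q:\ x\mathcal{I}\subset\mathcal{J}\}$, which is again a regular fractional ideal. A regular fractional ideal $\mathcal{J}$ is a canonical ideal if $\mathcal{J}:(\mathcal{J}:\mathcal{I})=\mathcal{I}$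 for every regular fractional ideal $\mathcal{I}$. The value set of a regular fractional ideal $\mathcal{I}$ is $E(\mathcal{I})=v(\mathcal{I}\cap Q^{reg})\subset\mathbb{Z}^r$. Its conductor $c(\mathcal{I})$ is the unique least element $\gamma\in E(\mathcal{I})$ such that $\gamma+\mathbb{N}^r\subset E(\mathcal{I})$ (with $0\in\mathbb{N}$; such an element exists), and its Frobenius vector is $\mathfrak{f}(\mathcal{I})=c(\mathcal{I})-e$ with $e=(1,\ldots,1)$. Fibers: for $E\subset\mathbb{Z}^r$, $\alpha\in\mathbb{Z}^r$ and $i\in I$, $F_i(E,\alpha)=\{\beta\in E:\ \beta_i=\alpha_i \text{ and } \beta_j>\alpha_j \text{ for all } j\in I\setminus\{i\}\}$, and $F(E,\alpha)=\bigcup_{i=1}^r F_i(E,\alpha)$. *)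

theory Defs
  imports "HOL-Algebra.Algebra" "HOL-Library.Extended_Nat" "HOL-Library.Equipollence"
begin

section \<open>Local rings, dimension, depth, completion\<close>

definition regular_elements :: "('a, 'b) ring_scheme \<Rightarrow> 'a set" where
  "regular_elements A =
     {x \<in> carrier A. \<forall>y\<in>carrier A. x \<otimes>\<^bsub>A\<^esub> y = \<zero>\<^bsub>A\<^esub> \<longrightarrow> y = \<zero>\<^bsub>A\<^esub>}"

definition reduced_ring :: "('a, 'b) ring_scheme \<Rightarrow> bool" where
  "reduced_ring A \<longleftrightarrow>
     (\<forall>x\<in>carrier A. \<forall>n::nat. x [^]\<^bsub>A\<^esub> n = \<zero>\<^bsub>A\<^esub> \<longrightarrow> x = \<zero>\<^bsub>A\<^esub>)"

definition local_ring :: "('a, 'b) ring_scheme \<Rightarrow> 'a set \<Rightarrow> bool" where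
  "local_ring A M \<longleftrightarrow> cring A \<and> {N. maximalideal N A} = {M}"

definition krull_dim :: "('a, 'b) ring_scheme \<Rightarrow> enat" where
  "krull_dim A = Sup {enat n | n. \<exists>P :: nat \<Rightarrow> 'a set.
     (\<forall>i\<le>n. primeideal (P i) A) \<and> (\<forall>i<n. P i \<subset> P (Suc i))}"

definition regular_sequence :: "('a, 'b) ring_scheme \<Rightarrow> 'a list \<Rightarrow> bool" where
  "regular_sequence A xs \<longleftrightarrow>
     set xs \<subseteq> carrier A \<and> genideal A (set xs) \<noteq> carrier A \<and>
     (\<forall>i<length xs. let I = genideal A (set (take i xs)) in
        I +>\<^bsub>A\<^esub> (xs ! i) \<in> regular_elements (A Quot I))"

definition depth :: "('a, 'b) ring_scheme \<Rightarrow> 'a set \<Rightarrow> enat" where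
  "depth A M = Sup {enat (length xs) | xs. regular_sequence A xs \<and> set xs \<subseteq> M}"

definition cohen_macaulay_local :: "('a, 'b) ring_scheme \<Rightarrow> 'a set \<Rightarrow> bool" where
  "cohen_macaulay_local A M \<longleftrightarrow>
     local_ring A M \<and> noetherian_ring A \<and> depth A M = krull_dim A"

abbreviation ideal_power :: "('a, 'b) ring_scheme \<Rightarrow> 'a set \<Rightarrow> nat \<Rightarrow> 'a set" where
  "ideal_power A M n \<equiv> M [^]\<^bsub>ideals_set A\<^esub> n"

text \<open>The inverse limit of the rings \<open>A / M\<^sup>n\<close>. Elements of a quotient are cosets, and the
  transition map from \<open>A / M\<^sup>n\<^sup>+\<^sup>1\<close> to \<open>A / M\<^sup>n\<close> sends a coset \<open>C\<close> to \<open>M\<^sup>n + C\<close>.\<close>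

definition adic_completion :: "('a, 'b) ring_scheme \<Rightarrow> 'a set \<Rightarrow> (nat \<Rightarrow> 'a set) ring" where
  "adic_completion A M =
     \<lparr>carrier = {f. \<forall>n. f n \<in> carrier (A Quot ideal_power A M n) \<and>
                        f n = ideal_power A M n <+>\<^bsub>A\<^esub> f (Suc n)},
      monoid.mult = (\<lambda>f g n. f n \<otimes>\<^bsub>A Quot ideal_power A M n\<^esub> g n),
      one = (\<lambda>n. \<one>\<^bsub>A Quot ideal_power A M n\<^esub>),
      ring.zero = (\<lambda>n. \<zero>\<^bsub>A Quot ideal_power A M n\<^esub>),
      add = (\<lambda>f g n. f n \<oplus>\<^bsub>A Quot ideal_power A M n\<^esub> g n)\<rparr>"

section \<open>Valuation rings of the total ring of fractions\<close>

abbreviation subring_of :: "('a, 'b) ring_scheme \<Rightarrow> 'a set \<Rightarrow> ('a, 'b) ring_scheme" where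
  "subring_of Q R \<equiv> Q\<lparr>carrier := R\<rparr>"

definition total_ring_of_fractions :: "('a, 'b) ring_scheme \<Rightarrow> 'a set \<Rightarrow> bool" where
  "total_ring_of_fractions Q R \<longleftrightarrow>
     cring Q \<and> subcring R Q \<and>
     regular_elements (subring_of Q R) \<subseteq> Units Q \<and>
     carrier Q = {a \<otimes>\<^bsub>Q\<^esub> inv\<^bsub>Q\<^esub> s | a s. a \<in> R \<and> s \<in> regular_elements (subring_of Q R)}"

definition valuation_ring :: "('a, 'b) ring_scheme \<Rightarrow> 'a set \<Rightarrow> bool" where
  "valuation_ring Q V \<longleftrightarrow>
     subcring V Q \<and> V \<noteq> carrier Q \<and>
     (\<forall>x\<in>carrier Q - V. \<forall>y\<in>carrier Q - V. x \<otimes>\<^bsub>Q\<^esub> y \<in> carrier Q - V)"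

definition valuation_rings_over :: "('a, 'b) ring_scheme \<Rightarrow> 'a set \<Rightarrow> 'a set set" where
  "valuation_rings_over Q R = {V. valuation_ring Q V \<and> R \<subseteq> V}"

text \<open>The residue field of a valuation ring \<open>V\<close> of \<open>Q\<close> is the quotient by its (unique) maximal
  ideal containing a regular element; other maximal ideals may exist, since \<open>Q\<close> need not be a
  field.\<close>

definition regular_maximal_ideal ::
  "('a, 'b) ring_scheme \<Rightarrow> 'a set \<Rightarrow> 'a set \<Rightarrow> bool" where
  "regular_maximal_ideal Q V m \<longleftrightarrow>
     maximalideal m (subring_of Q V) \<and> m \<inter> regular_elements Q \<noteq> {}"

text \<open>The canonical map \<open>R \<rightarrow> V / m\<close> is onto. Its kernel is then a maximal ideal of \<open>R\<close>, so for a
  local ring \<open>R\<close> the map identifies the residue field of \<open>R\<close> with \<open>V / m\<close>.\<close>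

definition residually_rational :: "('a, 'b) ring_scheme \<Rightarrow> 'a set \<Rightarrow> bool" where
  "residually_rational Q R \<longleftrightarrow>
     (\<forall>V\<in>valuation_rings_over Q R. \<forall>m. regular_maximal_ideal Q V m \<longrightarrow>
        (\<lambda>a. m +>\<^bsub>subring_of Q V\<^esub> a) ` R = carrier (subring_of Q V Quot m))"

definition admissible_ring :: "('a, 'b) ring_scheme \<Rightarrow> 'a set \<Rightarrow> bool" where
  "admissible_ring Q R \<longleftrightarrow>
     total_ring_of_fractions Q R \<and>
     (\<exists>M. cohen_macaulay_local (subring_of Q R) M \<and>
          krull_dim (subring_of Q R) = 1 \<and>
          reduced_ring (adic_completion (subring_of Q R) M) \<and>
          residually_rational Q R \<and>
          valuation_rings_over Q R \<lesssim> carrier (subring_of Q R Quot M))"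

text \<open>The surjective integer-valued valuation with valuation ring \<open>V\<close>, restricted to the regular
  elements, where it is finite. It exists (and is then unique) if \<open>V\<close> is discrete.\<close>

definition is_normalized_valuation ::
  "('a, 'b) ring_scheme \<Rightarrow> 'a set \<Rightarrow> ('a \<Rightarrow> int) \<Rightarrow> bool" where
  "is_normalized_valuation Q V v \<longleftrightarrow>
     v \<in> extensional (regular_elements Q) \<and>
     v ` regular_elements Q = UNIV \<and>
     (\<forall>x\<in>regular_elements Q. \<forall>y\<in>regular_elements Q. v (x \<otimes>\<^bsub>Q\<^esub> y) = v x + v y) \<and>
     (\<forall>x\<in>regular_elements Q. \<forall>y\<in>regular_elements Q.
        x \<oplus>\<^bsub>Q\<^esub> y \<in> regular_elements Q \<longrightarrow> min (v x) (v y) \<le> v (x \<oplus>\<^bsub>Q\<^esub> y)) \<and>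
     (\<forall>x\<in>regular_elements Q. x \<in> V \<longleftrightarrow> 0 \<le> v x)"

definition valuation_of :: "('a, 'b) ring_scheme \<Rightarrow> 'a set \<Rightarrow> 'a \<Rightarrow> int" where
  "valuation_of Q V = (THE v. is_normalized_valuation Q V v)"

section \<open>Fractional ideals\<close>

definition fractional_ideal :: "('a, 'b) ring_scheme \<Rightarrow> 'a set \<Rightarrow> 'a set \<Rightarrow> bool" where
  "fractional_ideal Q R I \<longleftrightarrow>
     additive_subgroup I Q \<and> (\<forall>a\<in>R. \<forall>x\<in>I. a \<otimes>\<^bsub>Q\<^esub> x \<in> I) \<and>
     (\<exists>d\<in>regular_elements (subring_of Q R). \<forall>x\<in>I. d \<otimes>\<^bsub>Q\<^esub> x \<in> R)"

definition regular_fractional_ideal :: "('a, 'b) ring_scheme \<Rightarrow> 'a set \<Rightarrow> 'a set \<Rightarrow> bool" where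
  "regular_fractional_ideal Q R I \<longleftrightarrow>
     fractional_ideal Q R I \<and> I \<inter> regular_elements Q \<noteq> {}"

definition ideal_colon :: "('a, 'b) ring_scheme \<Rightarrow> 'a set \<Rightarrow> 'a set \<Rightarrow> 'a set" where
  "ideal_colon Q J I = {x \<in> carrier Q. \<forall>y\<in>I. x \<otimes>\<^bsub>Q\<^esub> y \<in> J}"

definition canonical_ideal :: "('a, 'b) ring_scheme \<Rightarrow> 'a set \<Rightarrow> 'a set \<Rightarrow> bool" where
  "canonical_ideal Q R J \<longleftrightarrow>
     regular_fractional_ideal Q R J \<and>
     (\<forall>I. regular_fractional_ideal Q R I \<longrightarrow> ideal_colon Q J (ideal_colon Q J I) = I)"

section \<open>Value sets\<close>

text \<open>The integer vectors of length \<open>r\<close> are the extensional functions on \<open>{1..r}\<close>.\<close>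

definition int_vectors :: "nat \<Rightarrow> (nat \<Rightarrow> int) set" where
  "int_vectors r = {1..r} \<rightarrow>\<^sub>E UNIV"

definition value_set ::
  "('a, 'b) ring_scheme \<Rightarrow> nat \<Rightarrow> (nat \<Rightarrow> 'a set) \<Rightarrow> 'a set \<Rightarrow> (nat \<Rightarrow> int) set" where
  "value_set Q r V I =
     (\<lambda>h. \<lambda>i\<in>{1..r}. valuation_of Q (V i) h) ` (I \<inter> regular_elements Q)"

definition is_conductor :: "nat \<Rightarrow> (nat \<Rightarrow> int) set \<Rightarrow> (nat \<Rightarrow> int) \<Rightarrow> bool" where
  "is_conductor r E \<gamma> \<longleftrightarrow>
     (let C = {\<delta> \<in> E. \<forall>\<nu> :: nat \<Rightarrow> nat. (\<lambda>i\<in>{1..r}. \<delta> i + int (\<nu> i)) \<in> E}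
      in \<gamma> \<in> C \<and> (\<forall>\<delta>\<in>C. \<forall>i\<in>{1..r}. \<gamma> i \<le> \<delta> i))"

definition conductor :: "nat \<Rightarrow> (nat \<Rightarrow> int) set \<Rightarrow> nat \<Rightarrow> int" where
  "conductor r E = (THE \<gamma>. is_conductor r E \<gamma>)"

definition frobenius_vector :: "nat \<Rightarrow> (nat \<Rightarrow> int) set \<Rightarrow> nat \<Rightarrow> int" where
  "frobenius_vector r E = (\<lambda>i\<in>{1..r}. conductor r E i - 1)"

definition fiber :: "nat \<Rightarrow> (nat \<Rightarrow> int) set \<Rightarrow> (nat \<Rightarrow> int) \<Rightarrow> nat \<Rightarrow> (nat \<Rightarrow> int) set" where
  "fiber r E \<alpha> i = {\<beta> \<in> E. \<beta> i = \<alpha> i \<and> (\<forall>j\<in>{1..r} - {i}. \<beta> j > \<alpha> j)}"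

definition fibers :: "nat \<Rightarrow> (nat \<Rightarrow> int) set \<Rightarrow> (nat \<Rightarrow> int) \<Rightarrow> (nat \<Rightarrow> int) set" where
  "fibers r E \<alpha> = (\<Union>i\<in>{1..r}. fiber r E \<alpha> i)"

end

theory Submission
  imports Defs
begin

text \<open>First, the ring theory. Let \<open>x\<close> be a regular element of the maximal ideal, \<open>B\<close> the integral closure of \<open>R\<close> in
  \<open>Q\<close> and \<open>e\<close> the length of \<open>R / xR\<close>. Each \<open>b \<in> B\<close> satisfies a monic equation of degree at most
  \<open>e + 1\<close>, because \<open>U / xU\<close> has length \<open>e\<close> for every finite overring \<open>U\<close>. If no power of \<open>x\<close> annihilated
  \<open>B / R\<close>, this uniform degree would produce a nilpotent in the completion; so \<open>x\<^sup>k B \<subseteq> R\<close> for some \<open>k\<close>.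
  Then the primes of \<open>B\<close> containing \<open>x\<close> have uniformizers, their localizations are the valuation rings over
  \<open>R\<close>, and \<open>R\<close> contains every element of large value.

  Second, the duality. If \<open>J\<close> is canonical, \<open>J : (I \<inter> {v \<ge> \<alpha>}) = (J : I) + {v \<ge> c(J) - \<alpha>}\<close>, which turns
  empty fibers of \<open>E(I)\<close> into elements of \<open>J : I\<close> attaining a prescribed value in one coordinate each; since
  the residue field has at least \<open>r\<close> elements, these can be combined into one. Conversely, (ii) and the
  exchange property of \<open>E(I)\<close> show that \<open>I\<close> and \<open>J : (J : I)\<close> have the same value set, and nested
  fractional ideals with the same value set are equal.\<close>

section \<open>Submodules and their length\<close>

text \<open>The obstacle throughout is that Q need not be a field: valuations are defined on regular
  elements only, yet fractional ideals contain zero divisors. The remedy is that for every y in Q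
  the sum y + x^n is a unit for arbitrarily large n. The perturbation has large value, so inside a
  fractional ideal y may be traded for a unit with the same values up to any prescribed bound. The
  degree of the integral equations must not depend on b because the nilpotent is a limit of varying
  elements u_n, where the (e + 1)-st power of u_n is divisible by x^n; only a common exponent passes
  to the limit. This is where analytic reducedness enters, while the Cohen-Macaulay property
  supplies x. The formula for J : (I \<inter> {v \<ge> \<alpha>}) is biduality applied to J : (A +
  B) = (J : A) \<inter> (J : B), together with J : {v \<ge> \<alpha>} = {v \<ge> c(J) - \<alpha>}.
  All modules are subsets of Q: a quotient B / A is represented by the pair A \<subseteq> B, and a
  monic equation by the membership of b^(m + 1) in R + Rb + ... + Rb^m.\<close>

context cring
begin

text \<open>Closure under negation comes from -1 being in S as soon as S is a subring, see
  \<open>submod_minus\<close>. S will be R, its integral closure, or a valuation ring.\<close>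

definition submod :: "'a set \<Rightarrow> 'a set \<Rightarrow> bool" where
  "submod S N \<longleftrightarrow> N \<subseteq> carrier R \<and> \<zero> \<in> N \<and> (\<forall>a\<in>N. \<forall>b\<in>N. a \<oplus> b \<in> N) \<and> (\<forall>s\<in>S. \<forall>a\<in>N. s \<otimes> a \<in> N)"

definition msum :: "'a set \<Rightarrow> 'a set \<Rightarrow> 'a set" where
  "msum A B = {a \<oplus> b | a b. a \<in> A \<and> b \<in> B}"

definition scal :: "'a \<Rightarrow> 'a set \<Rightarrow> 'a set" where
  "scal z A = (\<lambda>a. z \<otimes> a) ` A"

lemma submodI:
  assumes "N \<subseteq> carrier R" "\<zero> \<in> N" "\<And>a b. a \<in> N \<Longrightarrow> b \<in> N \<Longrightarrow> a \<oplus> b \<in> N"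
    "\<And>s a. s \<in> S \<Longrightarrow> a \<in> N \<Longrightarrow> s \<otimes> a \<in> N"
  shows "submod S N"
  using assms unfolding submod_def by blast

lemma submodD:
  assumes "submod S N"
  shows "N \<subseteq> carrier R" "\<And>a. a \<in> N \<Longrightarrow> a \<in> carrier R" "\<zero> \<in> N"
    "\<And>a b. a \<in> N \<Longrightarrow> b \<in> N \<Longrightarrow> a \<oplus> b \<in> N"
    "\<And>s a. s \<in> S \<Longrightarrow> a \<in> N \<Longrightarrow> s \<otimes> a \<in> N"
  using assms unfolding submod_def by blast+

lemma submod_minus:
  assumes "submod S N" "subring S R" "a \<in> N" shows "\<ominus> a \<in> N"
proof -
  have "\<ominus> \<one> \<otimes> a \<in> N"
    using assms subringE(3,5)[OF assms(2)] submodD(5)[OF assms(1)] by blast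
  moreover have "\<ominus> \<one> \<otimes> a = \<ominus> a" using submodD(2)[OF assms(1,3)] by algebra
  ultimately show ?thesis by simp
qed

lemma submod_diff:
  assumes "submod S N" "subring S R" "a \<in> N" "b \<in> N" shows "a \<ominus> b \<in> N"
  using assms submod_minus submodD(4) unfolding a_minus_def by blast

lemma submod_cancel:
  assumes "submod S N" "subring S R" "a \<in> N" "b \<in> carrier R" "a \<oplus> b \<in> N" shows "b \<in> N"
proof -
  have "(a \<oplus> b) \<ominus> a \<in> N" using submod_diff assms by blast
  moreover have "(a \<oplus> b) \<ominus> a = b" using submodD(2)[OF assms(1,3)] assms(4) by algebra
  ultimately show ?thesis by simp
qed

lemma submod_cancel_diff:
  assumes "submod S N" "subring S R" "a \<in> N" "b \<in> carrier R" "b \<ominus> a \<in> N" shows "b \<in> N"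
proof -
  have "(b \<ominus> a) \<oplus> a \<in> N" using submodD(4) assms by blast
  moreover have "(b \<ominus> a) \<oplus> a = b" using submodD(2)[OF assms(1,3)] assms(4) by algebra
  ultimately show ?thesis by simp
qed

lemma submod_self: "subring S R \<Longrightarrow> submod S S"
  by (rule submodI) (auto dest: subringE)

lemma submod_carrier: "subring S R \<Longrightarrow> submod S (carrier R)"
  by (rule submodI) (auto dest: subringE(1))

lemma submod_weaken: "submod T N \<Longrightarrow> S \<subseteq> T \<Longrightarrow> submod S N"
  unfolding submod_def by blast

lemma submod_Int: "submod S N \<Longrightarrow> submod S N' \<Longrightarrow> submod S (N \<inter> N')"
  unfolding submod_def by blast

lemma submod_INT:
  assumes "\<And>i. i \<in> A \<Longrightarrow> submod S (f i)" "A \<noteq> {}" shows "submod S (\<Inter>i\<in>A. f i)"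
proof (rule submodI)
  show "(\<Inter>i\<in>A. f i) \<subseteq> carrier R" using assms submodD(1) by blast
qed (use submodD(3-5)[OF assms(1)] in auto)

lemma msumI: "a \<in> A \<Longrightarrow> b \<in> B \<Longrightarrow> a \<oplus> b \<in> msum A B"
  unfolding msum_def by blast

lemma msumE:
  assumes "c \<in> msum A B" obtains a b where "a \<in> A" "b \<in> B" "c = a \<oplus> b"
  using assms unfolding msum_def by blast

lemma submod_msum:
  assumes S: "subring S R" and N: "submod S N" and N': "submod S N'" shows "submod S (msum N N')"
proof (rule submodI)
  show "msum N N' \<subseteq> carrier R"
    using submodD(2)[OF N] submodD(2)[OF N'] by (auto simp: msum_def)
  show "\<zero> \<in> msum N N'"
    using msumI[OF submodD(3)[OF N] submodD(3)[OF N']] by simp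
next
  fix c d assume c: "c \<in> msum N N'" and d: "d \<in> msum N N'"
  obtain a b where 1: "a \<in> N" "b \<in> N'" "c = a \<oplus> b" using c by (rule msumE)
  obtain a' b' where 2: "a' \<in> N" "b' \<in> N'" "d = a' \<oplus> b'" using d by (rule msumE)
  note * = 1 2
  have "c \<oplus> d = (a \<oplus> a') \<oplus> (b \<oplus> b')"
    using * submodD(2)[OF N] submodD(2)[OF N'] by (simp add: a_ac)
  then show "c \<oplus> d \<in> msum N N'"
    using msumI[of "a \<oplus> a'" N "b \<oplus> b'" N'] * submodD(4)[OF N] submodD(4)[OF N'] by simp
next
  fix s c assume s: "s \<in> S" and c: "c \<in> msum N N'"
  obtain a b where *: "a \<in> N" "b \<in> N'" "c = a \<oplus> b" using c by (rule msumE)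
  have "s \<otimes> c = s \<otimes> a \<oplus> s \<otimes> b"
    using * s subringE(1)[OF S] submodD(2)[OF N] submodD(2)[OF N'] by (simp add: r_distr subset_eq)
  then show "s \<otimes> c \<in> msum N N'"
    using msumI[of "s \<otimes> a" N "s \<otimes> b" N'] * s submodD(5)[OF N] submodD(5)[OF N'] by simp
qed

lemma msum_ge1: "submod S N \<Longrightarrow> submod S N' \<Longrightarrow> N \<subseteq> msum N N'"
  using msumI[of _ N \<zero> N'] submodD(2)[of S N] submodD(3)[of S N'] by (metis r_zero subsetI)

lemma msum_ge2: "submod S N \<Longrightarrow> submod S N' \<Longrightarrow> N' \<subseteq> msum N N'"
  using msumI[of \<zero> N _ N'] submodD(2)[of S N'] submodD(3)[of S N] by (metis l_zero subsetI)

lemma msum_le: "submod S N \<Longrightarrow> A \<subseteq> N \<Longrightarrow> B \<subseteq> N \<Longrightarrow> msum A B \<subseteq> N"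
  unfolding msum_def using submodD(4) by blast

lemma msum_mono: "A \<subseteq> A' \<Longrightarrow> B \<subseteq> B' \<Longrightarrow> msum A B \<subseteq> msum A' B'"
  unfolding msum_def by blast

lemma scalI: "a \<in> A \<Longrightarrow> z \<otimes> a \<in> scal z A"
  unfolding scal_def by blast

lemma scalE:
  assumes "c \<in> scal z A" obtains a where "a \<in> A" "c = z \<otimes> a"
  using assms unfolding scal_def by blast

lemma scal_mono: "A \<subseteq> B \<Longrightarrow> scal z A \<subseteq> scal z B"
  unfolding scal_def by blast

lemma submod_scal:
  assumes S: "subring S R" and N: "submod S N" and z: "z \<in> carrier R" shows "submod S (scal z N)"
proof (rule submodI)
  show "scal z N \<subseteq> carrier R"
    using submodD(2)[OF N] z by (auto simp: scal_def)
  show "\<zero> \<in> scal z N"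
    using scalI[OF submodD(3)[OF N], of z] z by simp
next
  fix c d assume c: "c \<in> scal z N" and d: "d \<in> scal z N"
  obtain a where 1: "a \<in> N" "c = z \<otimes> a" using c by (rule scalE)
  obtain b where 2: "b \<in> N" "d = z \<otimes> b" using d by (rule scalE)
  note * = 1 2
  then have "c \<oplus> d = z \<otimes> (a \<oplus> b)" using submodD(2)[OF N] z by (simp add: r_distr)
  then show "c \<oplus> d \<in> scal z N" using scalI[of "a \<oplus> b" N z] * submodD(4)[OF N] by simp
next
  fix s c assume s: "s \<in> S" and c: "c \<in> scal z N"
  obtain a where *: "a \<in> N" "c = z \<otimes> a" using c by (rule scalE)
  then have "s \<otimes> c = z \<otimes> (s \<otimes> a)"
    using submodD(2)[OF N] z s subringE(1)[OF S] by (simp add: m_lcomm subset_eq)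
  then show "s \<otimes> c \<in> scal z N" using scalI[of "s \<otimes> a" N z] * s submodD(5)[OF N] by simp
qed

lemma scal_scal: "y \<in> carrier R \<Longrightarrow> z \<in> carrier R \<Longrightarrow> N \<subseteq> carrier R \<Longrightarrow> scal y (scal z N) = scal (y \<otimes> z) N"
  unfolding scal_def image_image by (rule image_cong) (auto simp: m_assoc)

lemma scal_one: "N \<subseteq> carrier R \<Longrightarrow> scal \<one> N = N"
proof -
  assume N: "N \<subseteq> carrier R"
  have "(\<lambda>a. \<one> \<otimes> a) ` N = (\<lambda>a. a) ` N" by (rule image_cong) (use N in auto)
  then show ?thesis unfolding scal_def by simp
qed

lemma scal_inv:
  assumes "z \<in> Units R" "N \<subseteq> carrier R" shows "scal (inv z) (scal z N) = N" "scal z (scal (inv z) N) = N"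
proof -
  have "z \<in> carrier R" "inv z \<in> carrier R" using assms(1) by auto
  then show "scal (inv z) (scal z N) = N" "scal z (scal (inv z) N) = N"
    using assms by (simp_all add: scal_scal scal_one)
qed

lemma scal_subset_iff:
  assumes "z \<in> Units R" "N \<subseteq> carrier R" "N' \<subseteq> carrier R" shows "scal z N \<subseteq> scal z N' \<longleftrightarrow> N \<subseteq> N'"
  using scal_mono[of "scal z N" "scal z N'" "inv z"] scal_mono[of N N' z] scal_inv[OF assms(1)] assms by auto

text \<open>Modular law: z in C' is a + b with a in C and b in B by the equality of sums; then b = z
  - a lies in C' \<inter> B, hence in C. This splits a chain at B without forming a
  quotient.\<close>

lemma modular_eq:
  assumes S: "subring S R" and "submod S C" "submod S C'" "submod S B" "C \<subseteq> C'" "C \<inter> B = C' \<inter> B" "msum C B = msum C' B"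
  shows "C = C'"
proof
  show "C' \<subseteq> C"
  proof
    fix z assume z: "z \<in> C'"
    then have "z \<in> msum C B" using msum_ge1[OF assms(3,4)] assms(7) by blast
    then obtain a b where *: "a \<in> C" "b \<in> B" "z = a \<oplus> b" by (elim msumE)
    have "b \<in> C'" using submod_cancel[OF assms(3) S, of a b] * assms(5) z submodD(2)[OF assms(4)] by blast
    then have "b \<in> C" using * assms(6) by blast
    then show "z \<in> C" using * submodD(4)[OF assms(2)] by blast
  qed
qed (use assms in auto)

section \<open>Length of a pair of submodules\<close>

definition strict_chain :: "'a set \<Rightarrow> 'a set \<Rightarrow> 'a set \<Rightarrow> nat \<Rightarrow> bool" where
  "strict_chain S A B k \<longleftrightarrow> (\<exists>f. (\<forall>i\<le>k. submod S (f i) \<and> A \<subseteq> f i \<and> f i \<subseteq> B) \<and> (\<forall>i<k. f i \<subset> f (Suc i)))"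

definition fin_len :: "'a set \<Rightarrow> 'a set \<Rightarrow> 'a set \<Rightarrow> bool" where
  "fin_len S A B \<longleftrightarrow> (\<exists>n. \<forall>k. strict_chain S A B k \<longrightarrow> k \<le> n)"

text \<open>The length of B / A, as the largest number of strict steps between A and B. A chain may
  start above A and end below B, so no composition series are involved. The value is meaningful
  under \<open>fin_len\<close>, where \<open>Max\<close> is taken over a finite set.\<close>

definition len :: "'a set \<Rightarrow> 'a set \<Rightarrow> 'a set \<Rightarrow> nat" where
  "len S A B = Max {k. strict_chain S A B k}"

lemma strict_chain_0: "submod S A \<Longrightarrow> A \<subseteq> B \<Longrightarrow> strict_chain S A B 0"
  unfolding strict_chain_def by auto

lemma strict_chain_mono: "strict_chain S A B k \<Longrightarrow> A' \<subseteq> A \<Longrightarrow> B \<subseteq> B' \<Longrightarrow> strict_chain S A' B' k"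
  unfolding strict_chain_def by (meson order_trans)

lemma fin_len_mono: "fin_len S A' B' \<Longrightarrow> A' \<subseteq> A \<Longrightarrow> B \<subseteq> B' \<Longrightarrow> fin_len S A B"
  unfolding fin_len_def using strict_chain_mono by blast

lemma fin_len_finite: "fin_len S A B \<Longrightarrow> finite {k. strict_chain S A B k}"
  unfolding fin_len_def by (metis finite_nat_set_iff_bounded_le mem_Collect_eq)

lemma strict_chain_le_len: "fin_len S A B \<Longrightarrow> strict_chain S A B k \<Longrightarrow> k \<le> len S A B"
  unfolding len_def using fin_len_finite by auto

lemma strict_chain_len: "fin_len S A B \<Longrightarrow> submod S A \<Longrightarrow> A \<subseteq> B \<Longrightarrow> strict_chain S A B (len S A B)"
  unfolding len_def using Max_in[OF fin_len_finite] strict_chain_0 by blast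

lemma strict_chain_concat:
  assumes "strict_chain S A B k" "strict_chain S B C l" "A \<subseteq> B" "B \<subseteq> C" shows "strict_chain S A C (k + l)"
proof -
  obtain f where f: "\<And>i. i\<le>k \<Longrightarrow> submod S (f i) \<and> A \<subseteq> f i \<and> f i \<subseteq> B" "\<And>i. i<k \<Longrightarrow> f i \<subset> f (Suc i)"
    using assms(1) unfolding strict_chain_def by blast
  obtain g where g: "\<And>i. i\<le>l \<Longrightarrow> submod S (g i) \<and> B \<subseteq> g i \<and> g i \<subseteq> C" "\<And>i. i<l \<Longrightarrow> g i \<subset> g (Suc i)"
    using assms(2) unfolding strict_chain_def by blast
  define h where "h i = (if i \<le> k then f i else g (i - k))" for i
  have "submod S (h i) \<and> A \<subseteq> h i \<and> h i \<subseteq> C" if "i \<le> k + l" for i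
  proof (cases "i \<le> k")
    case True then show ?thesis using f(1)[of i] assms(4) unfolding h_def by auto
  next
    case False
    then have "i - k \<le> l" using that by simp
    then show ?thesis using g(1)[of "i - k"] False assms(3) unfolding h_def by auto
  qed
  moreover have "h i \<subset> h (Suc i)" if i: "i < k + l" for i
  proof (cases "i < k")
    case True then show ?thesis using f(2) unfolding h_def by auto
  next
    case False
    then have "Suc i - k = Suc (i - k)" "i - k < l" using i by auto
    then have *: "g (i - k) \<subset> g (Suc i - k)" using g(2) by metis
    show ?thesis
    proof (cases "i = k")
      case True
      have "f k \<subseteq> g 0" using f(1)[of k] g(1)[of 0] by auto
      then show ?thesis using * True unfolding h_def by auto
    next
      case False then show ?thesis using * \<open>\<not> i < k\<close> unfolding h_def by auto
    qed
  qed
  ultimately show ?thesis unfolding strict_chain_def by blast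
qed

text \<open>Dropping repetitions leaves one strict step for each index at which the chain grows. The
  inductive claim also records that the compressed chain ends in \<open>f k\<close>, so that the
  next term can be appended.\<close>

lemma strict_chain_weak:
  assumes "\<And>i. i\<le>k \<Longrightarrow> submod S (f i) \<and> A \<subseteq> f i \<and> f i \<subseteq> B" "\<And>i. i<k \<Longrightarrow> f i \<subseteq> f (Suc i)"
  shows "strict_chain S A B (card {i. i < k \<and> f i \<noteq> f (Suc i)})"
proof -
  have "\<exists>g m. m = card {i. i < k \<and> f i \<noteq> f (Suc i)} \<and> (\<forall>i\<le>m. submod S (g i) \<and> A \<subseteq> g i \<and> g i \<subseteq> B) \<and>
     (\<forall>i<m. g i \<subset> g (Suc i)) \<and> g m = f k"
    using assms
  proof (induction k)
    case 0 then show ?case by (intro exI[of _ "\<lambda>_. f 0"]) auto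
  next
    case (Suc k)
    let ?m = "card {i. i < k \<and> f i \<noteq> f (Suc i)}"
    have "\<exists>g m. m = ?m \<and> (\<forall>i\<le>m. submod S (g i) \<and> A \<subseteq> g i \<and> g i \<subseteq> B) \<and>
       (\<forall>i<m. g i \<subset> g (Suc i)) \<and> g m = f k"
      by (rule Suc.IH) (use Suc.prems in auto)
    then obtain g where g: "\<forall>i\<le>?m. submod S (g i) \<and> A \<subseteq> g i \<and> g i \<subseteq> B"
      "\<forall>i<?m. g i \<subset> g (Suc i)" "g ?m = f k"
      by blast
    show ?case
    proof (cases "f k = f (Suc k)")
      case True
      then have "{i. i < Suc k \<and> f i \<noteq> f (Suc i)} = {i. i < k \<and> f i \<noteq> f (Suc i)}"
        by (auto simp: less_Suc_eq)
      then show ?thesis using g True by auto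
    next
      case False
      then have "{i. i < Suc k \<and> f i \<noteq> f (Suc i)} = insert k {i. i < k \<and> f i \<noteq> f (Suc i)}"
        by (auto simp: less_Suc_eq)
      then have c: "card {i. i < Suc k \<and> f i \<noteq> f (Suc i)} = Suc (card {i. i < k \<and> f i \<noteq> f (Suc i)})"
        by simp
      have 1: "f k \<subset> f (Suc k)" using False Suc.prems(2)[of k] by auto
      show ?thesis
        unfolding c
      proof (intro exI[of _ "g(Suc ?m := f (Suc k))"] exI[of _ "Suc ?m"] conjI allI impI)
        fix i assume i: "i < Suc ?m"
        show "(g(Suc ?m := f (Suc k))) i \<subset> (g(Suc ?m := f (Suc k))) (Suc i)"
        proof (cases "i = ?m")
          case True then show ?thesis using 1 g(3) by simp
        next
          case False then show ?thesis using i g(2) by simp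
        qed
      qed (use g(1) Suc.prems(1)[of "Suc k"] in \<open>auto simp: le_Suc_eq\<close>)
    qed
  qed
  then show ?thesis unfolding strict_chain_def by blast
qed

lemma strict_chain_split:
  assumes S: "subring S R" and c: "strict_chain S A C k" and A: "submod S A" and B: "submod S B" and C: "submod S C"
    and AB: "A \<subseteq> B" "B \<subseteq> C"
  shows "\<exists>k1 k2. strict_chain S A B k1 \<and> strict_chain S B C k2 \<and> k \<le> k1 + k2"
proof -
  obtain f where f: "\<And>i. i\<le>k \<Longrightarrow> submod S (f i) \<and> A \<subseteq> f i \<and> f i \<subseteq> C" "\<And>i. i<k \<Longrightarrow> f i \<subset> f (Suc i)"
    using c unfolding strict_chain_def by blast
  let ?A = "{i. i < k \<and> f i \<inter> B \<noteq> f (Suc i) \<inter> B}" and ?B = "{i. i < k \<and> msum (f i) B \<noteq> msum (f (Suc i)) B}"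
  have 1: "strict_chain S A B (card ?A)"
  proof (rule strict_chain_weak)
    fix i assume "i \<le> k"
    then have i: "submod S (f i)" "A \<subseteq> f i" using f(1)[of i] by auto
    show "submod S (f i \<inter> B) \<and> A \<subseteq> f i \<inter> B \<and> f i \<inter> B \<subseteq> B"
      using submod_Int[OF i(1) B] i(2) AB(1) by blast
  next
    fix i assume "i < k"
    from f(2)[OF this] show "f i \<inter> B \<subseteq> f (Suc i) \<inter> B" by blast
  qed
  have 2: "strict_chain S B C (card ?B)"
  proof (rule strict_chain_weak)
    fix i assume "i \<le> k"
    then have i: "submod S (f i)" "f i \<subseteq> C" using f(1)[of i] by auto
    show "submod S (msum (f i) B) \<and> B \<subseteq> msum (f i) B \<and> msum (f i) B \<subseteq> C"
      using submod_msum[OF S i(1) B] msum_ge2[OF i(1) B] msum_le[OF C i(2) AB(2)] by simp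
  next
    fix i assume "i < k"
    from f(2)[OF this] show "msum (f i) B \<subseteq> msum (f (Suc i)) B" by (intro msum_mono) auto
  qed
  \<comment> \<open>By the modular law each strict step stays strict after intersecting with B or
    after adding B, so the two traces together have at least k strict steps.\<close>
  have "{..<k} \<subseteq> ?A \<union> ?B"
  proof
    fix i assume "i \<in> {..<k}"
    then have "i < k" by simp
    then have "submod S (f i)" "submod S (f (Suc i))" using f(1) by auto
    then have "f i \<inter> B \<noteq> f (Suc i) \<inter> B \<or> msum (f i) B \<noteq> msum (f (Suc i)) B"
      using modular_eq[OF S, of "f i" "f (Suc i)" B] f(2)[OF \<open>i < k\<close>] B by blast
    then show "i \<in> ?A \<union> ?B" using \<open>i < k\<close> by blast
  qed
  then have "k \<le> card (?A \<union> ?B)" using card_mono[of "?A \<union> ?B" "{..<k}"] by simp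
  also have "\<dots> \<le> card ?A + card ?B" by (rule card_Un_le)
  finally show ?thesis using 1 2 by blast
qed

lemma fin_len_trans:
  assumes S: "subring S R" and A: "submod S A" and B: "submod S B" and C: "submod S C"
    and AB: "A \<subseteq> B" "B \<subseteq> C" and "fin_len S A B" "fin_len S B C"
  shows "fin_len S A C"
proof -
  have "k \<le> len S A B + len S B C" if kk: "strict_chain S A C k" for k
  proof -
    obtain k1 k2 where k: "strict_chain S A B k1" "strict_chain S B C k2" "k \<le> k1 + k2"
      using strict_chain_split[OF S kk A B C AB] by blast
    then show ?thesis using strict_chain_le_len[OF assms(7) k(1)] strict_chain_le_len[OF assms(8) k(2)] by linarith
  qed
  then show ?thesis unfolding fin_len_def by blast
qed

lemma len_add:
  assumes S: "subring S R" and A: "submod S A" and B: "submod S B" and C: "submod S C"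
    and AB: "A \<subseteq> B" "B \<subseteq> C" and f: "fin_len S A C"
  shows "len S A C = len S A B + len S B C"
proof (rule antisym)
  have f1: "fin_len S A B" and f2: "fin_len S B C" using f AB fin_len_mono by blast+
  show "len S A C \<le> len S A B + len S B C"
  proof -
    obtain k1 k2 where k: "strict_chain S A B k1" "strict_chain S B C k2" "len S A C \<le> k1 + k2"
      using strict_chain_split[OF S strict_chain_len[OF f A] A B C AB] AB by blast
    then show ?thesis using strict_chain_le_len[OF f1 k(1)] strict_chain_le_len[OF f2 k(2)] by linarith
  qed
  show "len S A B + len S B C \<le> len S A C"
    using strict_chain_le_len[OF f] strict_chain_concat[OF strict_chain_len[OF f1 A AB(1)] strict_chain_len[OF f2 B AB(2)] AB] by blast
qed

lemma strict_chain_scal: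
  assumes S: "subring S R" and z: "z \<in> Units R" and c: "strict_chain S A B k"
  shows "strict_chain S (scal z A) (scal z B) k"
proof -
  obtain f where f: "\<And>i. i\<le>k \<Longrightarrow> submod S (f i) \<and> A \<subseteq> f i \<and> f i \<subseteq> B" "\<And>i. i<k \<Longrightarrow> f i \<subset> f (Suc i)"
    using c unfolding strict_chain_def by blast
  have zc: "z \<in> carrier R" using z by blast
  show ?thesis unfolding strict_chain_def
  proof (intro exI[of _ "\<lambda>i. scal z (f i)"] conjI allI impI)
    fix i assume "i \<le> k"
    then have i: "submod S (f i)" "A \<subseteq> f i" "f i \<subseteq> B" using f(1)[of i] by auto
    show "submod S (scal z (f i))" "scal z A \<subseteq> scal z (f i)" "scal z (f i) \<subseteq> scal z B"
      using submod_scal[OF S i(1) zc] scal_mono[OF i(2)] scal_mono[OF i(3)] by auto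
  next
    fix i assume i: "i < k"
    then have "f i \<subseteq> carrier R" "f (Suc i) \<subseteq> carrier R"
      using f(1)[of i] f(1)[of "Suc i"] submodD(1)[of S "f i"] submodD(1)[of S "f (Suc i)"] by auto
    then show "scal z (f i) \<subset> scal z (f (Suc i))"
      using f(2)[OF i] scal_subset_iff[OF z, of "f i" "f (Suc i)"] scal_subset_iff[OF z, of "f (Suc i)" "f i"]
      by blast
  qed
qed

lemma strict_chain_scal_iff:
  assumes S: "subring S R" and z: "z \<in> Units R" and "A \<subseteq> carrier R" "B \<subseteq> carrier R"
  shows "strict_chain S (scal z A) (scal z B) k \<longleftrightarrow> strict_chain S A B k"
  using strict_chain_scal[OF S z, of A B k] strict_chain_scal[OF S Units_inv_Units[OF z], of "scal z A" "scal z B" k]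
    scal_inv[OF z] assms by auto

lemma fin_len_scal_iff:
  assumes S: "subring S R" and z: "z \<in> Units R" and "A \<subseteq> carrier R" "B \<subseteq> carrier R"
  shows "fin_len S (scal z A) (scal z B) \<longleftrightarrow> fin_len S A B"
  unfolding fin_len_def strict_chain_scal_iff[OF assms] ..

lemma len_scal:
  assumes S: "subring S R" and z: "z \<in> Units R" and "A \<subseteq> carrier R" "B \<subseteq> carrier R"
  shows "len S (scal z A) (scal z B) = len S A B"
  unfolding len_def strict_chain_scal_iff[OF assms] ..

lemma len_strict:
  assumes S: "subring S R" and f: "fin_len S A B" and "submod S A" "submod S N" "submod S N'" "A \<subseteq> N" "N \<subset> N'" "N' \<subseteq> B"
  shows "len S A N < len S A N'"
proof -
  have "strict_chain S N N' 1" unfolding strict_chain_def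
    by (rule exI[of _ "\<lambda>i. if i = 0 then N else N'"]) (use assms in auto)
  then have "strict_chain S A N' (len S A N + 1)"
    using strict_chain_concat[of S A N "len S A N" N' 1] strict_chain_len[of S A N] fin_len_mono[OF f, of A N] assms by auto
  then show ?thesis using strict_chain_le_len[of S A N'] fin_len_mono[OF f, of A N'] assms by fastforce
qed

lemma fin_len_maximal:
  assumes S: "subring S R" and f: "fin_len S A B" and A: "submod S A"
    and F: "\<And>N. N \<in> F \<Longrightarrow> submod S N \<and> A \<subseteq> N \<and> N \<subseteq> B" and ne: "F \<noteq> {}"
  shows "\<exists>N\<in>F. \<forall>N'\<in>F. N \<subseteq> N' \<longrightarrow> N' = N"
proof -
  have b: "len S A N \<le> len S A B" if "N \<in> F" for N
  proof -
    have "strict_chain S A N (len S A N)"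
      using that F strict_chain_len[of S A N] fin_len_mono[OF f, of A N] A by blast
    then show ?thesis using strict_chain_le_len[OF f] strict_chain_mono[of S A N _ A B] F[OF that] by blast
  qed
  obtain N where N: "N \<in> F" "\<And>N'. N' \<in> F \<Longrightarrow> len S A N' \<le> len S A N"
  proof -
    obtain N0 where "N0 \<in> F" using ne by blast
    then show ?thesis
      using ex_has_greatest_nat[of "\<lambda>N. N \<in> F" N0 "len S A" "Suc (len S A B)"] b that
      by (metis le_imp_less_Suc)
  qed
  have "N' = N" if "N' \<in> F" "N \<subseteq> N'" for N'
    using len_strict[OF S f A, of N N'] F[of N] F[of N'] N that by (metis leD psubsetI)
  then show ?thesis using N(1) by blast
qed

lemma fin_len_dcc:
  assumes S: "subring S R" and f: "fin_len S A B" and A: "submod S A"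
    and F: "\<And>i::nat. submod S (g i) \<and> A \<subseteq> g i \<and> g i \<subseteq> B" and d: "\<And>i. g (Suc i) \<subseteq> g i"
  shows "\<exists>n. \<forall>m\<ge>n. g m = g n"
proof -
  define n where "n = (ARG_MIN (\<lambda>i. len S A (g i)) i. True)"
  have n: "len S A (g n) \<le> len S A (g m)" for m
    unfolding n_def by (rule arg_min_nat_le) simp
  have "g m = g n" if "n \<le> m" for m
  proof (rule ccontr)
    assume "g m \<noteq> g n"
    then have "g m \<subset> g n" using lift_Suc_antimono_le[of g, OF d that] by blast
    then have "len S A (g m) < len S A (g n)"
      using len_strict[OF S f A, of "g m" "g n"] F[of n] F[of m] by blast
    then show False using n[of m] by simp
  qed
  then show ?thesis by blast
qed

text \<open>The explicit bound on the index is what makes the degree of the integral equations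
  uniform in \<open>pow_bound\<close>.\<close>

lemma fin_len_acc:
  assumes S: "subring S R" and f: "fin_len S A B" and A: "submod S A"
    and F: "\<And>i::nat. submod S (g i) \<and> A \<subseteq> g i \<and> g i \<subseteq> B" and d: "\<And>i. g i \<subseteq> g (Suc i)"
  shows "\<exists>n\<le>len S A B. g (Suc n) = g n"
proof (rule ccontr)
  assume "\<not> ?thesis"
  then have "\<And>n. n \<le> len S A B \<Longrightarrow> g n \<subset> g (Suc n)" using d by (metis psubsetI)
  then have "strict_chain S A B (Suc (len S A B))"
    unfolding strict_chain_def using F by (intro exI[of _ g]) auto
  then show False using strict_chain_le_len[OF f] by fastforce
qed

section \<open>Products of submodules and spans of powers\<close>

definition modprod :: "'a set \<Rightarrow> 'a set \<Rightarrow> 'a set \<Rightarrow> 'a set" where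
  "modprod S A A' = \<Inter>{N. submod S N \<and> (\<forall>a\<in>A. \<forall>a'\<in>A'. a \<otimes> a' \<in> N)}"

lemma modprod_mem: "a \<in> A \<Longrightarrow> a' \<in> A' \<Longrightarrow> a \<otimes> a' \<in> modprod S A A'"
  unfolding modprod_def by blast

lemma modprod_least: "submod S N \<Longrightarrow> (\<And>a a'. a \<in> A \<Longrightarrow> a' \<in> A' \<Longrightarrow> a \<otimes> a' \<in> N) \<Longrightarrow> modprod S A A' \<subseteq> N"
  unfolding modprod_def by blast

lemma submod_modprod:
  assumes S: "subring S R" and "A \<subseteq> carrier R" "A' \<subseteq> carrier R" shows "submod S (modprod S A A')"
proof -
  have "carrier R \<in> {N. submod S N \<and> (\<forall>a\<in>A. \<forall>a'\<in>A'. a \<otimes> a' \<in> N)}"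
    using submod_carrier[OF S] assms(2,3) by auto
  then show ?thesis
    unfolding modprod_def
    using submod_INT[of "{N. submod S N \<and> (\<forall>a\<in>A. \<forall>a'\<in>A'. a \<otimes> a' \<in> N)}" S id] by force
qed

lemma submod_preimage:
  assumes S: "subring S R" and N: "submod S N" and z: "z \<in> carrier R"
  shows "submod S {a \<in> carrier R. z \<otimes> a \<in> N}"
proof (rule submodI)
  show "\<zero> \<in> {a \<in> carrier R. z \<otimes> a \<in> N}" using submodD(3)[OF N] z by simp
next
  fix a b assume "a \<in> {a \<in> carrier R. z \<otimes> a \<in> N}" "b \<in> {a \<in> carrier R. z \<otimes> a \<in> N}"
  then show "a \<oplus> b \<in> {a \<in> carrier R. z \<otimes> a \<in> N}" using submodD(4)[OF N] z by (simp add: r_distr)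
next
  fix s a assume s: "s \<in> S" and a: "a \<in> {a \<in> carrier R. z \<otimes> a \<in> N}"
  have sc: "s \<in> carrier R" using subringE(1)[OF S] s by blast
  have "z \<otimes> (s \<otimes> a) = s \<otimes> (z \<otimes> a)" using a z sc by (simp add: m_lcomm)
  then show "s \<otimes> a \<in> {a \<in> carrier R. z \<otimes> a \<in> N}" using submodD(5)[OF N s] a sc by simp
qed auto

lemma submod_Union_chain:
  assumes "\<And>n::nat. submod S (f n)" "\<And>n. f n \<subseteq> f (Suc n)" shows "submod S (\<Union>n. f n)"
proof (rule submodI)
  show "(\<Union>n. f n) \<subseteq> carrier R" using submodD(1)[OF assms(1)] by blast
  show "\<zero> \<in> (\<Union>n. f n)" using submodD(3)[OF assms(1)] by blast
next
  fix a b assume "a \<in> (\<Union>n. f n)" "b \<in> (\<Union>n. f n)"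
  then obtain n m where "a \<in> f n" "b \<in> f m" by blast
  then have "a \<in> f (max n m)" "b \<in> f (max n m)"
    using lift_Suc_mono_le[of f, OF assms(2), of n "max n m"] lift_Suc_mono_le[of f, OF assms(2), of m "max n m"]
    by auto
  then show "a \<oplus> b \<in> (\<Union>n. f n)" using submodD(4)[OF assms(1)] by blast
next
  fix s a assume "s \<in> S" "a \<in> (\<Union>n. f n)"
  then show "s \<otimes> a \<in> (\<Union>n. f n)" using submodD(5)[OF assms(1)] by blast
qed

text \<open>Horner form of S + S b + ... + S b^m. Thus membership of b^(m + 1) in
  \<open>powspan S b m\<close> is a monic equation of degree m + 1 for b over S.\<close>

primrec powspan :: "'a set \<Rightarrow> 'a \<Rightarrow> nat \<Rightarrow> 'a set" where
  "powspan S b 0 = S"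
| "powspan S b (Suc m) = msum S (scal b (powspan S b m))"

lemma submod_powspan: "subring S R \<Longrightarrow> b \<in> carrier R \<Longrightarrow> submod S (powspan S b m)"
  by (induction m) (simp_all add: submod_self submod_msum submod_scal)

lemma powspan_Suc_ge:
  assumes S: "subring S R" and b: "b \<in> carrier R" shows "powspan S b m \<subseteq> powspan S b (Suc m)"
proof (induction m)
  case 0 show ?case using msum_ge1[OF submod_self[OF S] submod_scal[OF S submod_self[OF S] b]] by simp
next
  case (Suc m)
  from msum_mono[OF subset_refl scal_mono[OF this]] show ?case by simp
qed

lemma powspan_mono: "subring S R \<Longrightarrow> b \<in> carrier R \<Longrightarrow> m \<le> n \<Longrightarrow> powspan S b m \<subseteq> powspan S b n"
  using lift_Suc_mono_le[of "powspan S b" m n] powspan_Suc_ge by blast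

lemma powspan_mult:
  assumes S: "subring S R" and b: "b \<in> carrier R" and w: "w \<in> powspan S b m" shows "b \<otimes> w \<in> powspan S b (Suc m)"
proof -
  have "\<zero> \<oplus> b \<otimes> w \<in> powspan S b (Suc m)"
    using msumI[OF subringE(2)[OF S] scalI[OF w, of b]] by simp
  then show ?thesis using submodD(2)[OF submod_powspan[OF S b] w] b by simp
qed

lemma pow_in_powspan: "subring S R \<Longrightarrow> b \<in> carrier R \<Longrightarrow> b [^] m \<in> powspan S b m"
proof (induction m)
  case 0 then show ?case using subringE(3) by simp
next
  case (Suc m) then show ?case using powspan_mult[of S b "b [^] m" m] by (simp add: m_comm)
qed

lemma powspan_least:
  assumes "submod S A" "\<one> \<in> A" "\<And>a. a \<in> A \<Longrightarrow> b \<otimes> a \<in> A" "subring S R"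
  shows "powspan S b m \<subseteq> A"
proof (induction m)
  case 0
  have "s \<in> A" if "s \<in> S" for s
  proof -
    have "s \<otimes> \<one> \<in> A" using submodD(5)[OF assms(1) that assms(2)] .
    moreover have "s \<otimes> \<one> = s" using subringE(1)[OF assms(4)] that by auto
    ultimately show ?thesis by simp
  qed
  then show ?case by auto
next
  case (Suc m)
  have "S \<subseteq> A" using Suc powspan_mono[of S b 0 m] by (metis (no_types, lifting) assms(1,2,4) r_one submodD(2,5) subringE(1) subsetD subsetI)
  moreover have "scal b (powspan S b m) \<subseteq> A" using Suc assms(3) unfolding scal_def by blast
  ultimately show ?case using msum_le[OF assms(1)] by simp
qed

section \<open>Integer powers of units\<close>

definition zpow :: "'a \<Rightarrow> int \<Rightarrow> 'a" where "zpow t k = t [^]\<^bsub>units_of R\<^esub> k"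

lemma zpow_Units [simp]: "t \<in> Units R \<Longrightarrow> zpow t k \<in> Units R"
  unfolding zpow_def using group.int_pow_closed[OF units_group, of t k] by (simp add: units_of_carrier)

lemma zpow_closed [simp]: "t \<in> Units R \<Longrightarrow> zpow t k \<in> carrier R"
  by (simp add: Units_closed)

lemma zpow_add: "t \<in> Units R \<Longrightarrow> zpow t (k + l) = zpow t k \<otimes> zpow t l"
  unfolding zpow_def using group.int_pow_mult[OF units_group, of t k l] by (simp add: units_of_carrier units_of_mult)

lemma zpow_0 [simp]: "zpow t 0 = \<one>"
  unfolding zpow_def by (simp add: units_of_one)

lemma zpow_nat: "t \<in> Units R \<Longrightarrow> zpow t (int n) = t [^] n"
  unfolding zpow_def by (simp add: int_pow_int units_of_pow)

lemma zpow_1: "t \<in> Units R \<Longrightarrow> zpow t 1 = t"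
  using zpow_nat[of t 1] by (simp add: Units_closed)

lemma zpow_minus: "t \<in> Units R \<Longrightarrow> zpow t (- k) \<otimes> zpow t k = \<one>" "t \<in> Units R \<Longrightarrow> zpow t k \<otimes> zpow t (- k) = \<one>"
  by (simp_all flip: zpow_add)

lemma zpow_cancel: "t \<in> Units R \<Longrightarrow> y \<in> carrier R \<Longrightarrow> zpow t (- k) \<otimes> (zpow t k \<otimes> y) = y"
  "t \<in> Units R \<Longrightarrow> y \<in> carrier R \<Longrightarrow> zpow t k \<otimes> (zpow t (- k) \<otimes> y) = y"
  by (simp_all add: m_assoc[symmetric] zpow_minus)

lemma zpow_neg1: "t \<in> Units R \<Longrightarrow> zpow t (- 1) = inv t"
  using zpow_minus[of t 1] zpow_1[of t] by (metis Units_closed Units_inv_Units Units_r_inv inv_unique zpow_closed)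

lemma Units_iff_inv: "\<lbrakk>y \<in> carrier R; z \<in> carrier R; y \<otimes> z = \<one>\<rbrakk> \<Longrightarrow> y \<in> Units R \<and> inv y = z"
  by (metis (mono_tags, lifting) Units_def comm_inv_char m_comm mem_Collect_eq)

lemma inv_mult: "y \<in> Units R \<Longrightarrow> z \<in> Units R \<Longrightarrow> inv (y \<otimes> z) = inv y \<otimes> inv z"
proof -
  assume u: "y \<in> Units R" "z \<in> Units R"
  have c: "y \<in> carrier R" "z \<in> carrier R" "inv y \<in> carrier R" "inv z \<in> carrier R" using u by auto
  have "(y \<otimes> z) \<otimes> (inv y \<otimes> inv z) = (y \<otimes> inv y) \<otimes> (z \<otimes> inv z)" using c by algebra
  then have "(y \<otimes> z) \<otimes> (inv y \<otimes> inv z) = \<one>" using u by simp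
  then show ?thesis using Units_iff_inv[of "y \<otimes> z" "inv y \<otimes> inv z"] c by simp
qed

section \<open>Comparison with ideals and cosets of a subring\<close>

lemma additive_subgroup_submod:
  assumes S: "subring S R"
  shows "additive_subgroup N R \<and> (\<forall>a\<in>S. \<forall>y\<in>N. a \<otimes> y \<in> N) \<longleftrightarrow> submod S N"
proof
  assume "additive_subgroup N R \<and> (\<forall>a\<in>S. \<forall>y\<in>N. a \<otimes> y \<in> N)"
  then have N: "additive_subgroup N R" "\<forall>a\<in>S. \<forall>y\<in>N. a \<otimes> y \<in> N" by auto
  interpret additive_subgroup N R by (rule N(1))
  show "submod S N" using a_subset zero_closed a_closed N(2) by (intro submodI) auto
next
  assume N: "submod S N"
  have "subgroup N (add_monoid R)"
    using submodD[OF N] submod_minus[OF N S] by (intro add.subgroupI) (auto simp: a_inv_def)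
  then show "additive_subgroup N R \<and> (\<forall>a\<in>S. \<forall>y\<in>N. a \<otimes> y \<in> N)"
    using submodD(5)[OF N] by (auto intro: additive_subgroup.intro)
qed

lemma coset_eq_iff:
  assumes S: "subring S R" and N: "submod S N" and a: "a \<in> carrier R" and b: "b \<in> carrier R"
  shows "N +> a = N +> b \<longleftrightarrow> a \<ominus> b \<in> N"
proof
  assume e: "N +> a = N +> b"
  have "\<zero> \<oplus> a \<in> N +> a" unfolding a_r_coset_def' using submodD(3)[OF N] by blast
  then have "\<zero> \<oplus> a \<in> N +> b" unfolding e .
  then obtain n where n: "n \<in> N" "\<zero> \<oplus> a = n \<oplus> b" unfolding a_r_coset_def' by auto
  have nC: "n \<in> carrier R" using submodD(2)[OF N n(1)] .
  have "a \<ominus> b = (\<zero> \<oplus> a) \<ominus> b" using a by simp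
  also have "\<dots> = n" unfolding n(2) using nC b by algebra
  finally show "a \<ominus> b \<in> N" using n by simp
next
  have sub: "N +> a \<subseteq> N +> b" if ab: "a \<ominus> b \<in> N" and a: "a \<in> carrier R" and b: "b \<in> carrier R" for a b
  proof
    fix y assume "y \<in> N +> a"
    then obtain n where n: "n \<in> N" "y = n \<oplus> a" unfolding a_r_coset_def' by blast
    have nC: "n \<in> carrier R" using submodD(2)[OF N n(1)] .
    have "y = (n \<oplus> (a \<ominus> b)) \<oplus> b" unfolding n(2) using nC a b by algebra
    moreover have "n \<oplus> (a \<ominus> b) \<in> N" using submodD(4)[OF N n(1) ab] .
    ultimately show "y \<in> N +> b" unfolding a_r_coset_def' by blast
  qed
  assume ab: "a \<ominus> b \<in> N"
  have "b \<ominus> a = \<ominus> (a \<ominus> b)" using a b by algebra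
  then have "b \<ominus> a \<in> N" using submod_minus[OF N S ab] by simp
  then show "N +> a = N +> b" using sub[OF ab a b] sub[OF _ b a] by blast
qed

lemma coset_subring: "N +>\<^bsub>R\<lparr>carrier := S\<rparr>\<^esub> a = N +> a"
  by (simp add: a_r_coset_def')

lemma ideal_subring_iff:
  assumes S: "subring S R"
  shows "ideal N (R\<lparr>carrier := S\<rparr>) \<longleftrightarrow> submod S N \<and> N \<subseteq> S"
proof -
  let ?A = "R\<lparr>carrier := S\<rparr>"
  have cr: "cring ?A" using subcring_iff[OF subringE(1)[OF S]] subcringI'[OF S] by simp
  interpret A: cring ?A by fact
  have SA: "subring S ?A" using A.carrier_is_subring by simp
  have sm: "A.submod S N \<longleftrightarrow> submod S N \<and> N \<subseteq> S"
    unfolding A.submod_def submod_def using subringE(1)[OF S] by auto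
  show ?thesis
  proof
    assume "ideal N ?A"
    then have "additive_subgroup N ?A" "\<forall>a\<in>S. \<forall>y\<in>N. a \<otimes> y \<in> N"
      using ideal.axioms(1) ideal.I_l_closed[of N ?A] by auto
    then show "submod S N \<and> N \<subseteq> S" using A.additive_subgroup_submod[OF SA, of N] sm by simp
  next
    assume N: "submod S N \<and> N \<subseteq> S"
    then have "additive_subgroup N ?A" using A.additive_subgroup_submod[OF SA, of N] sm by simp
    moreover have "s \<otimes> y \<in> N" "y \<otimes> s \<in> N" if "s \<in> S" "y \<in> N" for s y
    proof -
      show 1: "s \<otimes> y \<in> N" using submodD(5) N that by blast
      have "s \<in> carrier R" "y \<in> carrier R" using that subringE(1)[OF S] N by auto
      then show "y \<otimes> s \<in> N" using 1 m_comm by simp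
    qed
    ultimately show "ideal N ?A"
      unfolding ideal_def ideal_axioms_def using A.ring_axioms by simp
  qed
qed

lemma primeideal_subring_iff:
  assumes S: "subring S R"
  shows "primeideal N (R\<lparr>carrier := S\<rparr>) \<longleftrightarrow>
    submod S N \<and> N \<subseteq> S \<and> \<one> \<notin> N \<and> (\<forall>a\<in>S. \<forall>b\<in>S. a \<otimes> b \<in> N \<longrightarrow> a \<in> N \<or> b \<in> N)"
proof -
  have cr: "cring (R\<lparr>carrier := S\<rparr>)" using subcring_iff[OF subringE(1)[OF S]] subcringI'[OF S] by simp
  have one: "S \<noteq> N \<longleftrightarrow> \<one> \<notin> N" if N: "submod S N" "N \<subseteq> S"
  proof
    assume ne: "S \<noteq> N"
    show "\<one> \<notin> N"
    proof
      assume 1: "\<one> \<in> N"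
      have "s \<in> N" if "s \<in> S" for s
        using submodD(5)[OF N(1) that 1] subringE(1)[OF S] that by auto
      then show False using ne N by blast
    qed
  qed (use subringE(3)[OF S] in blast)
  show ?thesis
    unfolding primeideal_def primeideal_axioms_def ideal_subring_iff[OF S] using cr one by auto
qed

end

section \<open>One-dimensional analytically reduced local rings\<close>

text \<open>What is used of a one-dimensional Cohen-Macaulay local ring with reduced completion: x
  is a regular element of M, \<open>prime_M\<close> is the dimension hypothesis, and
  \<open>Mp n\<close> stands for \<open>M^n\<close>, known through its recursion. In
  \<open>complete_reduced\<close> the sequence u is an element of the completion, which has to
  vanish once its e-th power does.\<close>

locale one_dim = cring Q for Q (structure) +
  fixes R M :: "'a set" and x :: 'a and Mp :: "nat \<Rightarrow> 'a set"
  assumes R: "subring R Q"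
    and frac: "y \<in> carrier Q \<Longrightarrow> \<exists>s\<in>R \<inter> Units Q. y \<otimes> s \<in> R"
    and M: "submod R M" and MR: "M \<subseteq> R" and one_M: "\<one> \<notin> M"
    and unit_R: "a \<in> R \<Longrightarrow> a \<notin> M \<Longrightarrow> a \<in> Units Q \<and> inv a \<in> R"
    and xM: "x \<in> M" and xU: "x \<in> Units Q"
    and noeth: "F \<noteq> {} \<Longrightarrow> (\<And>N. N \<in> F \<Longrightarrow> submod R N \<and> N \<subseteq> R) \<Longrightarrow> \<exists>N\<in>F. \<forall>N'\<in>F. N \<subseteq> N' \<longrightarrow> N' = N"
    and prime_M: "submod R P \<Longrightarrow> P \<subseteq> R \<Longrightarrow> \<one> \<notin> P \<Longrightarrow>
       (\<And>a b. a \<in> R \<Longrightarrow> b \<in> R \<Longrightarrow> a \<otimes> b \<in> P \<Longrightarrow> a \<in> P \<or> b \<in> P) \<Longrightarrow> s \<in> P \<Longrightarrow> s \<in> Units Q \<Longrightarrow> M \<subseteq> P"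
    and Mp_submod: "submod R (Mp n)" and Mp_0: "Mp 0 = R"
    and Mp_mult: "a \<in> M \<Longrightarrow> b \<in> Mp n \<Longrightarrow> a \<otimes> b \<in> Mp (Suc n)"
    and Mp_least: "submod R N \<Longrightarrow> (\<And>a b. a \<in> M \<Longrightarrow> b \<in> Mp n \<Longrightarrow> a \<otimes> b \<in> N) \<Longrightarrow> Mp (Suc n) \<subseteq> N"
    and complete_reduced: "(\<And>n. u n \<in> R) \<Longrightarrow> (\<And>n. u (Suc n) \<ominus> u n \<in> Mp n) \<Longrightarrow>
       (\<And>n. u n [^] (e::nat) \<in> Mp n) \<Longrightarrow> u n \<in> Mp n"
begin

lemma RC: "a \<in> R \<Longrightarrow> a \<in> carrier Q" using subringE(1)[OF R] by blast
lemma xR: "x \<in> R" using xM MR by blast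
lemma xC: "x \<in> carrier Q" using xR RC by blast
lemmas R_closed = subringE(2,3,5,6,7)[OF R]
lemma R_self: "submod R R" using submod_self[OF R] .
lemma Rpow: "a \<in> R \<Longrightarrow> a [^] (n::nat) \<in> R"
  by (induction n) (auto simp: R_closed)
lemma xpU [simp]: "x [^] (n::nat) \<in> Units Q" using xU by (rule Units_pow_closed)
lemma xpC [simp]: "x [^] (n::nat) \<in> carrier Q" using xC by simp
lemma xpR [simp]: "x [^] (n::nat) \<in> R" using xR by (rule Rpow)
lemma xpMp: "x [^] (n::nat) \<in> Mp n"
proof (induction n)
  case 0 then show ?case using Mp_0 R_closed by simp
next
  case (Suc n) then show ?case using Mp_mult[OF xM Suc] xC by (simp add: m_comm)
qed

section \<open>Finite length modulo regular ideals\<close>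

lemma simple_step:
  assumes N: "submod R N" and g: "g \<in> carrier Q" and Mg: "\<And>a. a \<in> M \<Longrightarrow> a \<otimes> g \<in> N"
  shows "fin_len R N (msum N (scal g R))"
proof -
  have 1: "Z = N \<or> Z = msum N (scal g R)" if Z: "submod R Z" "N \<subseteq> Z" "Z \<subseteq> msum N (scal g R)" for Z
  proof (cases "Z = N")
    case False
    then obtain z where z: "z \<in> Z" "z \<notin> N" using Z by blast
    then obtain a r where ar: "a \<in> N" "r \<in> R" "z = a \<oplus> g \<otimes> r" using Z(3) unfolding msum_def scal_def by blast
    have "g \<otimes> r \<in> Z"
      using submod_cancel[OF Z(1) R, of a "g \<otimes> r"] ar z Z(2) g RC by auto
    \<comment> \<open>As M g \<subseteq> N, a coefficient r in M would put z into N. Outside M it is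
      a unit of R, so g itself lies in Z and Z is everything.\<close>
    have "r \<notin> M"
    proof
      assume "r \<in> M"
      from Mg[OF this] have "g \<otimes> r \<in> N" using g RC[OF ar(2)] by (simp add: m_comm)
      then show False using submodD(4)[OF N ar(1)] ar(3) z(2) by blast
    qed
    then have r: "r \<in> Units Q" "inv r \<in> R" using unit_R ar(2) by auto
    have gZ: "g \<in> Z"
    proof -
      have "inv r \<otimes> (g \<otimes> r) \<in> Z" using submodD(5)[OF Z(1) r(2)] \<open>g \<otimes> r \<in> Z\<close> .
      moreover have "inv r \<otimes> (g \<otimes> r) = g"
        using r(1) g RC[OF r(2)] RC[OF ar(2)] by (simp add: m_lcomm[of "inv r" g r])
      ultimately show ?thesis by simp
    qed
    have "scal g R \<subseteq> Z"
    proof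
      fix y assume "y \<in> scal g R"
      then obtain t where t: "t \<in> R" "y = g \<otimes> t" by (rule scalE)
      then show "y \<in> Z" using submodD(5)[OF Z(1) t(1) gZ] g RC[OF t(1)] by (simp add: m_comm)
    qed
    then show ?thesis using msum_le[OF Z(1,2)] Z(3) by blast
  qed simp
  have "k \<le> 1" if kk: "strict_chain R N (msum N (scal g R)) k" for k
  proof (rule ccontr)
    assume "\<not> k \<le> 1"
    obtain f where f: "\<And>i. i\<le>k \<Longrightarrow> submod R (f i) \<and> N \<subseteq> f i \<and> f i \<subseteq> msum N (scal g R)" "\<And>i. i<k \<Longrightarrow> f i \<subset> f (Suc i)"
      using kk unfolding strict_chain_def by blast
    have "f 0 \<subset> f 1" "f 1 \<subset> f 2" using f(2)[of 0] f(2)[of 1] \<open>\<not> k \<le> 1\<close> by (auto simp: numeral_2_eq_2)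
    moreover have "f i = N \<or> f i = msum N (scal g R)" if "i \<le> 2" for i
      using 1[of "f i"] f(1)[of i] that \<open>\<not> k \<le> 1\<close> by auto
    from this[of 0] this[of 1] this[of 2] have "f 0 = N \<or> f 0 = msum N (scal g R)"
      "f 1 = N \<or> f 1 = msum N (scal g R)" "f 2 = N \<or> f 2 = msum N (scal g R)" by auto
    moreover have "N \<subseteq> f 0" using f(1)[of 0] by auto
    ultimately show False by (metis psubsetE psubset_trans)
  qed
  then show ?thesis unfolding fin_len_def by blast
qed

lemma fin_len_refl: "fin_len R N N"
proof -
  have "k \<le> 0" if kk: "strict_chain R N N k" for k
  proof (rule ccontr)
    assume "\<not> k \<le> 0"
    obtain f where f: "\<And>i. i\<le>k \<Longrightarrow> submod R (f i) \<and> N \<subseteq> f i \<and> f i \<subseteq> N" "\<And>i. i<k \<Longrightarrow> f i \<subset> f (Suc i)"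
      using kk unfolding strict_chain_def by blast
    have k: "0 \<le> k" "Suc 0 \<le> k" "0 < k" using \<open>\<not> k \<le> 0\<close> by simp_all
    have "f 0 = N" "f (Suc 0) = N" using f(1)[OF k(1)] f(1)[OF k(2)] by blast+
    then show False using f(2)[OF k(3)] by simp
  qed
  then show ?thesis unfolding fin_len_def by blast
qed

text \<open>Noetherian induction. Let N' be maximal among the counterexamples above N. An element g
  outside N' with maximal annihilator modulo N' has a prime annihilator; it contains the regular
  element s, hence M. Then N' + Rg is no counterexample, and one simple step leads back to
  N'.\<close>

lemma artin:
  assumes N: "submod R N" "N \<subseteq> R" and s: "s \<in> N" "s \<in> Units Q"
  shows "fin_len R N R \<and> (\<exists>m. Mp m \<subseteq> N)"
proof (rule ccontr)
  assume bad: "\<not> ?thesis"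
  define F where "F = {N'. submod R N' \<and> N \<subseteq> N' \<and> N' \<subseteq> R \<and> \<not> (fin_len R N' R \<and> (\<exists>m. Mp m \<subseteq> N'))}"
  have FI: "K \<in> F \<longleftrightarrow> submod R K \<and> N \<subseteq> K \<and> K \<subseteq> R \<and> \<not> (fin_len R K R \<and> (\<exists>m. Mp m \<subseteq> K))" for K
    unfolding F_def by simp
  have "F \<noteq> {}" using bad N FI[of N] by blast
  then have "\<exists>N\<in>F. \<forall>N'\<in>F. N \<subseteq> N' \<longrightarrow> N' = N" by (rule noeth) (simp add: FI)
  then obtain N' where N': "N' \<in> F" and max: "\<forall>N''\<in>F. N' \<subseteq> N'' \<longrightarrow> N'' = N'" by (rule bexE)
  have m: "submod R N'" and NN: "N \<subseteq> N'" "N' \<subseteq> R" and nb: "\<not> (fin_len R N' R \<and> (\<exists>m. Mp m \<subseteq> N'))"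
    using N' FI[of N'] by simp_all
  have "N' \<noteq> R" using nb Mp_0 fin_len_refl by (metis subset_refl)
  have one: "\<one> \<notin> N'"
  proof
    assume 1: "\<one> \<in> N'"
    have "r \<in> N'" if "r \<in> R" for r
      using submodD(5)[OF m that 1] RC[OF that] by simp
    then show False using \<open>N' \<noteq> R\<close> NN by blast
  qed
  define an where "an g = {a \<in> carrier Q. g \<otimes> a \<in> N'} \<inter> R" for g
  have an: "submod R (an g)" "an g \<subseteq> R" if "g \<in> R" for g
    unfolding an_def using submod_Int[OF submod_preimage[OF R m RC[OF that]] R_self] by auto
  have anI: "a \<in> an g \<longleftrightarrow> a \<in> R \<and> g \<otimes> a \<in> N'" for a g unfolding an_def using RC by auto
  obtain g where g: "g \<in> R" "g \<notin> N'" and gmax: "\<And>h. h \<in> R \<Longrightarrow> h \<notin> N' \<Longrightarrow> an g \<subseteq> an h \<Longrightarrow> an h = an g"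
  proof -
    have ne: "an ` (R - N') \<noteq> {}" using one R_closed by blast
    have "\<exists>N\<in>an ` (R - N'). \<forall>N''\<in>an ` (R - N'). N \<subseteq> N'' \<longrightarrow> N'' = N"
      by (rule noeth[OF ne]) (use an in auto)
    then obtain g where "g \<in> R - N'" "\<forall>h\<in>R - N'. an g \<subseteq> an h \<longrightarrow> an h = an g" by auto
    then show ?thesis using that[of g] by blast
  qed
  have "M \<subseteq> an g"
  proof (rule prime_M[OF an[OF g(1)]])
    show "\<one> \<notin> an g" using anI g RC by auto
    show "s \<in> an g" using anI submodD(5)[OF m g(1)] s(1) NN by blast
    show "s \<in> Units Q" by fact
    fix a b assume ab: "a \<in> R" "b \<in> R" "a \<otimes> b \<in> an g"
    show "a \<in> an g \<or> b \<in> an g"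
    proof (cases "a \<in> an g")
      case False
      then have ga: "g \<otimes> a \<notin> N'" "g \<otimes> a \<in> R" using anI ab g R_closed by auto
      have "an g \<subseteq> an (g \<otimes> a)"
      proof
        fix c assume c: "c \<in> an g"
        then have "a \<otimes> (g \<otimes> c) \<in> N'" using anI submodD(5)[OF m ab(1)] by blast
        moreover have "a \<otimes> (g \<otimes> c) = g \<otimes> a \<otimes> c" using c g ab anI RC by (simp add: m_ac)
        ultimately show "c \<in> an (g \<otimes> a)" using anI c by simp
      qed
      then have "an (g \<otimes> a) = an g" using gmax ga by blast
      moreover have "b \<in> an (g \<otimes> a)" using anI ab g RC by (simp add: m_assoc)
      ultimately show ?thesis by simp
    qed simp
  qed
  then have Mg: "a \<otimes> g \<in> N'" if "a \<in> M" for a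
  proof -
    have "a \<in> R" "g \<otimes> a \<in> N'" using that \<open>M \<subseteq> an g\<close> anI by auto
    then show ?thesis using RC g m_comm by metis
  qed
  let ?N = "msum N' (scal g R)"
  have gR: "submod R (scal g R)" using submod_scal[OF R R_self RC[OF g(1)]] .
  have n: "submod R ?N" "N' \<subseteq> ?N" using submod_msum[OF R m gR] msum_ge1[OF m gR] by auto
  have "scal g R \<subseteq> R" using g R_closed unfolding scal_def by auto
  then have nR: "?N \<subseteq> R" using msum_le[OF R_self NN(2)] by blast
  have "g \<in> scal g R" using scalI[of \<one> R g] R_closed g RC by simp
  then have "g \<in> ?N" using msum_ge2[OF m gR] by blast
  then have "?N \<noteq> N'" using g by blast
  then have "?N \<notin> F" using max n by blast
  then have "fin_len R ?N R \<and> (\<exists>m. Mp m \<subseteq> ?N)" using FI[of ?N] n nR NN by (simp add: subset_trans[OF NN(1) n(2)])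
  then obtain k where k: "fin_len R ?N R" "Mp k \<subseteq> ?N" by blast
  have "fin_len R N' R"
    using fin_len_trans[OF R m n(1) R_self n(2) nR simple_step[OF m RC[OF g(1)] Mg] k(1)] .
  moreover have "Mp (Suc k) \<subseteq> N'"
  proof (rule Mp_least[OF m])
    fix a b assume ab: "a \<in> M" "b \<in> Mp k"
    then have "b \<in> ?N" using k by blast
    then obtain c r where c: "c \<in> N'" "r \<in> R" "b = c \<oplus> g \<otimes> r" unfolding msum_def scal_def by blast
    have aR: "a \<in> R" using ab MR by blast
    have "a \<otimes> b = a \<otimes> c \<oplus> r \<otimes> (a \<otimes> g)"
      using c aR g RC submodD(2)[OF m c(1)] by (simp add: r_distr m_ac)
    then show "a \<otimes> b \<in> N'"
      using submodD(4)[OF m submodD(5)[OF m aR c(1)] submodD(5)[OF m c(2) Mg[OF ab(1)]]] by simp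
  qed
  ultimately show False using nb by blast
qed

lemma scalR: "z \<in> R \<Longrightarrow> submod R (scal z R) \<and> scal z R \<subseteq> R \<and> z \<in> scal z R"
  using submod_scal[OF R R_self RC, of z] scalI[of \<one> R z] R_closed RC
  unfolding scal_def by force

lemma artin_scal:
  assumes "z \<in> R" "z \<in> Units Q" shows "fin_len R (scal z R) R" "\<exists>m. Mp m \<subseteq> scal z R"
  using artin[of "scal z R" z] scalR assms by blast+

text \<open>Q arises from R by inverting x alone: any regular denominator s divides a power of x,
  because sR contains a power of M.\<close>

lemma xpow_frac:
  assumes y: "y \<in> carrier Q" shows "\<exists>n. x [^] (n::nat) \<otimes> y \<in> R"
proof -
  obtain s where s: "s \<in> R" "s \<in> Units Q" "y \<otimes> s \<in> R" using frac[OF y] by blast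
  obtain m where "Mp m \<subseteq> scal s R" using artin_scal s by blast
  then obtain c where c: "c \<in> R" "x [^] m = s \<otimes> c" using xpMp scalE by (metis subsetD)
  have "x [^] m \<otimes> y = (y \<otimes> s) \<otimes> c" using c y s RC by (simp add: m_ac)
  then show ?thesis using s c R_closed by metis
qed

lemma xpow_mono:
  assumes N: "submod R N" and "x [^] (n::nat) \<otimes> y \<in> N" "y \<in> carrier Q" "n \<le> m" shows "x [^] m \<otimes> y \<in> N"
proof -
  have "x [^] m \<otimes> y = x [^] (m - n) \<otimes> (x [^] n \<otimes> y)"
    using assms xC by (simp add: m_assoc[symmetric] nat_pow_mult)
  then show ?thesis using submodD(5)[OF N xpR assms(2)] by simp
qed

text \<open>The integral closure of \<open>R\<close> in \<open>Q\<close>. Stable modules with a bounded denominator replace integral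
  equations, so that closure under addition and multiplication needs no polynomials.\<close>

definition B where
  "B = {b \<in> carrier Q. \<exists>A K. submod R A \<and> \<one> \<in> A \<and> (\<forall>a\<in>A. b \<otimes> a \<in> A) \<and> (\<forall>a\<in>A. x [^] (K::nat) \<otimes> a \<in> R)}"

lemma B_I:
  assumes "b \<in> carrier Q" "submod R A" "\<one> \<in> A" "\<And>a. a \<in> A \<Longrightarrow> b \<otimes> a \<in> A" "\<And>a. a \<in> A \<Longrightarrow> x [^] (K::nat) \<otimes> a \<in> R"
  shows "b \<in> B"
  using assms unfolding B_def by blast

lemma B_E:
  assumes "b \<in> B"
  obtains A K where "submod R A" "\<one> \<in> A" "\<And>a. a \<in> A \<Longrightarrow> b \<otimes> a \<in> A" "\<And>a. a \<in> A \<Longrightarrow> x [^] (K::nat) \<otimes> a \<in> R"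
  using assms unfolding B_def by blast

lemma BC: "b \<in> B \<Longrightarrow> b \<in> carrier Q" unfolding B_def by blast

lemma RB: "R \<subseteq> B"
proof
  fix b assume b: "b \<in> R"
  show "b \<in> B"
    by (rule B_I[of b R 0]) (use b R_closed R_self RC in auto)
qed

lemma B_subring: "subring B Q"
proof -
  have *: "b \<oplus> c \<in> B \<and> b \<otimes> c \<in> B" if b: "b \<in> B" and c: "c \<in> B" for b c
  proof -
    obtain A K where A: "submod R A" "\<one> \<in> A" "\<And>a. a \<in> A \<Longrightarrow> b \<otimes> a \<in> A" "\<And>a. a \<in> A \<Longrightarrow> x [^] (K::nat) \<otimes> a \<in> R"
      using B_E[OF b] by blast
    obtain A' K' where A': "submod R A'" "\<one> \<in> A'" "\<And>a. a \<in> A' \<Longrightarrow> c \<otimes> a \<in> A'" "\<And>a. a \<in> A' \<Longrightarrow> x [^] (K'::nat) \<otimes> a \<in> R"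
      using B_E[OF c] by blast
    have bc: "b \<in> carrier Q" "c \<in> carrier Q" using b c BC by auto
    \<comment> \<open>If A is stable under b and A' under c, the product A A' is stable under both,
      and x^(K + K') clears its denominators.\<close>
    let ?N = "modprod R A A'"
    have N: "submod R ?N" using submod_modprod[OF R submodD(1)[OF A(1)] submodD(1)[OF A'(1)]] .
    have 1: "\<one> \<in> ?N" using modprod_mem[OF A(2) A'(2)] by simp
    have "?N \<subseteq> {a \<in> carrier Q. b \<otimes> a \<in> ?N}"
    proof (rule modprod_least[OF submod_preimage[OF R N bc(1)]])
      fix a a' assume a: "a \<in> A" "a' \<in> A'"
      have "b \<otimes> a \<otimes> a' \<in> ?N" using modprod_mem[OF A(3)[OF a(1)] a(2)] .
      then show "a \<otimes> a' \<in> {a \<in> carrier Q. b \<otimes> a \<in> ?N}"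
        using submodD(2)[OF A(1) a(1)] submodD(2)[OF A'(1) a(2)] bc by (simp add: m_assoc)
    qed
    then have bN: "b \<otimes> a \<in> ?N" if "a \<in> ?N" for a using that by blast
    have "?N \<subseteq> {a \<in> carrier Q. c \<otimes> a \<in> ?N}"
    proof (rule modprod_least[OF submod_preimage[OF R N bc(2)]])
      fix a a' assume a: "a \<in> A" "a' \<in> A'"
      have "a \<otimes> (c \<otimes> a') \<in> ?N" using modprod_mem[OF a(1) A'(3)[OF a(2)]] .
      then show "a \<otimes> a' \<in> {a \<in> carrier Q. c \<otimes> a \<in> ?N}"
        using submodD(2)[OF A(1) a(1)] submodD(2)[OF A'(1) a(2)] bc by (simp add: m_lcomm)
    qed
    then have cN: "c \<otimes> a \<in> ?N" if "a \<in> ?N" for a using that by blast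
    have "?N \<subseteq> {a \<in> carrier Q. x [^] (K + K') \<otimes> a \<in> R}"
    proof (rule modprod_least[OF submod_preimage[OF R R_self xpC]])
      fix a a' assume a: "a \<in> A" "a' \<in> A'"
      have "(x [^] K \<otimes> a) \<otimes> (x [^] K' \<otimes> a') \<in> R" using A(4)[OF a(1)] A'(4)[OF a(2)] R_closed by simp
      moreover have "(x [^] K \<otimes> a) \<otimes> (x [^] K' \<otimes> a') = x [^] (K + K') \<otimes> (a \<otimes> a')"
        using submodD(2)[OF A(1) a(1)] submodD(2)[OF A'(1) a(2)] xC by (simp add: nat_pow_mult[symmetric] m_ac)
      ultimately show "a \<otimes> a' \<in> {a \<in> carrier Q. x [^] (K + K') \<otimes> a \<in> R}"
        using submodD(2)[OF A(1) a(1)] submodD(2)[OF A'(1) a(2)] by simp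
    qed
    then have KN: "x [^] (K + K') \<otimes> a \<in> R" if "a \<in> ?N" for a using that by blast
    have "b \<oplus> c \<in> B"
    proof (rule B_I[OF _ N 1 _ KN])
      fix a assume a: "a \<in> ?N"
      have "(b \<oplus> c) \<otimes> a = b \<otimes> a \<oplus> c \<otimes> a" using bc submodD(2)[OF N a] by (simp add: l_distr)
      then show "(b \<oplus> c) \<otimes> a \<in> ?N" using submodD(4)[OF N bN[OF a] cN[OF a]] by simp
    qed (use bc in auto)
    moreover have "b \<otimes> c \<in> B"
    proof (rule B_I[OF _ N 1 _ KN])
      fix a assume a: "a \<in> ?N"
      have "(b \<otimes> c) \<otimes> a = b \<otimes> (c \<otimes> a)" using bc submodD(2)[OF N a] by (simp add: m_assoc)
      then show "(b \<otimes> c) \<otimes> a \<in> ?N" using bN[OF cN[OF a]] by simp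
    qed (use bc in auto)
    ultimately show ?thesis by blast
  qed
  show ?thesis
  proof (rule subringI)
    show "B \<subseteq> carrier Q" using BC by blast
    show "\<one> \<in> B" using RB R_closed by blast
    fix b assume b: "b \<in> B"
    have "\<ominus> \<one> \<otimes> b \<in> B" using * b RB R_closed by blast
    moreover have "\<ominus> \<one> \<otimes> b = \<ominus> b" using BC[OF b] by algebra
    ultimately show "\<ominus> b \<in> B" by simp
  qed (use * in blast)+
qed

lemmas B_closed = subringE(2,3,5,6,7)[OF B_subring]
lemma B_self: "submod B B" using submod_self[OF B_subring] .
lemma submod_BR: "submod B N \<Longrightarrow> submod R N" using submod_weaken RB by blast
lemma xB: "x \<in> B" using xR RB by blast
lemma xpB [simp]: "x [^] (n::nat) \<in> B" using xpR RB by blast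

section \<open>Uniform integral equations and finiteness of the integral closure\<close>

lemma fin_len_shift:
  assumes N: "submod R N" "submod R N'" and b: "scal (x [^] (k::nat)) N' \<subseteq> R" and l: "scal (x [^] (l::nat)) R \<subseteq> N"
  shows "fin_len R N N'"
proof -
  \<comment> \<open>Multiplication by x^k moves N and N' between x^(k + l) R and R, where lengths
    are finite.\<close>
  have "scal (x [^] (k + l)) R = scal (x [^] k) (scal (x [^] l) R)"
    using submodD(1)[OF R_self] xC by (simp add: scal_scal nat_pow_mult)
  also have "\<dots> \<subseteq> scal (x [^] k) N" using scal_mono[OF l] .
  finally have "fin_len R (scal (x [^] k) N) (scal (x [^] k) N')"
    using fin_len_mono[OF artin_scal(1)[OF xpR[of "k + l"] xpU]] b by blast
  then show ?thesis using fin_len_scal_iff[OF R xpU submodD(1)[OF N(1)] submodD(1)[OF N(2)]] by blast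
qed

definition mult_len :: nat where "mult_len = len R (scal x R) R"

text \<open>Uniformly in \<open>b\<close>: with \<open>U = R[b]\<close>, additivity of length gives \<open>len (U / xU) = len (R / xR)\<close>,
  so the images of \<open>R + Rb + \<dots> + Rb\<^sup>j\<close> in \<open>U / xU\<close> become stationary after at most that many steps.\<close>

lemma pow_bound:
  assumes b: "b \<in> B" shows "b [^] Suc mult_len \<in> powspan R b mult_len"
proof -
  have bC: "b \<in> carrier Q" using BC b by blast
  obtain A K where A: "submod R A" "\<one> \<in> A" "\<And>a. a \<in> A \<Longrightarrow> b \<otimes> a \<in> A" "\<And>a. a \<in> A \<Longrightarrow> x [^] (K::nat) \<otimes> a \<in> R"
    using B_E[OF b] by blast
  define U where "U = (\<Union>n. powspan R b n)"
  have U: "submod R U"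
    unfolding U_def by (rule submod_Union_chain) (rule submod_powspan[OF R bC], rule powspan_Suc_ge[OF R bC])
  have pU: "powspan R b n \<subseteq> U" for n unfolding U_def by blast
  have UA: "U \<subseteq> A" unfolding U_def using powspan_least[OF A(1,2,3) R] by blast
  have KU: "scal (x [^] K) U \<subseteq> R" using UA A(4) unfolding scal_def by blast
  have RU: "R \<subseteq> U" using pU[of 0] by simp
  let ?xU = "scal x U"
  have xU': "submod R ?xU" "?xU \<subseteq> U"
    using submod_scal[OF R U xC] submodD(5)[OF U xR] unfolding scal_def by auto
  have xRm: "submod R (scal x R)" "scal x R \<subseteq> R" using scalR[OF xR] by auto
  have xRU: "scal x R \<subseteq> ?xU" using scal_mono[OF RU] .
  have x1: "x [^] (1::nat) = x" using xC by simp
  have f1: "fin_len R (scal x R) U"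
    using fin_len_shift[OF xRm(1) U KU, of 1] x1 by simp
  have e1: "len R (scal x R) U = len R (scal x R) ?xU + len R ?xU U"
    using len_add[OF R xRm(1) xU'(1) U xRU xU'(2) f1] .
  have e2: "len R (scal x R) U = len R (scal x R) R + len R R U"
    using len_add[OF R xRm(1) R_self U xRm(2) RU f1] .
  have e3: "len R (scal x R) ?xU = len R R U"
    using len_scal[OF R xU submodD(1)[OF R_self] submodD(1)[OF U]] .
  have len: "len R ?xU U = mult_len" using e1 e2 e3 unfolding mult_len_def by simp
  have fxU: "fin_len R ?xU U" using fin_len_mono[OF f1 xRU subset_refl] .
  define g where "g n = msum (powspan R b n) ?xU" for n
  have gm: "submod R (g n)" "?xU \<subseteq> g n" "g n \<subseteq> U" "powspan R b n \<subseteq> g n" for n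
    unfolding g_def using submod_msum[OF R submod_powspan[OF R bC] xU'(1)] msum_ge2[OF submod_powspan[OF R bC] xU'(1)]
      msum_le[OF U pU xU'(2)] msum_ge1[OF submod_powspan[OF R bC] xU'(1)] by auto
  have gs: "g n \<subseteq> g (Suc n)" for n unfolding g_def using msum_mono[OF powspan_Suc_ge[OF R bC] subset_refl] .
  have "\<exists>n\<le>len R ?xU U. g (Suc n) = g n"
  proof (rule fin_len_acc[OF R fxU xU'(1)])
    show "submod R (g i) \<and> ?xU \<subseteq> g i \<and> g i \<subseteq> U" for i using gm(1-3)[of i] by simp
  qed (rule gs)
  then obtain n where n: "n \<le> mult_len" "g (Suc n) = g n" unfolding len by blast
  \<comment> \<open>Multiplication by b maps \<open>g n\<close> into \<open>g (Suc n)\<close>, which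
    equals \<open>g n\<close>; so stationarity at n absorbs all higher powers of b.\<close>
  have "powspan R b i \<subseteq> g n" for i
  proof (induction i)
    case 0
    show ?case using powspan_mono[OF R bC, of 0 n] gm(4)[of n] by simp
  next
    case (Suc i)
    have 1: "R \<subseteq> g n" using powspan_mono[OF R bC, of 0 n] gm(4)[of n] by simp
    have "b \<otimes> w \<in> g n" if w: "w \<in> powspan R b i" for w
    proof -
      have "w \<in> msum (powspan R b n) ?xU" using w Suc unfolding g_def by blast
      then obtain p u where p: "p \<in> powspan R b n" "u \<in> U" "w = p \<oplus> x \<otimes> u" unfolding msum_def scal_def by blast
      have pc: "p \<in> carrier Q" "u \<in> carrier Q" using submodD(2)[OF submod_powspan[OF R bC] p(1)] submodD(2)[OF U p(2)] by auto
      obtain m where "u \<in> powspan R b m" using p(2) unfolding U_def by blast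
      then have "b \<otimes> u \<in> U" using powspan_mult[OF R bC] pU[of "Suc m"] by blast
      then have "b \<otimes> p \<oplus> x \<otimes> (b \<otimes> u) \<in> g (Suc n)"
        unfolding g_def using msumI[OF powspan_mult[OF R bC p(1)] scalI] by blast
      moreover have "b \<otimes> w = b \<otimes> p \<oplus> x \<otimes> (b \<otimes> u)" using p(3) pc bC xC by (simp add: r_distr m_lcomm)
      ultimately show ?thesis using n by simp
    qed
    then have "scal b (powspan R b i) \<subseteq> g n" unfolding scal_def by blast
    then show ?case using msum_le[OF gm(1) 1] by simp
  qed
  then have Ug: "U \<subseteq> g n" unfolding U_def by blast
  \<comment> \<open>Substituting U = P + xU into itself, with P the span of the powers up to b^n,
    gives U = P + x^k U. For k = K the last summand lies in R \<subseteq> P, so U = P.\<close>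
  have it: "\<exists>p\<in>powspan R b n. \<exists>u'\<in>U. u = p \<oplus> x [^] k \<otimes> u'" if u: "u \<in> U" for u and k :: nat
  proof (induction k)
    case 0
    have "u = \<zero> \<oplus> x [^] (0::nat) \<otimes> u" using submodD(2)[OF U u] by simp
    then show ?case using u submodD(3)[OF submod_powspan[OF R bC]] by blast
  next
    case (Suc k)
    then obtain p u' where p: "p \<in> powspan R b n" "u' \<in> U" "u = p \<oplus> x [^] k \<otimes> u'" by blast
    have "u' \<in> msum (powspan R b n) ?xU" using p Ug unfolding g_def by blast
    then obtain p' u'' where q: "p' \<in> powspan R b n" "u'' \<in> U" "u' = p' \<oplus> x \<otimes> u''" unfolding msum_def scal_def by blast
    have c: "p \<in> carrier Q" "u' \<in> carrier Q" "p' \<in> carrier Q" "u'' \<in> carrier Q"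
      using submodD(2)[OF submod_powspan[OF R bC]] submodD(2)[OF U] p q by auto
    have "p \<oplus> x [^] k \<otimes> p' \<in> powspan R b n"
      using submodD(4)[OF submod_powspan[OF R bC] p(1) submodD(5)[OF submod_powspan[OF R bC] xpR q(1)]] .
    moreover have "u = (p \<oplus> x [^] k \<otimes> p') \<oplus> x [^] Suc k \<otimes> u''"
      unfolding p(3) q(3) using c xC by (simp add: r_distr m_assoc a_assoc)
    ultimately show ?case using q(2) by blast
  qed
  have "U \<subseteq> powspan R b mult_len"
  proof
    fix u assume "u \<in> U"
    from it[OF this] obtain p u' where p: "p \<in> powspan R b n" "u' \<in> U" "u = p \<oplus> x [^] K \<otimes> u'" by blast
    have "x [^] K \<otimes> u' \<in> R" using p UA A(4) by blast
    then have "x [^] K \<otimes> u' \<in> powspan R b n" using powspan_mono[OF R bC, of 0 n] by auto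
    then have "u \<in> powspan R b n" using p submodD(4)[OF submod_powspan[OF R bC]] by blast
    then show "u \<in> powspan R b mult_len" using powspan_mono[OF R bC n(1)] by blast
  qed
  then show ?thesis using pow_in_powspan[OF R bC] pU by blast
qed

text \<open>Let e be \<open>mult_len\<close>. As b^(e + 1) is a combination of powers up to b^e and
  both z and zb lie in R, the product z^e b^(e + 1) already lies in R; one factor z is left
  over.\<close>

lemma pow_bound_R:
  assumes b: "b \<in> B" and z: "z \<in> R" "z \<otimes> b \<in> R"
  shows "(z \<otimes> b) [^] Suc mult_len \<in> scal z R"
proof -
  have bC: "b \<in> carrier Q" and zC: "z \<in> carrier Q" using BC b RC z by auto
  have *: "z [^] i \<otimes> w \<in> R" if "w \<in> powspan R b i" for i w
    using that
  proof (induction i arbitrary: w)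
    case 0 then show ?case using R_closed RC by simp
  next
    case (Suc i)
    then obtain r w' where w: "r \<in> R" "w' \<in> powspan R b i" "w = r \<oplus> b \<otimes> w'" unfolding powspan.simps msum_def scal_def by blast
    have c: "w' \<in> carrier Q" using submodD(2)[OF submod_powspan[OF R bC] w(2)] .
    have "z [^] Suc i \<otimes> w = z [^] Suc i \<otimes> r \<oplus> (z \<otimes> b) \<otimes> (z [^] i \<otimes> w')"
      unfolding w(3) using c bC zC RC[OF w(1)] by (simp add: r_distr m_ac)
    then show ?case using Suc.IH[OF w(2)] w(1) z Rpow[OF z(1), of "Suc i"] R_closed by simp
  qed
  have "(z \<otimes> b) [^] Suc mult_len = z [^] Suc mult_len \<otimes> b [^] Suc mult_len"
    by (rule nat_pow_distrib[OF zC bC])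
  also have "\<dots> = z \<otimes> (z [^] mult_len \<otimes> b [^] Suc mult_len)"
    using zC bC by (simp add: m_ac)
  finally show ?thesis using *[OF pow_bound[OF b]] scalI by metis
qed

lemma one_minus_M:
  assumes "m \<in> M" shows "\<one> \<ominus> m \<in> Units Q" "inv (\<one> \<ominus> m) \<in> R"
proof -
  have mR: "m \<in> R" using assms MR by blast
  have "\<one> \<ominus> m \<notin> M"
  proof
    assume "\<one> \<ominus> m \<in> M"
    then have "\<one> \<ominus> m \<oplus> m \<in> M" using submodD(4)[OF M] assms by blast
    moreover have "\<one> \<ominus> m \<oplus> m = \<one>" using RC[OF mR] by algebra
    ultimately show False using one_M by simp
  qed
  moreover have "\<one> \<ominus> m \<in> R" using submod_diff[OF R_self R] R_closed mR by blast
  ultimately show "\<one> \<ominus> m \<in> Units Q" "inv (\<one> \<ominus> m) \<in> R" using unit_R by auto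
qed

lemma scal_xpow_Mp: "scal (x [^] (n::nat)) R \<subseteq> Mp n"
proof
  fix y assume "y \<in> scal (x [^] n) R"
  then obtain r where r: "r \<in> R" "y = x [^] n \<otimes> r" by (rule scalE)
  then have "y = r \<otimes> x [^] n" using RC[OF r(1)] by (simp add: m_comm)
  then show "y \<in> Mp n" using submodD(5)[OF Mp_submod r(1) xpMp] by simp
qed

lemma scal_xpow_antimono: "n \<le> m \<Longrightarrow> scal (x [^] (m::nat)) R \<subseteq> scal (x [^] (n::nat)) R"
proof
  fix y assume nm: "n \<le> m" and "y \<in> scal (x [^] m) R"
  then obtain r where r: "r \<in> R" "y = x [^] m \<otimes> r" by (auto elim: scalE)
  have "y = x [^] n \<otimes> (x [^] (m - n) \<otimes> r)"
    using r RC[OF r(1)] nm xC by (simp add: m_assoc[symmetric] nat_pow_mult)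
  then show "y \<in> scal (x [^] n) R" using scalI R_closed(4)[OF xpR r(1)] by simp
qed

text \<open>Otherwise the ideals \<open>R \<inter> x\<^sup>N B\<close> contain, for each \<open>N\<close>, elements outside \<open>xR\<close> with
  \<open>e\<close>-th power in \<open>x\<^sup>N R\<close>, where \<open>e\<close> does not depend on \<open>N\<close>. As \<open>R / x\<^sup>n R\<close> has finite length,
  such elements can be chosen to form a Cauchy sequence, whose limit is a non-zero nilpotent.\<close>

lemma B_bounded: "\<exists>k. \<forall>b\<in>B. x [^] (k::nat) \<otimes> b \<in> R"
proof (rule ccontr)
  assume "\<not> ?thesis"
  then have bad: "\<exists>b\<in>B. x [^] (k::nat) \<otimes> b \<notin> R" for k by blast
  define I where "I N = R \<inter> scal (x [^] (N::nat)) B" for N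
  have I: "submod R (I N)" "I N \<subseteq> R" for N
    unfolding I_def using submod_Int[OF R_self submod_scal[OF R submod_BR[OF B_self] xpC]] by auto
  have Idec: "I (Suc N) \<subseteq> I N" for N
  proof
    fix a assume a: "a \<in> I (Suc N)"
    then obtain b where b: "b \<in> B" "a = x [^] Suc N \<otimes> b" "a \<in> R" unfolding I_def scal_def by blast
    have "a = x [^] N \<otimes> (x \<otimes> b)" using b BC[OF b(1)] xC by (simp add: m_assoc)
    then show "a \<in> I N" unfolding I_def using b scalI[OF B_closed(4)[OF xB b(1)]] by simp
  qed
  \<comment> \<open>Choose b with x^N b outside R and n least with x^n b \<in> R. Minimality keeps
    x^n b outside xR, and n > N puts it into x^N B.\<close>
  have In: "\<exists>a\<in>I N. a \<notin> scal x R" for N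
  proof -
    obtain b where b: "b \<in> B" "x [^] N \<otimes> b \<notin> R" using bad by blast
    have bC: "b \<in> carrier Q" using BC b by blast
    define n where "n = (LEAST n. x [^] (n::nat) \<otimes> b \<in> R)"
    have n: "x [^] n \<otimes> b \<in> R" unfolding n_def using LeastI_ex[OF xpow_frac[OF bC]] .
    have nN: "N < n"
    proof (rule ccontr)
      assume "\<not> N < n"
      then show False using xpow_mono[OF R_self n bC, of N] b by simp
    qed
    then obtain j where j: "n = Suc (N + j)" using less_imp_Suc_add by blast
    have e: "x [^] n \<otimes> b = x [^] N \<otimes> (x [^] Suc j \<otimes> b)"
      unfolding j using bC xC by (simp add: m_assoc[symmetric] nat_pow_mult[symmetric])
    have e2: "x [^] n \<otimes> b = x \<otimes> (x [^] (N + j) \<otimes> b)"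
      unfolding j using bC xC by (simp add: m_ac)
    have "x [^] n \<otimes> b \<in> I N"
      unfolding I_def using n e scalI[OF B_closed(4)[OF xpB b(1)]] by (metis IntI)
    moreover have "x [^] n \<otimes> b \<notin> scal x R"
    proof
      assume "x [^] n \<otimes> b \<in> scal x R"
      then obtain r where r: "r \<in> R" "x \<otimes> (x [^] (N + j) \<otimes> b) = x \<otimes> r" unfolding e2 by (rule scalE)
      then have "x [^] (N + j) \<otimes> b = r" using Units_l_cancel[OF xU] bC RC by simp
      then have "x [^] (N + j) \<otimes> b \<in> R" using r by simp
      from Least_le[of "\<lambda>n. x [^] (n::nat) \<otimes> b \<in> R", OF this] show False using j unfolding n_def by simp
    qed
    ultimately show ?thesis by blast
  qed
  \<comment> \<open>\<open>S n N\<close> is \<open>I N\<close> taken modulo x^n, and the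
    intersection \<open>T n\<close> collects the residues that occur for every N. By finite length
    \<open>T n\<close> is already one of the \<open>S n N\<close>.\<close>
  define S where "S n N = msum (I N) (scal (x [^] (n::nat)) R)" for n N
  have S: "submod R (S n N)" "scal (x [^] n) R \<subseteq> S n N" "S n N \<subseteq> R" "I N \<subseteq> S n N" for n N
    unfolding S_def
    using submod_msum[OF R I(1) conjunct1[OF scalR[OF xpR]]] msum_ge2[OF I(1) conjunct1[OF scalR[OF xpR]]]
      msum_ge1[OF I(1) conjunct1[OF scalR[OF xpR]]] msum_le[OF R_self I(2)] scalR[OF xpR] by simp_all
  have Sdec: "S n (Suc N) \<subseteq> S n N" for n N unfolding S_def using msum_mono[OF Idec subset_refl] .
  define T where "T n = (\<Inter>N. S n N)" for n
  have stab: "\<exists>N0. S n N0 \<subseteq> T n" for n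
  proof -
    have "\<exists>N0. \<forall>N\<ge>N0. S n N = S n N0"
    proof (rule fin_len_dcc[OF R artin_scal(1)[OF xpR[of n] xpU]])
      show "submod R (scal (x [^] n) R)" using scalR[OF xpR] by blast
      show "submod R (S n i) \<and> scal (x [^] n) R \<subseteq> S n i \<and> S n i \<subseteq> R" for i using S by blast
      show "S n (Suc i) \<subseteq> S n i" for i by (rule Sdec)
    qed
    then obtain N0 where N0: "\<And>N. N \<ge> N0 \<Longrightarrow> S n N = S n N0" by blast
    have "S n N0 \<subseteq> S n N" for N
    proof (cases "N \<ge> N0")
      case True then show ?thesis using N0 by blast
    next
      case False then show ?thesis using lift_Suc_antimono_le[of "S n", OF Sdec, of N N0] by simp
    qed
    then show ?thesis unfolding T_def by blast
  qed
  have TR: "T n \<subseteq> R" for n unfolding T_def using S(3)[of n 0] by blast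
  \<comment> \<open>\<open>T (Suc n)\<close> contains some \<open>I N0\<close>, and t agrees modulo
    x^n with an element of that ideal.\<close>
  have step: "\<exists>t'\<in>T (Suc n). t' \<ominus> t \<in> scal (x [^] n) R" if t: "t \<in> T n" for t n
  proof -
    obtain N0 where N0: "S (Suc n) N0 \<subseteq> T (Suc n)" using stab by blast
    have "t \<in> S n N0" using t unfolding T_def by blast
    then obtain a w where a: "a \<in> I N0" "w \<in> scal (x [^] n) R" "t = a \<oplus> w" unfolding S_def by (rule msumE)
    have sm: "submod R (scal (x [^] n) R)" using scalR[OF xpR] by blast
    have c: "a \<in> carrier Q" "w \<in> carrier Q" using submodD(2)[OF I(1) a(1)] submodD(2)[OF sm a(2)] by auto
    have "a \<ominus> t = \<ominus> w" unfolding a(3) using c by algebra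
    then have "a \<ominus> t \<in> scal (x [^] n) R" using submod_minus[OF sm R a(2)] by simp
    then show ?thesis using N0 S(4) a(1) by blast
  qed
  have pow: "t [^] Suc mult_len \<in> scal (x [^] n) R" if t: "t \<in> T n" for t n
  proof -
    have "t \<in> S n n" using t unfolding T_def by blast
    then obtain a w where a: "a \<in> I n" "w \<in> scal (x [^] n) R" "t = a \<oplus> w" unfolding S_def by (rule msumE)
    obtain b where b: "b \<in> B" "a = x [^] n \<otimes> b" using a(1) unfolding I_def scal_def by blast
    obtain r where r: "r \<in> R" "w = x [^] n \<otimes> r" using a(2) by (rule scalE)
    have rB: "r \<in> B" using RB r by blast
    have t2: "t = x [^] n \<otimes> (b \<oplus> r)" unfolding a(3) b(2) r(2) using BC[OF b(1)] BC[OF rB] by (simp add: r_distr)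
    show ?thesis using pow_bound_R[OF B_closed(5)[OF b(1) rB] xpR[of n]] t TR[of n] unfolding t2 by blast
  qed
  obtain t0 where t0: "t0 \<in> T 1" "t0 \<notin> scal x R"
    using stab[of 1] In S(4) by blast
  \<comment> \<open>The index is shifted by one because \<open>T 1\<close> is the first set that
    sees residues modulo x; the start t0 is non-zero there.\<close>
  have "\<exists>u. \<forall>n. (u n \<in> T (Suc n) \<and> (n = 0 \<longrightarrow> u n = t0)) \<and> u (Suc n) \<ominus> u n \<in> scal (x [^] Suc n) R"
  proof (rule dependent_nat_choice[where P = "\<lambda>n v. v \<in> T (Suc n) \<and> (n = 0 \<longrightarrow> v = t0)"
        and Q = "\<lambda>n v w. w \<ominus> v \<in> scal (x [^] Suc n) R"])
    show "\<exists>v. v \<in> T (Suc 0) \<and> (0 = (0::nat) \<longrightarrow> v = t0)" using t0 by auto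
  next
    fix t and n :: nat assume t: "t \<in> T (Suc n) \<and> (n = 0 \<longrightarrow> t = t0)"
    show "\<exists>y. (y \<in> T (Suc (Suc n)) \<and> (Suc n = 0 \<longrightarrow> y = t0)) \<and> y \<ominus> t \<in> scal (x [^] Suc n) R"
      using step[of t "Suc n"] t by auto
  qed
  then obtain u where u: "\<And>n. u n \<in> T (Suc n)" "u 0 = t0" "\<And>n. u (Suc n) \<ominus> u n \<in> scal (x [^] Suc n) R"
    by blast
  have uR: "u n \<in> R" for n using u(1) TR by blast
  have sM: "scal (x [^] Suc n) R \<subseteq> Mp n" for n
    using scal_xpow_antimono[of n "Suc n"] scal_xpow_Mp[of n] by simp
  have uMp: "u n \<in> Mp n" for n
  proof (rule complete_reduced[of u "Suc mult_len"])
    show "u n \<in> R" for n by (rule uR)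
    show "u (Suc n) \<ominus> u n \<in> Mp n" for n using u(3)[of n] sM[of n] by blast
    show "u n [^] Suc mult_len \<in> Mp n" for n using pow[OF u(1)[of n]] sM[of n] by blast
  qed
  \<comment> \<open>The limit vanishes, so \<open>u q\<close> lies in \<open>Mp q\<close>
    \<subseteq> xR; but \<open>u q\<close> is congruent to t0 modulo x.\<close>
  obtain q where q: "Mp q \<subseteq> scal x R" using artin_scal(2)[OF xR xU] by blast
  have sx: "submod R (scal x R)" using scalR[OF xR] by blast
  have ux: "u n \<ominus> u 0 \<in> scal x R" for n
  proof (induction n)
    case 0
    have "u 0 \<ominus> u 0 = \<zero>" using RC[OF uR[of 0]] by algebra
    then show ?case using submodD(3)[OF sx] by simp
  next
    case (Suc n)
    have "u (Suc n) \<ominus> u n \<in> scal x R"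
      using u(3)[of n] scal_xpow_antimono[of 1 "Suc n"] xC by auto
    then have "(u (Suc n) \<ominus> u n) \<oplus> (u n \<ominus> u 0) \<in> scal x R" using Suc submodD(4)[OF sx] by blast
    moreover have "(u (Suc n) \<ominus> u n) \<oplus> (u n \<ominus> u 0) = u (Suc n) \<ominus> u 0"
      using RC[OF uR[of "Suc n"]] RC[OF uR[of n]] RC[OF uR[of 0]] by algebra
    ultimately show ?case by simp
  qed
  have "u q \<ominus> (u q \<ominus> u 0) \<in> scal x R" using submod_diff[OF sx R _ ux[of q]] uMp[of q] q by blast
  moreover have "u q \<ominus> (u q \<ominus> u 0) = u 0" using RC[OF uR[of q]] RC[OF uR[of 0]] by algebra
  ultimately show False using u(2) t0 by simp
qed

text \<open>Iterating the hypothesis yields \<open>u\<^sub>0, u\<^sub>1, \<dots>\<close> with \<open>u\<^sub>n \<equiv> x u\<^sub>n\<^sub>+\<^sub>1\<close> modulo \<open>N'\<close>, and the ideals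
  \<open>(u\<^sub>0, \<dots>, u\<^sub>n)\<close> become stationary.\<close>

lemma nakayama:
  assumes N: "submod R N" "N \<subseteq> R" and N': "submod R N'" "N' \<subseteq> R"
    and st: "\<And>a. a \<in> N \<Longrightarrow> \<exists>b\<in>N'. \<exists>a'\<in>N. a = b \<oplus> x \<otimes> a'"
  shows "N \<subseteq> N'"
proof
  fix a0 assume a0: "a0 \<in> N"
  have "\<exists>u. \<forall>n. (u n \<in> N \<and> (n = 0 \<longrightarrow> u n = a0)) \<and> (\<exists>b\<in>N'. u n = b \<oplus> x \<otimes> u (Suc n))"
  proof (rule dependent_nat_choice[where P = "\<lambda>n v. v \<in> N \<and> (n = 0 \<longrightarrow> v = a0)"
        and Q = "\<lambda>n v w. \<exists>b\<in>N'. v = b \<oplus> x \<otimes> w"])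
    show "\<exists>v. v \<in> N \<and> (0 = (0::nat) \<longrightarrow> v = a0)" using a0 by auto
  next
    fix a and n :: nat assume "a \<in> N \<and> (n = 0 \<longrightarrow> a = a0)"
    then show "\<exists>y. (y \<in> N \<and> (Suc n = 0 \<longrightarrow> y = a0)) \<and> (\<exists>b\<in>N'. a = b \<oplus> x \<otimes> y)"
      using st[of a] by auto
  qed
  then obtain u where u: "\<And>n. u n \<in> N" "u 0 = a0" "\<And>n. \<exists>b\<in>N'. u n = b \<oplus> x \<otimes> u (Suc n)"
    by blast
  have uR: "u n \<in> R" for n using u N by blast
  define J where "J = rec_nat (scal (u 0) R) (\<lambda>n A. msum A (scal (u (Suc n)) R))"
  have J0: "J 0 = scal (u 0) R" and JS: "J (Suc n) = msum (J n) (scal (u (Suc n)) R)" for n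
    unfolding J_def by auto
  have J: "submod R (J n) \<and> J n \<subseteq> R" for n
  proof (induction n)
    case 0 then show ?case unfolding J0 using scalR[OF uR] by blast
  next
    case (Suc n)
    then show ?case unfolding JS using scalR[OF uR[of "Suc n"]] submod_msum[OF R] msum_le[OF R_self] by simp
  qed
  have uJ: "u (Suc n) \<in> J (Suc n)" and JJ: "J n \<subseteq> J (Suc n)" for n
  proof -
    have s: "submod R (scal (u (Suc n)) R)" "u (Suc n) \<in> scal (u (Suc n)) R" using scalR[OF uR[of "Suc n"]] by auto
    show "u (Suc n) \<in> J (Suc n)" "J n \<subseteq> J (Suc n)"
      unfolding JS using msum_ge2[OF conjunct1[OF J[of n]] s(1)] s(2) msum_ge1[OF conjunct1[OF J[of n]] s(1)] by auto
  qed
  have "\<exists>K\<in>range J. \<forall>K'\<in>range J. K \<subseteq> K' \<longrightarrow> K' = K"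
    by (rule noeth) (use J in auto)
  then obtain k where "\<forall>K'\<in>range J. J k \<subseteq> K' \<longrightarrow> K' = J k" by auto
  then have "J (Suc k) = J k" using JJ[of k] by blast
  then have uk: "u (Suc k) \<in> J k" using uJ[of k] by simp
  \<comment> \<open>Modulo N' each earlier term of the sequence is a multiple of \<open>u n\<close>,
    so the whole ideal \<open>J n\<close> is generated by \<open>u n\<close> there.\<close>
  have red: "\<exists>\<rho>\<in>R. w \<ominus> \<rho> \<otimes> u n \<in> N'" if "w \<in> J n" for w n
    using that
  proof (induction n arbitrary: w)
    case 0
    then obtain r where r: "r \<in> R" "w = u 0 \<otimes> r" unfolding J0 by (auto elim: scalE)
    have "w \<ominus> r \<otimes> u 0 = \<zero>" unfolding r(2) using RC[OF r(1)] RC[OF uR[of 0]] by algebra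
    then show ?case using r submodD(3)[OF N'(1)] by (intro bexI[of _ r]) simp_all
  next
    case (Suc n)
    then obtain w' r where w: "w' \<in> J n" "r \<in> R" "w = w' \<oplus> u (Suc n) \<otimes> r" unfolding JS msum_def scal_def by blast
    obtain \<rho> where \<rho>: "\<rho> \<in> R" "w' \<ominus> \<rho> \<otimes> u n \<in> N'" using Suc.IH[OF w(1)] by blast
    obtain b where b: "b \<in> N'" "u n = b \<oplus> x \<otimes> u (Suc n)" using u(3) by blast
    have c: "w' \<in> carrier Q" "r \<in> carrier Q" "\<rho> \<in> carrier Q" "b \<in> carrier Q" "u (Suc n) \<in> carrier Q"
      using J[of n] w \<rho> b N' RC uR by auto
    have "w \<ominus> (\<rho> \<otimes> x \<oplus> r) \<otimes> u (Suc n) = (w' \<ominus> \<rho> \<otimes> u n) \<oplus> \<rho> \<otimes> b"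
      unfolding w(3) b(2) using c xC by algebra
    then have "w \<ominus> (\<rho> \<otimes> x \<oplus> r) \<otimes> u (Suc n) \<in> N'"
      using submodD(4)[OF N'(1) \<rho>(2) submodD(5)[OF N'(1) \<rho>(1) b(1)]] by simp
    then show ?case using R_closed(5)[OF R_closed(4)[OF \<rho>(1) xR] w(2)] by blast
  qed
  obtain \<rho> where \<rho>: "\<rho> \<in> R" "u (Suc k) \<ominus> \<rho> \<otimes> u k \<in> N'" using red[OF uk] by blast
  obtain b where b: "b \<in> N'" "u k = b \<oplus> x \<otimes> u (Suc k)" using u(3) by blast
  \<comment> \<open>Modulo N', \<open>u (Suc k)\<close> is \<rho> times \<open>u k\<close>, which is
    x times \<open>u (Suc k)\<close>. Hence 1 - \<rho> x, which is invertible in R, multiplies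
    \<open>u (Suc k)\<close> into N'. The same relations then carry the membership down to
    \<open>u 0\<close>.\<close>
  let ?d = "\<one> \<ominus> \<rho> \<otimes> x"
  have c: "\<rho> \<in> carrier Q" "b \<in> carrier Q" "u (Suc k) \<in> carrier Q" using \<rho> b N' RC uR by auto
  have d: "?d \<in> Units Q" "inv ?d \<in> R" using one_minus_M submodD(5)[OF M \<rho>(1) xM] by auto
  have "?d \<otimes> u (Suc k) = (u (Suc k) \<ominus> \<rho> \<otimes> u k) \<oplus> \<rho> \<otimes> b"
    unfolding b(2) using c xC by algebra
  then have "?d \<otimes> u (Suc k) \<in> N'" using submodD(4)[OF N'(1) \<rho>(2) submodD(5)[OF N'(1) \<rho>(1) b(1)]] by simp
  then have "inv ?d \<otimes> (?d \<otimes> u (Suc k)) \<in> N'" using submodD(5)[OF N'(1) d(2)] by blast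
  moreover have "inv ?d \<otimes> (?d \<otimes> u (Suc k)) = u (Suc k)"
    using d(1) c(3) by (simp add: m_assoc[symmetric] Units_closed)
  ultimately have last: "u (Suc k) \<in> N'" by simp
  have "u (Suc k - i) \<in> N'" if "i \<le> Suc k" for i
    using that
  proof (induction i)
    case 0 then show ?case using last by simp
  next
    case (Suc i)
    then have i: "Suc k - i = Suc (Suc k - Suc i)" by simp
    obtain b where b: "b \<in> N'" "u (Suc k - Suc i) = b \<oplus> x \<otimes> u (Suc (Suc k - Suc i))" using u(3) by blast
    have "u (Suc (Suc k - Suc i)) \<in> N'" using Suc i by simp
    then show ?case using b submodD(4)[OF N'(1) b(1) submodD(5)[OF N'(1) xR]] by simp
  qed
  from this[of "Suc k"] show "a0 \<in> N'" using u(2) by simp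
qed

text \<open>If infinitely many \<open>y + x\<^sup>n\<close> were non-units, these pairwise comaximal elements would give
  a strictly descending chain of principal ideals of \<open>Q\<close>, contradicting finite length modulo \<open>x\<close>.\<close>

lemma unit_shift_R:
  assumes y: "y \<in> R" shows "\<exists>n\<ge>n0. y \<oplus> x [^] (n::nat) \<in> Units Q"
proof (rule ccontr)
  assume "\<not> ?thesis"
  then have bad: "y \<oplus> x [^] n \<notin> Units Q" if "n \<ge> n0" for n using that by blast
  define z where "z n = y \<oplus> x [^] (n0 + n)" for n
  have zU: "z n \<notin> Units Q" and zR: "z n \<in> R" for n
    unfolding z_def using bad y R_closed by auto
  have zC: "z n \<in> carrier Q" for n using zR RC by blast
  define p where "p = rec_nat \<one> (\<lambda>n a. a \<otimes> z n)"
  have p0: "p 0 = \<one>" and pS: "p (Suc n) = p n \<otimes> z n" for n unfolding p_def by auto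
  have pR: "p n \<in> R" for n by (induction n) (auto simp: p0 pS R_closed zR)
  have pC: "p n \<in> carrier Q" for n using pR RC by blast
  \<comment> \<open>The difference is x^(n0 + i) (1 - x^(j - i)), so the elements \<open>z n\<close>
    are pairwise comaximal in Q.\<close>
  have diffU: "z i \<ominus> z j \<in> Units Q" if ij: "i < j" for i j
  proof -
    have "x [^] (j - i) \<in> M"
    proof -
      obtain l where "j - i = Suc l" using Suc_diff_Suc[OF ij, symmetric] by blast
      then have "x [^] (j - i) = x [^] l \<otimes> x" by simp
      then show ?thesis using submodD(5)[OF M xpR xM] by simp
    qed
    then have "x [^] (n0 + i) \<otimes> (\<one> \<ominus> x [^] (j - i)) \<in> Units Q" using one_minus_M by simp
    moreover have "x [^] (n0 + i) \<otimes> (\<one> \<ominus> x [^] (j - i)) = x [^] (n0 + i) \<ominus> x [^] (n0 + i) \<otimes> x [^] (j - i)"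
      using xC by (simp add: a_minus_def r_distr r_minus)
    moreover have "x [^] (n0 + i) \<otimes> x [^] (j - i) = x [^] (n0 + j)"
      using ij xC by (simp add: nat_pow_mult)
    moreover have "z i \<ominus> z j = x [^] (n0 + i) \<ominus> x [^] (n0 + j)"
      unfolding z_def using RC[OF y] xpC[of "n0+i"] xpC[of "n0+j"] by algebra
    ultimately show ?thesis by simp
  qed
  have comax: "\<exists>c\<in>carrier Q. \<exists>d\<in>carrier Q. p i \<otimes> c \<oplus> z m \<otimes> d = \<one>" if "i \<le> m" for i m
    using that
  proof (induction i)
    case 0
    have "p 0 \<otimes> \<one> \<oplus> z m \<otimes> \<zero> = \<one>" using zC p0 by simp
    then show ?case by blast
  next
    case (Suc i)
    then obtain c d where c: "c \<in> carrier Q" "d \<in> carrier Q" "p i \<otimes> c \<oplus> z m \<otimes> d = \<one>" by auto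
    have U: "z i \<ominus> z m \<in> Units Q" using diffU Suc by simp
    let ?w = "inv (z i \<ominus> z m)"
    have w: "?w \<in> carrier Q" using U by simp
    have "(z i \<ominus> z m) \<otimes> ?w = \<one>" using U by simp
    then have 1: "z i \<otimes> ?w \<ominus> z m \<otimes> ?w = \<one>" using zC[of i] zC[of m] w by algebra
    have "p (Suc i) \<otimes> (c \<otimes> ?w) \<oplus> z m \<otimes> (d \<ominus> p i \<otimes> c \<otimes> ?w)
        = p i \<otimes> c \<otimes> (z i \<otimes> ?w \<ominus> z m \<otimes> ?w) \<oplus> z m \<otimes> d"
      unfolding pS using zC[of i] zC[of m] w c(1,2) pC[of i] by algebra
    then have "p (Suc i) \<otimes> (c \<otimes> ?w) \<oplus> z m \<otimes> (d \<ominus> p i \<otimes> c \<otimes> ?w) = \<one>"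
      unfolding 1 using c pC[of i] by simp
    then show ?case using c w pC[of i] by (intro bexI[of _ "c \<otimes> ?w"] bexI[of _ "d \<ominus> p i \<otimes> c \<otimes> ?w"]) auto
  qed
  \<comment> \<open>By comaximality of \<open>p m\<close> and \<open>z m\<close>, divisibility of
    \<open>p m\<close> by their product would make \<open>z m\<close> invertible.\<close>
  have notin: "p m \<noteq> p (Suc m) \<otimes> q" if q: "q \<in> carrier Q" for m q
  proof
    assume e: "p m = p (Suc m) \<otimes> q"
    obtain c d where c: "c \<in> carrier Q" "d \<in> carrier Q" "p m \<otimes> c \<oplus> z m \<otimes> d = \<one>" using comax[of m m] by auto
    have 0: "p m \<ominus> p m \<otimes> z m \<otimes> q = \<zero>"
      using e pC[of m] zC[of m] q unfolding pS by (metis r_right_minus_eq m_closed)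
    have "z m \<otimes> (d \<oplus> p m \<otimes> c \<otimes> q) = (p m \<otimes> c \<oplus> z m \<otimes> d) \<ominus> c \<otimes> (p m \<ominus> p m \<otimes> z m \<otimes> q)"
      using c(1,2) pC[of m] zC[of m] q by algebra
    also have "\<dots> = \<one>" unfolding 0 c(3) using c by algebra
    finally have 1: "z m \<otimes> (d \<oplus> p m \<otimes> c \<otimes> q) = \<one>" .
    have 2: "d \<oplus> p m \<otimes> c \<otimes> q \<in> carrier Q" using c pC[of m] q by simp
    have "(d \<oplus> p m \<otimes> c \<otimes> q) \<otimes> z m = \<one>" using 1 m_comm[OF 2 zC[of m]] by simp
    then have "z m \<in> Units Q" unfolding Units_def using 1 2 zC[of m] by blast
    then show False using zU by blast
  qed
  define q where "q m = R \<inter> scal (p m) (carrier Q)" for m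
  have q: "submod R (q m)" "q m \<subseteq> R" for m
    unfolding q_def using submod_Int[OF R_self submod_scal[OF R submod_carrier[OF R] pC]] by auto
  have qdec: "q (Suc m) \<subseteq> q m" for m
  proof
    fix a assume "a \<in> q (Suc m)"
    then obtain c where c: "a \<in> R" "c \<in> carrier Q" "a = p (Suc m) \<otimes> c" unfolding q_def scal_def by blast
    have "a = p m \<otimes> (z m \<otimes> c)" using c pC[of m] zC[of m] unfolding pS by (simp add: m_assoc)
    then show "a \<in> q m" unfolding q_def using c scalI[of "z m \<otimes> c" "carrier Q" "p m"] zC[of m] by simp
  qed
  define g where "g m = msum (q m) (scal x R)" for m
  have sx: "submod R (scal x R)" "scal x R \<subseteq> R" using scalR[OF xR] by auto
  have "\<exists>n. \<forall>m\<ge>n. g m = g n"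
  proof (rule fin_len_dcc[OF R artin_scal(1)[OF xR xU] sx(1)])
    show "submod R (g i) \<and> scal x R \<subseteq> g i \<and> g i \<subseteq> R" for i
      unfolding g_def using submod_msum[OF R q(1) sx(1)] msum_ge2[OF q(1) sx(1)] msum_le[OF R_self q(2) sx(2)] by simp
    show "g (Suc i) \<subseteq> g i" for i unfolding g_def using msum_mono[OF qdec subset_refl] .
  qed
  then obtain n where n: "g (Suc n) = g n" by (metis le_SucI order_refl)
  \<comment> \<open>Since x is a unit of Q, xr \<in> \<open>p n\<close> Q implies r \<in>
    \<open>p n\<close> Q. So stationarity modulo xR has the shape that \<open>nakayama\<close>
    requires.\<close>
  have "q n \<subseteq> q (Suc n)"
  proof (rule nakayama[OF q q])
    fix a assume a: "a \<in> q n"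
    then have "a \<in> g n" unfolding g_def using msum_ge1[OF q(1) sx(1)] by blast
    then have "a \<in> g (Suc n)" unfolding n .
    then obtain b r where b: "b \<in> q (Suc n)" "r \<in> R" "a = b \<oplus> x \<otimes> r" unfolding g_def msum_def scal_def by blast
    have "x \<otimes> r \<in> q n"
      using submod_cancel[OF q(1) R, of b n "x \<otimes> r"] b a qdec RC xC by auto
    then obtain c where c: "c \<in> carrier Q" "x \<otimes> r = p n \<otimes> c" unfolding q_def scal_def by blast
    have "r = inv x \<otimes> (x \<otimes> r)" using xU xC RC[OF b(2)] by (simp add: m_assoc[symmetric])
    also have "\<dots> = p n \<otimes> (inv x \<otimes> c)" unfolding c(2) using xU c(1) pC[of n] by (simp add: m_lcomm)
    finally have "r \<in> q n" unfolding q_def using b(2) scalI[of "inv x \<otimes> c" "carrier Q" "p n"] xU c(1) by simp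
    then show "\<exists>b\<in>q (Suc n). \<exists>a'\<in>q n. a = b \<oplus> x \<otimes> a'" using b by blast
  qed
  moreover have "p n \<in> q n" unfolding q_def using pR[of n] scalI[of \<one> "carrier Q" "p n"] pC[of n] by simp
  ultimately obtain c where "c \<in> carrier Q" "p n = p (Suc n) \<otimes> c" unfolding q_def scal_def by blast
  then show False using notin by blast
qed

lemma unit_shift:
  assumes y: "y \<in> carrier Q" shows "\<exists>n\<ge>n0. y \<oplus> x [^] (n::nat) \<in> Units Q"
proof -
  obtain k where k: "x [^] (k::nat) \<otimes> y \<in> R" using xpow_frac[OF y] by blast
  \<comment> \<open>Dividing by x^k afterwards costs k in the exponent, hence the start at n0 +
    k.\<close>
  obtain n where n: "n \<ge> n0 + k" "x [^] k \<otimes> y \<oplus> x [^] n \<in> Units Q" using unit_shift_R[OF k] by blast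
  have "x [^] k \<otimes> y \<oplus> x [^] n = x [^] k \<otimes> (y \<oplus> x [^] (n - k))"
    using n(1) y xC by (simp add: r_distr nat_pow_mult)
  then have "inv (x [^] k) \<otimes> (x [^] k \<otimes> y \<oplus> x [^] n) = y \<oplus> x [^] (n - k)"
    using y by (simp add: m_assoc[symmetric])
  then have "y \<oplus> x [^] (n - k) \<in> Units Q" using n(2) Units_m_closed[OF Units_inv_Units[OF xpU]] by metis
  then show ?thesis using n(1) by (intro exI[of _ "n - k"]) auto
qed

section \<open>Uniformizers of the integral closure\<close>

text \<open>The primes of B over x. As B / xB has finite length they are maximal, see
  \<open>regprime_inverse\<close>.\<close>

definition regprime :: "'a set \<Rightarrow> bool" where
  "regprime n \<longleftrightarrow> submod B n \<and> n \<subseteq> B \<and> \<one> \<notin> n \<and> x \<in> n \<and> (\<forall>a\<in>B. \<forall>b\<in>B. a \<otimes> b \<in> n \<longrightarrow> a \<in> n \<or> b \<in> n)"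

lemma regprimeD:
  assumes "regprime n"
  shows "submod B n" "n \<subseteq> B" "\<one> \<notin> n" "x \<in> n" "\<And>a b. a \<in> B \<Longrightarrow> b \<in> B \<Longrightarrow> a \<otimes> b \<in> n \<Longrightarrow> a \<in> n \<or> b \<in> n"
  using assms unfolding regprime_def by blast+

lemma fin_len_B: "fin_len R (scal (x [^] (n::nat)) B) B"
proof -
  obtain k where k: "\<And>b. b \<in> B \<Longrightarrow> x [^] (k::nat) \<otimes> b \<in> R" using B_bounded by blast
  show ?thesis
  proof (rule fin_len_shift)
    show "submod R (scal (x [^] n) B)" using submod_scal[OF R submod_BR[OF B_self] xpC] .
    show "submod R B" using submod_BR[OF B_self] .
    show "scal (x [^] k) B \<subseteq> R" unfolding scal_def using k by blast
    show "scal (x [^] n) R \<subseteq> scal (x [^] n) B" using scal_mono[OF RB] .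
  qed
qed

lemma scal_x_B: "submod B (scal (x [^] (n::nat)) B)" "scal (x [^] n) B \<subseteq> B"
  using submod_scal[OF B_subring B_self xpC] B_closed(4)[OF xpB] unfolding scal_def by auto

lemma scal_x1: "scal (x [^] (1::nat)) B = scal x B" using xC by simp

lemma scal_x_subset: "submod B N \<Longrightarrow> x [^] (k::nat) \<in> N \<Longrightarrow> scal (x [^] k) B \<subseteq> N"
proof
  fix y assume N: "submod B N" "x [^] k \<in> N" and "y \<in> scal (x [^] k) B"
  then obtain b where b: "b \<in> B" "y = x [^] k \<otimes> b" by (auto elim: scalE)
  then show "y \<in> N" using submodD(5)[OF N(1) b(1) N(2)] BC[OF b(1)] by (simp add: m_comm)
qed

lemma B_maximal:
  assumes F: "\<And>N. N \<in> F \<Longrightarrow> submod B N \<and> x [^] (k::nat) \<in> N \<and> N \<subseteq> B" and ne: "F \<noteq> {}"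
  shows "\<exists>N\<in>F. \<forall>N'\<in>F. N \<subseteq> N' \<longrightarrow> N' = N"
proof (rule fin_len_maximal[OF R fin_len_B[of k] submod_BR[OF scal_x_B(1)] _ ne])
  fix N assume "N \<in> F"
  from F[OF this] show "submod R N \<and> scal (x [^] k) B \<subseteq> N \<and> N \<subseteq> B"
    using submod_BR scal_x_subset by blast
qed

text \<open>The ideals b^j B + xB become stationary, so b^j (1 - bc) \<in> xB for some j and c. The
  prime n does not contain b^j, so it contains the other factor: B / n is a field.\<close>

lemma regprime_inverse:
  assumes n: "regprime n" and b: "b \<in> B" "b \<notin> n" shows "\<exists>c\<in>B. \<one> \<ominus> b \<otimes> c \<in> n"
proof -
  note N = regprimeD[OF n]
  have bC: "b \<in> carrier Q" using BC b by blast
  have bp: "b [^] (j::nat) \<in> B \<and> b [^] j \<notin> n" for j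
  proof (induction j)
    case 0 then show ?case using N B_closed by simp
  next
    case (Suc j) then show ?case using N(5)[of "b [^] j" b] b B_closed(4) by auto
  qed
  have m: "submod B (scal (b [^] (j::nat)) B)" for j using submod_scal[OF B_subring B_self] bC by simp
  have mB: "scal (b [^] (j::nat)) B \<subseteq> B" for j using B_closed(4) bp unfolding scal_def by blast
  have mx: "submod B (scal x B)" "scal x B \<subseteq> B" using scal_x_B[of 1] scal_x1 by auto
  define g where "g j = msum (scal (b [^] (j::nat)) B) (scal x B)" for j
  have "\<exists>n. \<forall>m\<ge>n. g m = g n"
  proof (rule fin_len_dcc[OF R fin_len_B[of 1] submod_BR[OF scal_x_B(1)]])
    fix i
    show "submod R (g i) \<and> scal (x [^] (1::nat)) B \<subseteq> g i \<and> g i \<subseteq> B"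
      unfolding g_def scal_x1
      using submod_BR[OF submod_msum[OF B_subring m mx(1)]] msum_ge2[OF m mx(1)] msum_le[OF B_self mB mx(2)] by simp
    have "scal (b [^] Suc i) B \<subseteq> scal (b [^] i) B"
    proof
      fix y assume "y \<in> scal (b [^] Suc i) B"
      then obtain c where c: "c \<in> B" "y = b [^] Suc i \<otimes> c" by (rule scalE)
      then have "y = b [^] i \<otimes> (b \<otimes> c)" using bC BC by (simp add: m_assoc)
      then show "y \<in> scal (b [^] i) B" using scalI[OF B_closed(4)[OF b(1) c(1)]] by simp
    qed
    then show "g (Suc i) \<subseteq> g i" unfolding g_def using msum_mono by blast
  qed
  then obtain j where j: "g (Suc j) = g j" by (metis le_SucI order_refl)
  have "b [^] j \<in> scal (b [^] j) B" using scalI[of \<one> B "b [^] j"] B_closed bC by simp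
  then have "b [^] j \<in> g j" unfolding g_def using msum_ge1[OF m mx(1)] by blast
  then have "b [^] j \<in> g (Suc j)" unfolding j .
  then obtain c d where c: "c \<in> B" "d \<in> B" "b [^] j = b [^] Suc j \<otimes> c \<oplus> x \<otimes> d" unfolding g_def msum_def scal_def by blast
  have C: "c \<in> carrier Q" "d \<in> carrier Q" "b [^] j \<in> carrier Q" using BC c bC by auto
  have "b [^] j \<otimes> (\<one> \<ominus> b \<otimes> c) = b [^] j \<ominus> b [^] Suc j \<otimes> c"
    using C bC by (simp add: a_minus_def r_distr r_minus m_assoc)
  also have "\<dots> = (b [^] Suc j \<otimes> c \<oplus> x \<otimes> d) \<ominus> b [^] Suc j \<otimes> c" using c(3) by simp
  also have "\<dots> = d \<otimes> x" using C bC xC nat_pow_closed[OF bC, of "Suc j"] by algebra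
  finally have "b [^] j \<otimes> (\<one> \<ominus> b \<otimes> c) \<in> n" using submodD(5)[OF N(1) c(2) N(4)] by simp
  moreover have "\<one> \<ominus> b \<otimes> c \<in> B" using submod_diff[OF B_self B_subring] B_closed b c by simp
  ultimately have "\<one> \<ominus> b \<otimes> c \<in> n" using N(5)[of "b [^] j"] bp by blast
  then show ?thesis using c by blast
qed

text \<open>An element whose annihilator modulo the localization of \<open>xB\<close> is maximal is annihilated by \<open>n\<close>
  there; one common denominator outside \<open>n\<close> then descends this to \<open>B\<close>.\<close>

lemma regprime_socle:
  assumes n: "regprime n" shows "\<exists>b\<in>B. b \<notin> scal x B \<and> (\<forall>c\<in>n. c \<otimes> b \<in> scal x B)"
proof -
  note N = regprimeD[OF n]
  have xB': "submod B (scal x B)" "scal x B \<subseteq> B" using scal_x_B[of 1] scal_x1 by auto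
  have xn: "scal x B \<subseteq> n" using scal_x_subset[OF N(1), of 1] N(4) xC by simp
  have xx: "x \<in> scal x B" using scalI[of \<one> B x] B_closed xC by simp
  have n_mult: "u \<otimes> v \<in> B - n" if "u \<in> B - n" "v \<in> B - n" for u v
    using that N(5)[of u v] B_closed(4) by blast
  \<comment> \<open>D is the contraction to B of the localization of xB at n.\<close>
  define D where "D = {d \<in> B. \<exists>u\<in>B - n. u \<otimes> d \<in> scal x B}"
  have DI: "d \<in> D \<longleftrightarrow> d \<in> B \<and> (\<exists>u\<in>B - n. u \<otimes> d \<in> scal x B)" for d unfolding D_def by blast
  have D: "submod B D"
  proof (rule submodI)
    show "D \<subseteq> carrier Q" using DI BC by blast
    have "\<one> \<otimes> \<zero> \<in> scal x B" using submodD(3)[OF xB'(1)] by simp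
    then show "\<zero> \<in> D" using DI N(3) B_closed by blast
  next
    fix a b assume "a \<in> D" "b \<in> D"
    then obtain u v where u: "u \<in> B - n" "u \<otimes> a \<in> scal x B" "v \<in> B - n" "v \<otimes> b \<in> scal x B" "a \<in> B" "b \<in> B"
      using DI by blast
    have c: "u \<in> carrier Q" "v \<in> carrier Q" "a \<in> carrier Q" "b \<in> carrier Q" using BC u by auto
    have uv: "u \<in> B" "v \<in> B" using u by auto
    have "v \<otimes> (u \<otimes> a) \<oplus> u \<otimes> (v \<otimes> b) \<in> scal x B"
      using submodD(4)[OF xB'(1) submodD(5)[OF xB'(1) uv(2) u(2)] submodD(5)[OF xB'(1) uv(1) u(4)]] .
    moreover have "v \<otimes> (u \<otimes> a) \<oplus> u \<otimes> (v \<otimes> b) = (u \<otimes> v) \<otimes> (a \<oplus> b)" using c by algebra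
    ultimately show "a \<oplus> b \<in> D" using DI n_mult[OF u(1,3)] B_closed(5)[OF u(5,6)] by auto
  next
    fix s a assume s: "s \<in> B" and "a \<in> D"
    then obtain u where u: "u \<in> B - n" "u \<otimes> a \<in> scal x B" "a \<in> B" using DI by blast
    have c: "u \<in> carrier Q" "a \<in> carrier Q" "s \<in> carrier Q" using BC u s by auto
    have "s \<otimes> (u \<otimes> a) \<in> scal x B" using submodD(5)[OF xB'(1) s u(2)] .
    moreover have "s \<otimes> (u \<otimes> a) = u \<otimes> (s \<otimes> a)" using c by algebra
    ultimately show "s \<otimes> a \<in> D" using DI u(1) B_closed(4)[OF s u(3)] by auto
  qed
  have DB: "D \<subseteq> B" using DI by blast
  have xD: "scal x B \<subseteq> D"
  proof
    fix d assume d: "d \<in> scal x B"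
    then have "\<one> \<otimes> d \<in> scal x B" "d \<in> B" using xB' BC by auto
    then show "d \<in> D" using DI N(3) B_closed by blast
  qed
  have oneD: "\<one> \<notin> D"
  proof
    assume "\<one> \<in> D"
    then obtain u where u: "u \<in> B - n" "u \<otimes> \<one> \<in> scal x B" using DI by blast
    have "u \<in> carrier Q" using u BC by blast
    then show False using u xn by auto
  qed
  define an where "an b = B \<inter> {a \<in> carrier Q. b \<otimes> a \<in> D}" for b
  have anI: "a \<in> an b \<longleftrightarrow> a \<in> B \<and> b \<otimes> a \<in> D" for a b unfolding an_def using BC by blast
  have an: "submod B (an b) \<and> x [^] (1::nat) \<in> an b \<and> an b \<subseteq> B" if "b \<in> B" for b
  proof -
    have "submod B (an b)" unfolding an_def using submod_Int[OF B_self submod_preimage[OF B_subring D BC[OF that]]] .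
    moreover have "x \<in> an b" using anI xB submodD(5)[OF D that, of x] xx xD by blast
    ultimately show ?thesis unfolding an_def using xC by auto
  qed
  have "\<exists>N\<in>an ` (B - D). \<forall>N'\<in>an ` (B - D). N \<subseteq> N' \<longrightarrow> N' = N"
  proof (rule B_maximal[where k = 1])
    show "an ` (B - D) \<noteq> {}" using oneD B_closed by blast
  qed (use an in blast)
  then obtain b where b: "b \<in> B" "b \<notin> D" and max: "\<And>h. h \<in> B \<Longrightarrow> h \<notin> D \<Longrightarrow> an b \<subseteq> an h \<Longrightarrow> an h = an b" by auto
  have bC: "b \<in> carrier Q" using b BC by blast
  \<comment> \<open>Maximality makes the annihilator (D : b) prime. It lies in n and, being a
    maximal ideal by \<open>regprime_inverse\<close>, equals n.\<close>
  have pb: "regprime (an b)"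
    unfolding regprime_def
  proof (intro conjI ballI impI)
    show "submod B (an b)" "an b \<subseteq> B" using an b by auto
    show "x \<in> an b" using an[OF b(1)] xC by simp
    show "\<one> \<notin> an b" using anI b bC by simp
    fix c d assume cd: "c \<in> B" "d \<in> B" "c \<otimes> d \<in> an b"
    have C: "c \<in> carrier Q" "d \<in> carrier Q" using BC cd by auto
    show "c \<in> an b \<or> d \<in> an b"
    proof (cases "c \<in> an b")
      case False
      then have h: "b \<otimes> c \<notin> D" "b \<otimes> c \<in> B" using anI cd b B_closed(4) by auto
      have "an b \<subseteq> an (b \<otimes> c)"
      proof
        fix a assume a: "a \<in> an b"
        then have "c \<otimes> (b \<otimes> a) \<in> D" using anI submodD(5)[OF D cd(1)] by blast
        moreover have "c \<otimes> (b \<otimes> a) = b \<otimes> c \<otimes> a" using C bC a anI BC by (simp add: m_ac)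
        ultimately show "a \<in> an (b \<otimes> c)" using anI a by simp
      qed
      then have "an (b \<otimes> c) = an b" using max h by blast
      moreover have "d \<in> an (b \<otimes> c)" using cd anI bC C by (simp add: m_assoc)
      ultimately show ?thesis by simp
    qed simp
  qed
  have sub: "an b \<subseteq> n"
  proof
    fix c assume c: "c \<in> an b"
    then have cB: "c \<in> B" "b \<otimes> c \<in> D" using anI by auto
    obtain u where u: "u \<in> B - n" "u \<otimes> (b \<otimes> c) \<in> scal x B" using cB DI by blast
    show "c \<in> n"
    proof (rule ccontr)
      assume "c \<notin> n"
      then have "u \<otimes> c \<in> B - n" using n_mult u cB by blast
      moreover have "(u \<otimes> c) \<otimes> b \<in> scal x B" using u bC BC cB by (simp add: m_ac)
      ultimately show False using DI b by blast
    qed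
  qed
  have nb: "n \<subseteq> an b"
  proof
    fix c assume c: "c \<in> n"
    show "c \<in> an b"
    proof (rule ccontr)
      assume "c \<notin> an b"
      then obtain d where d: "d \<in> B" "\<one> \<ominus> c \<otimes> d \<in> an b" using regprime_inverse[OF pb, of c] c N(2) by blast
      have C: "c \<in> carrier Q" "d \<in> carrier Q" using c N(2) d BC by auto
      have "(\<one> \<ominus> c \<otimes> d) \<oplus> d \<otimes> c \<in> n" using submodD(4)[OF N(1)] submodD(5)[OF N(1) d(1) c] d sub by blast
      moreover have "(\<one> \<ominus> c \<otimes> d) \<oplus> d \<otimes> c = \<one>" using C by algebra
      ultimately show False using N(3) by simp
    qed
  qed
  \<comment> \<open>Submodules of D with one denominator for all elements. Adjoining a single d
    multiplies two denominators, so a maximal such submodule is D itself.\<close>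
  define F where "F = {E. submod B E \<and> x [^] (1::nat) \<in> E \<and> E \<subseteq> D \<and> (\<exists>u\<in>B - n. \<forall>e\<in>E. u \<otimes> e \<in> scal x B)}"
  have FI: "E \<in> F \<longleftrightarrow> submod B E \<and> x [^] (1::nat) \<in> E \<and> E \<subseteq> D \<and> (\<exists>u\<in>B - n. \<forall>e\<in>E. u \<otimes> e \<in> scal x B)" for E
    unfolding F_def by blast
  have "scal x B \<in> F"
    unfolding FI
  proof (intro conjI bexI[of _ \<one>] ballI)
    show "submod B (scal x B)" by fact
    show "x [^] (1::nat) \<in> scal x B" using xx xC by simp
    show "\<one> \<otimes> e \<in> scal x B" if "e \<in> scal x B" for e using that xB' BC by auto
    show "\<one> \<in> B - n" using N B_closed by blast
  qed fact
  then have "F \<noteq> {}" by blast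
  have "\<exists>N\<in>F. \<forall>N'\<in>F. N \<subseteq> N' \<longrightarrow> N' = N"
    by (rule B_maximal[where k = 1]) (use FI DB \<open>F \<noteq> {}\<close> in auto)
  then obtain E where E: "E \<in> F" "\<And>E'. E' \<in> F \<Longrightarrow> E \<subseteq> E' \<Longrightarrow> E' = E" by auto
  obtain u where u: "u \<in> B - n" "\<And>e. e \<in> E \<Longrightarrow> u \<otimes> e \<in> scal x B" and Em: "submod B E" "x [^] (1::nat) \<in> E" "E \<subseteq> D"
    using E(1) FI by auto
  have uB: "u \<in> B" "u \<in> carrier Q" using u BC by auto
  have DE: "D \<subseteq> E"
  proof
    fix d assume d: "d \<in> D"
    then obtain v where v: "v \<in> B - n" "v \<otimes> d \<in> scal x B" using DI by blast
    have vB: "v \<in> B" "v \<in> carrier Q" using v BC by auto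
    have dC: "d \<in> carrier Q" using submodD(2)[OF D d] .
    have md: "submod B (scal d B)" using submod_scal[OF B_subring B_self dC] .
    have mdD: "scal d B \<subseteq> D"
    proof
      fix y assume "y \<in> scal d B"
      then obtain s where "s \<in> B" "y = d \<otimes> s" by (rule scalE)
      then show "y \<in> D" using submodD(5)[OF D _ d, of s] dC BC by (simp add: m_comm)
    qed
    let ?E = "msum E (scal d B)"
    have "?E \<in> F"
      unfolding FI
    proof (intro conjI bexI[of _ "u \<otimes> v"] ballI)
      show "submod B ?E" using submod_msum[OF B_subring Em(1) md] .
      show "x [^] (1::nat) \<in> ?E" using msum_ge1[OF Em(1) md] Em(2) by blast
      show "?E \<subseteq> D" using msum_le[OF D Em(3) mdD] .
      show "u \<otimes> v \<in> B - n" using n_mult u v by blast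
      fix e assume "e \<in> ?E"
      then obtain a s where a: "a \<in> E" "s \<in> B" "e = a \<oplus> d \<otimes> s" unfolding msum_def scal_def by blast
      have c: "a \<in> carrier Q" "s \<in> carrier Q" using submodD(2)[OF Em(1) a(1)] BC a by auto
      have us: "u \<otimes> s \<in> B" using B_closed uB a by blast
      have "v \<otimes> (u \<otimes> a) \<oplus> (u \<otimes> s) \<otimes> (v \<otimes> d) \<in> scal x B"
        using submodD(4)[OF xB'(1) submodD(5)[OF xB'(1) vB(1) u(2)[OF a(1)]] submodD(5)[OF xB'(1) us v(2)]] .
      moreover have "v \<otimes> (u \<otimes> a) \<oplus> (u \<otimes> s) \<otimes> (v \<otimes> d) = u \<otimes> v \<otimes> e"
        unfolding a(3) using c dC uB vB by algebra
      ultimately show "u \<otimes> v \<otimes> e \<in> scal x B" by simp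
    qed
    then have "?E = E" using E(2) msum_ge1[OF Em(1) md] by blast
    moreover have "d \<in> scal d B" using scalI[of \<one> B d] B_closed dC by simp
    ultimately show "d \<in> E" using msum_ge2[OF Em(1) md] by blast
  qed
  have "u \<otimes> b \<in> B" using B_closed uB b by blast
  moreover have "u \<otimes> b \<notin> scal x B" using DI b u by blast
  moreover have "c \<otimes> (u \<otimes> b) \<in> scal x B" if c: "c \<in> n" for c
  proof -
    have "u \<otimes> (b \<otimes> c) \<in> scal x B" using c nb anI DE u by blast
    moreover have "u \<otimes> (b \<otimes> c) = c \<otimes> (u \<otimes> b)" using c N(2) BC bC uB by (simp add: m_ac subset_eq)
    ultimately show ?thesis by simp
  qed
  ultimately show ?thesis by blast
qed

text \<open>The multiplier y maps n into B and t outside n. So each c in n is t times the fraction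
  (yc) / (yt), whose denominator is outside n: locally t generates n.\<close>

definition uniformizer :: "'a set \<Rightarrow> 'a \<Rightarrow> bool" where
  "uniformizer n t \<longleftrightarrow> t \<in> n \<and> t \<in> Units Q \<and> (\<exists>y\<in>Units Q. y \<otimes> t \<in> B - n \<and> (\<forall>c\<in>n. y \<otimes> c \<in> B))"

lemma not_regprime_add:
  assumes n: "regprime n" and a: "a \<in> B" "a \<notin> n" and b: "b \<in> n" shows "a \<oplus> b \<in> B - n"
proof -
  note N = regprimeD[OF n]
  have "b \<in> B" using N b by blast
  moreover have "a \<oplus> b \<notin> n"
    using submod_cancel[OF N(1) B_subring b BC[OF a(1)]] a_comm[OF BC[OF a(1)] BC[OF \<open>b \<in> B\<close>]] a(2) by metis
  ultimately show ?thesis using B_closed(5) a by blast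
qed

lemma regprime_mult: "regprime n \<Longrightarrow> u \<in> B - n \<Longrightarrow> v \<in> B - n \<Longrightarrow> u \<otimes> v \<in> B - n"
  using regprimeD(5)[of n u v] B_closed(4) by blast

lemma xpow_regprime: "regprime n \<Longrightarrow> j > 0 \<Longrightarrow> x [^] (j::nat) \<in> n"
  using submodD(5)[OF regprimeD(1), of n "x [^] (j - 1)" x] regprimeD(4)[of n] nat_pow_Suc[of x "j - 1"] by simp

lemma regprime_uniformizer:
  assumes n: "regprime n" shows "\<exists>t. uniformizer n t"
proof -
  note N = regprimeD[OF n]
  obtain b where b: "b \<in> B" "b \<notin> scal x B" "\<And>c. c \<in> n \<Longrightarrow> c \<otimes> b \<in> scal x B" using regprime_socle[OF n] by blast
  have bC: "b \<in> carrier Q" using BC b by blast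
  have nC: "c \<in> carrier Q" if "c \<in> n" for c using that N BC by blast
  have ix: "inv x \<in> carrier Q" using xU by blast
  define y0 where "y0 = inv x \<otimes> b"
  have y0C: "y0 \<in> carrier Q" unfolding y0_def using ix bC by simp
  have y0n: "y0 \<otimes> c \<in> B" if c: "c \<in> n" for c
  proof -
    obtain e where e: "e \<in> B" "c \<otimes> b = x \<otimes> e" using b(3)[OF c] by (rule scalE)
    have "y0 \<otimes> c = inv x \<otimes> (c \<otimes> b)" unfolding y0_def using nC[OF c] bC ix by (simp add: m_ac)
    also have "\<dots> = e" unfolding e(2) using xU xC BC[OF e(1)] by (simp add: m_assoc[symmetric])
    finally show ?thesis using e by simp
  qed
  have y0B: "y0 \<notin> B"
  proof
    assume "y0 \<in> B"
    then have "x \<otimes> y0 \<in> scal x B" by (rule scalI)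
    moreover have "x \<otimes> y0 = b" unfolding y0_def using xU xC bC by (simp add: m_assoc[symmetric])
    ultimately show False using b by simp
  qed
  obtain t0 where t0: "t0 \<in> n" "y0 \<otimes> t0 \<notin> n"
  proof (rule ccontr)
    assume "\<not> thesis"
    then have y0n': "\<And>c. c \<in> n \<Longrightarrow> y0 \<otimes> c \<in> n" using that by blast
    obtain k where k: "\<And>b. b \<in> B \<Longrightarrow> x [^] (k::nat) \<otimes> b \<in> R" using B_bounded by blast
    \<comment> \<open>If y0 maps n into itself, then x^(-1) n is a module containing 1, stable under
      y0 and with bounded denominators; this makes y0 integral.\<close>
    have "y0 \<in> B"
    proof (rule B_I[OF y0C, of "scal (inv x) n" "Suc k"])
      show "submod R (scal (inv x) n)" using submod_scal[OF R submod_BR[OF N(1)] ix] .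
      show "\<one> \<in> scal (inv x) n" using scalI[OF N(4), of "inv x"] xU by simp
    next
      fix a assume "a \<in> scal (inv x) n"
      then obtain c where c: "c \<in> n" "a = inv x \<otimes> c" by (rule scalE)
      have "y0 \<otimes> a = inv x \<otimes> (y0 \<otimes> c)" unfolding c(2) using ix y0C nC[OF c(1)] by (simp add: m_lcomm)
      then show "y0 \<otimes> a \<in> scal (inv x) n" using scalI[OF y0n'[OF c(1)]] by simp
      have "x [^] Suc k \<otimes> a = x [^] k \<otimes> ((x \<otimes> inv x) \<otimes> c)"
        unfolding c(2) using ix xC nC[OF c(1)] by (simp add: m_assoc)
      then show "x [^] Suc k \<otimes> a \<in> R" using k[of c] c N(2) nC[OF c(1)] xU by auto
    qed
    then show False using y0B by blast
  qed
  \<comment> \<open>y0 maps n only into B, so x^j needs one factor x to be absorbed by y0 and a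
    further one to stay in n.\<close>
  obtain j where j: "j \<ge> 2" "t0 \<oplus> x [^] (j::nat) \<in> Units Q" using unit_shift[OF nC[OF t0(1)]] by blast
  define t where "t = t0 \<oplus> x [^] j"
  have tn: "t \<in> n" unfolding t_def using submodD(4)[OF N(1) t0(1) xpow_regprime[OF n]] j by simp
  obtain l where l: "j = Suc (Suc l)" using j(1) by (metis One_nat_def Suc_1 Suc_le_D le_SucE Suc_le_mono)
  have "y0 \<otimes> t = y0 \<otimes> t0 \<oplus> (y0 \<otimes> x) \<otimes> x [^] Suc l"
    unfolding t_def l using y0C nC[OF t0(1)] xC by (simp add: r_distr m_ac)
  moreover have "(y0 \<otimes> x) \<otimes> x [^] Suc l \<in> n"
    using submodD(5)[OF N(1) y0n[OF N(4)] xpow_regprime[OF n, of "Suc l"]] by simp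
  ultimately have y0t: "y0 \<otimes> t \<in> B - n" using not_regprime_add[OF n y0n[OF t0(1)] t0(2)] by metis
  obtain i where i: "y0 \<oplus> x [^] (i::nat) \<in> Units Q" using unit_shift[OF y0C] by blast
  define y where "y = y0 \<oplus> x [^] i"
  have yc: "y \<otimes> c = y0 \<otimes> c \<oplus> x [^] i \<otimes> c" if "c \<in> n" for c
    unfolding y_def using nC[OF that] y0C xC by (simp add: l_distr)
  have "y \<otimes> t \<in> B - n"
    unfolding yc[OF tn] using not_regprime_add[OF n _ _ submodD(5)[OF N(1) xpB tn]] y0t by blast
  moreover have "y \<otimes> c \<in> B" if c: "c \<in> n" for c
    unfolding yc[OF c] using B_closed(5)[OF y0n[OF c] B_closed(4)[OF xpB]] N(2) c by blast
  moreover have "t \<in> Units Q" "y \<in> Units Q" using j i unfolding t_def y_def by auto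
  ultimately show ?thesis unfolding uniformizer_def using tn by blast
qed

text \<open>The localization of B at n, seen inside Q. The denominator u may be a zero divisor, so
  this is the preimage in Q of the localized ring and not a set of fractions b / u.\<close>

definition local_at :: "'a set \<Rightarrow> 'a set" where
  "local_at n = {y \<in> carrier Q. \<exists>u\<in>B - n. u \<otimes> y \<in> B}"

lemma local_atI: "y \<in> carrier Q \<Longrightarrow> u \<in> B - n \<Longrightarrow> u \<otimes> y \<in> B \<Longrightarrow> y \<in> local_at n"
  unfolding local_at_def by blast

lemma local_atE:
  assumes "y \<in> local_at n" obtains u where "u \<in> B" "u \<notin> n" "u \<otimes> y \<in> B" "y \<in> carrier Q" "u \<in> carrier Q"
  using assms BC unfolding local_at_def by blast

lemma B_local_at: "regprime n \<Longrightarrow> B \<subseteq> local_at n"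
proof
  fix b assume n: "regprime n" and b: "b \<in> B"
  show "b \<in> local_at n" by (rule local_atI[of b \<one>]) (use b BC regprimeD(3)[OF n] B_closed in auto)
qed

lemma local_at_subring: assumes n: "regprime n" shows "subring (local_at n) Q"
proof (rule subringI)
  show "local_at n \<subseteq> carrier Q" unfolding local_at_def by blast
  show "\<one> \<in> local_at n" using B_local_at[OF n] B_closed by blast
next
  fix h assume h: "h \<in> local_at n"
  obtain u where u: "u \<in> B" "u \<notin> n" "u \<otimes> h \<in> B" "h \<in> carrier Q" "u \<in> carrier Q" using h by (rule local_atE)
  have "u \<otimes> \<ominus> h = \<ominus> (u \<otimes> h)" using u by (simp add: r_minus)
  then show "\<ominus> h \<in> local_at n" using local_atI[of "\<ominus> h" u n] u B_closed by simp
next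
  fix h k assume h: "h \<in> local_at n" and k: "k \<in> local_at n"
  obtain u where u: "u \<in> B" "u \<notin> n" "u \<otimes> h \<in> B" "h \<in> carrier Q" "u \<in> carrier Q" using h by (rule local_atE)
  obtain v where v: "v \<in> B" "v \<notin> n" "v \<otimes> k \<in> B" "k \<in> carrier Q" "v \<in> carrier Q" using k by (rule local_atE)
  have uv: "u \<otimes> v \<in> B - n" using regprime_mult[OF n] u v by blast
  have "(u \<otimes> v) \<otimes> (h \<otimes> k) = (u \<otimes> h) \<otimes> (v \<otimes> k)" using u v by (simp add: m_ac)
  then show "h \<otimes> k \<in> local_at n" using local_atI[OF _ uv, of "h \<otimes> k"] u v B_closed by simp
  have "(u \<otimes> v) \<otimes> (h \<oplus> k) = v \<otimes> (u \<otimes> h) \<oplus> u \<otimes> (v \<otimes> k)" using u v by (simp add: m_ac r_distr)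
  then show "h \<oplus> k \<in> local_at n" using local_atI[OF _ uv, of "h \<oplus> k"] u v B_closed by simp
qed

lemma local_at_inv: "u \<in> B - n \<Longrightarrow> u \<in> Units Q \<Longrightarrow> inv u \<in> local_at n"
  by (rule local_atI[of _ u]) (auto simp: B_closed)

text \<open>A denominator for z / t is y t u: it lies outside n and multiplies z / t to y (uz),
  where uz \<in> n.\<close>

lemma uniformizer_quot:
  assumes n: "regprime n" and t: "uniformizer n t" and z: "z \<in> carrier Q" and u: "u \<in> B - n" "u \<otimes> z \<in> n"
  shows "inv t \<otimes> z \<in> local_at n"
proof -
  obtain y where y: "y \<in> Units Q" "y \<otimes> t \<in> B - n" "\<And>c. c \<in> n \<Longrightarrow> y \<otimes> c \<in> B" and tU: "t \<in> Units Q"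
    using t unfolding uniformizer_def by blast
  have c: "y \<in> carrier Q" "t \<in> carrier Q" "inv t \<in> carrier Q" "u \<in> carrier Q" using y tU u BC by auto
  have "((y \<otimes> t) \<otimes> u) \<otimes> (inv t \<otimes> z) = (t \<otimes> inv t) \<otimes> (y \<otimes> (u \<otimes> z))"
    using c z by algebra
  then have "((y \<otimes> t) \<otimes> u) \<otimes> (inv t \<otimes> z) = y \<otimes> (u \<otimes> z)" using tU c z by simp
  then show ?thesis
    using local_atI[OF _ regprime_mult[OF n y(2) u(1)], of "inv t \<otimes> z"] c z y(3)[OF u(2)] by simp
qed

text \<open>Discreteness of V in terms of units of Q: each of them is a power of t times a unit of
  V.\<close>

definition val_uniformizer :: "'a set \<Rightarrow> 'a \<Rightarrow> bool" where
  "val_uniformizer V t \<longleftrightarrow> t \<in> Units Q \<and> t \<in> V \<and> inv t \<notin> V \<and>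
     (\<forall>z\<in>Units Q. \<exists>k w. w \<in> Units Q \<and> w \<in> V \<and> inv w \<in> V \<and> z = zpow t k \<otimes> w)"

lemma uniformizer_inv_notin:
  assumes n: "regprime n" and t: "uniformizer n t" shows "inv t \<notin> local_at n"
proof
  note N = regprimeD[OF n]
  have tn: "t \<in> n" and tU: "t \<in> Units Q" using t unfolding uniformizer_def by auto
  assume "inv t \<in> local_at n"
  then obtain u where u: "u \<in> B" "u \<notin> n" "u \<otimes> inv t \<in> B" "inv t \<in> carrier Q" "u \<in> carrier Q" by (rule local_atE)
  have "(u \<otimes> inv t) \<otimes> t = u" using u tU by (simp add: m_assoc Units_closed)
  then show False using submodD(5)[OF N(1) u(3) tn] u by simp
qed

text \<open>The intersections of B with t^j \<open>local_at n\<close> decrease strictly, as t^j lies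
  in the j-th but not in the next one. If t^k divides x^m locally, the first k + 1 of them contain
  x^m B, so k is at most the length of B / x^m B.\<close>

lemma uniformizer_bounded:
  assumes n: "regprime n" and t: "uniformizer n t" and k: "zpow t (- int k) \<otimes> x [^] (m::nat) \<in> local_at n"
  shows "k \<le> len R (scal (x [^] m) B) B"
proof -
  note N = regprimeD[OF n]
  have tn: "t \<in> n" and tU: "t \<in> Units Q" using t unfolding uniformizer_def by auto
  have tC: "t \<in> carrier Q" using tU by blast
  have tB: "t \<in> B" using tn N by blast
  note V = local_at_subring[OF n]
  have VR: "submod R (local_at n)" using submod_weaken[OF submod_self[OF V]] B_local_at[OF n] RB by blast
  have tV: "t [^] (j::nat) \<in> local_at n" for j
    using tB B_local_at[OF n] subringE(3,6)[OF V] by (induction j) auto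
  define I where "I j = B \<inter> scal (t [^] (j::nat)) (local_at n)" for j
  have Idec: "I (Suc j) \<subset> I j" for j
  proof (rule psubsetI)
    show "I (Suc j) \<subseteq> I j"
    proof
      fix a assume "a \<in> I (Suc j)"
      then obtain c where c: "c \<in> local_at n" "a = t [^] Suc j \<otimes> c" "a \<in> B" unfolding I_def scal_def by blast
      have "a = t [^] j \<otimes> (t \<otimes> c)" using c tC subringE(1)[OF V] by (auto simp: m_assoc)
      then show "a \<in> I j" unfolding I_def using c scalI[of "t \<otimes> c" "local_at n"] subringE(6)[OF V, of t c] tB B_local_at[OF n] by auto
    qed
    have "t [^] j \<in> B" using tB by (induction j) (auto simp: B_closed)
    then have "t [^] j \<in> I j" unfolding I_def using scalI[OF subringE(3)[OF V], of "t [^] j"] tC by simp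
    moreover have "t [^] j \<notin> I (Suc j)"
    proof
      assume "t [^] j \<in> I (Suc j)"
      then obtain c where c: "c \<in> local_at n" "t [^] j = t [^] Suc j \<otimes> c" unfolding I_def scal_def by blast
      have cC: "c \<in> carrier Q" using c subringE(1)[OF V] by blast
      have "t [^] j \<otimes> \<one> = t [^] j \<otimes> (t \<otimes> c)" using c(2) tC cC by (simp add: m_assoc)
      then have "t \<otimes> c = \<one>" using Units_l_cancel[OF Units_pow_closed[OF tU, of j], of \<one> "t \<otimes> c"] tC cC by simp
      then have "inv t = c" using Units_iff_inv[OF tC cC] by simp
      then show False using uniformizer_inv_notin[OF n t] c by simp
    qed
    ultimately show "I (Suc j) \<noteq> I j" by blast
  qed
  have Im: "submod R (I j)" for j
    unfolding I_def using submod_Int[OF submod_BR[OF B_self] submod_scal[OF R VR]] tC by simp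
  have Iant: "I j' \<subseteq> I j" if "j \<le> j'" for j j'
    using lift_Suc_antimono_le[of I, OF _ that] Idec by blast
  have "x [^] m = t [^] k \<otimes> (zpow t (- int k) \<otimes> x [^] m)"
    using zpow_cancel(2)[OF tU xpC, of "int k" m] zpow_nat[OF tU, of k] by simp
  then have xI: "x [^] m \<in> I k" unfolding I_def using scalI[OF k, of "t [^] k"] by simp
  have "scal (x [^] m) B \<subseteq> I k"
  proof
    fix y assume "y \<in> scal (x [^] m) B"
    then obtain b where b: "b \<in> B" "y = x [^] m \<otimes> b" by (rule scalE)
    obtain c where c: "c \<in> local_at n" "x [^] m = t [^] k \<otimes> c" using xI unfolding I_def scal_def by blast
    have "y = t [^] k \<otimes> (c \<otimes> b)" unfolding b(2) c(2) using tC BC[OF b(1)] c(1) subringE(1)[OF V] by (auto simp: m_assoc)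
    moreover have "c \<otimes> b \<in> local_at n" using subringE(6)[OF V c(1)] b B_local_at[OF n] by blast
    moreover have "y \<in> B" using b B_closed(4)[OF xpB] by simp
    ultimately show "y \<in> I k" unfolding I_def using scalI by blast
  qed
  then have "strict_chain R (scal (x [^] m) B) B k"
    unfolding strict_chain_def
  proof (intro exI[of _ "\<lambda>i. I (k - i)"] conjI allI impI)
    fix i assume i: "i < k"
    then have "k - i = Suc (k - Suc i)" by simp
    then show "I (k - i) \<subset> I (k - Suc i)" using Idec[of "k - Suc i"] by simp
  next
    fix i assume "scal (x [^] m) B \<subseteq> I k"
    then show "scal (x [^] m) B \<subseteq> I (k - i)" using Iant[of "k - i" k] by auto
    show "I (k - i) \<subseteq> B" unfolding I_def by blast
  qed (rule Im)
  then show ?thesis using strict_chain_le_len[OF fin_len_B] by blast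
qed

lemma uniformizer_decomp_B:
  assumes n: "regprime n" and t: "uniformizer n t" and z: "z \<in> Units Q" "z \<in> B"
  shows "\<exists>k w. w \<in> Units Q \<and> w \<in> local_at n \<and> inv w \<in> local_at n \<and> z = zpow t k \<otimes> w"
proof -
  note N = regprimeD[OF n]
  note V = local_at_subring[OF n]
  have tU: "t \<in> Units Q" using t unfolding uniformizer_def by auto
  have zC: "z \<in> carrier Q" "inv z \<in> carrier Q" using z by auto
  obtain m where m: "x [^] (m::nat) \<otimes> inv z \<in> R" using xpow_frac[OF zC(2)] by blast
  let ?P = "\<lambda>k. zpow t (- int k) \<otimes> z \<in> local_at n"
  have bd: "k \<le> len R (scal (x [^] m) B) B" if kk: "?P k" for k
  proof -
    have "(zpow t (- int k) \<otimes> z) \<otimes> (x [^] m \<otimes> inv z) \<in> local_at n"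
      using subringE(6)[OF V kk] m RB B_local_at[OF n] by blast
    moreover have "(zpow t (- int k) \<otimes> z) \<otimes> (x [^] m \<otimes> inv z) = (z \<otimes> inv z) \<otimes> (zpow t (- int k) \<otimes> x [^] m)"
      using zC zpow_closed[OF tU] xpC[of m] by algebra
    ultimately have "zpow t (- int k) \<otimes> x [^] m \<in> local_at n" using z tU by simp
    then show ?thesis by (rule uniformizer_bounded[OF n t])
  qed
  have "?P 0" using z B_local_at[OF n] zC by auto
  \<comment> \<open>z divides x^m, so the exponent of t in z is bounded by that in x^m. With k
    maximal, w = t^(-k) z cannot be divided by t once more, which makes it a unit of the
    localization.\<close>
  then obtain k where k: "?P k" "\<And>j. ?P j \<Longrightarrow> j \<le> k"
    using ex_has_greatest_nat[of ?P 0 id "Suc (len R (scal (x [^] m) B) B)"] bd by (metis id_apply le_imp_less_Suc)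
  define w where "w = zpow t (- int k) \<otimes> z"
  have wU: "w \<in> Units Q" unfolding w_def using tU z by simp
  have wC: "w \<in> carrier Q" using wU by blast
  obtain u where u: "u \<in> B" "u \<notin> n" "u \<otimes> w \<in> B" "u \<in> carrier Q" using k(1) unfolding w_def by (auto elim: local_atE)
  have "u \<otimes> w \<notin> n"
  proof
    assume "u \<otimes> w \<in> n"
    then have "inv t \<otimes> w \<in> local_at n" using uniformizer_quot[OF n t wC, of u] u by blast
    moreover have "inv t \<otimes> w = zpow t (- int (Suc k)) \<otimes> z"
      unfolding w_def using zpow_add[OF tU, of "-1" "- int k"] zpow_neg1[OF tU] zC tU by (simp add: m_assoc)
    ultimately show False using k(2)[of "Suc k"] by simp
  qed
  moreover have "(u \<otimes> w) \<otimes> inv w = u" using wU u wC by (simp add: m_assoc)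
  ultimately have "inv w \<in> local_at n" using local_atI[of "inv w" "u \<otimes> w" n] wU u by simp
  moreover have "z = zpow t (int k) \<otimes> w" unfolding w_def using zpow_cancel(2)[OF tU zC(1)] by simp
  ultimately show ?thesis using wU k(1) unfolding w_def by blast
qed

lemma uniformizer_val_uniformizer:
  assumes n: "regprime n" and t: "uniformizer n t" shows "val_uniformizer (local_at n) t"
  unfolding val_uniformizer_def
proof (intro conjI ballI)
  note N = regprimeD[OF n]
  note V = local_at_subring[OF n]
  show tU: "t \<in> Units Q" using t unfolding uniformizer_def by auto
  show "t \<in> local_at n" using t N(2) B_local_at[OF n] unfolding uniformizer_def by blast
  show "inv t \<notin> local_at n" using uniformizer_inv_notin[OF n t] .
  fix z assume z: "z \<in> Units Q"
  then have zC: "z \<in> carrier Q" by blast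
  obtain m where m: "x [^] (m::nat) \<otimes> z \<in> R" using xpow_frac[OF zC] by blast
  have B2: "x [^] m \<otimes> z \<in> Units Q" "x [^] m \<otimes> z \<in> B" using z m RB by auto
  obtain k w where w: "w \<in> Units Q" "w \<in> local_at n" "inv w \<in> local_at n" "x [^] m \<otimes> z = zpow t k \<otimes> w"
    using uniformizer_decomp_B[OF n t B2] by blast
  obtain l v where v: "v \<in> Units Q" "v \<in> local_at n" "inv v \<in> local_at n" "x [^] m = zpow t l \<otimes> v"
    using uniformizer_decomp_B[OF n t xpU xpB] by blast
  have c: "w \<in> carrier Q" "v \<in> carrier Q" "inv v \<in> carrier Q" "inv w \<in> carrier Q"
    "zpow t l \<in> carrier Q" "zpow t (-l) \<in> carrier Q" "zpow t k \<in> carrier Q" using w v tU by auto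
  have "zpow t (k - l) \<otimes> (w \<otimes> inv v) = zpow t (-l) \<otimes> inv v \<otimes> (zpow t k \<otimes> w)"
    using zpow_add[OF tU, of k "- l"] c by (simp add: m_ac)
  also have "\<dots> = (zpow t (-l) \<otimes> zpow t l) \<otimes> (v \<otimes> inv v) \<otimes> z"
    unfolding w(4)[symmetric] v(4) using c zC by algebra
  also have "\<dots> = z" using zpow_minus[OF tU] v(1) zC by simp
  finally have "z = zpow t (k - l) \<otimes> (w \<otimes> inv v)" by simp
  moreover have "inv (w \<otimes> inv v) = inv w \<otimes> v" using inv_mult[of w "inv v"] w v by simp
  ultimately show "\<exists>k w. w \<in> Units Q \<and> w \<in> local_at n \<and> inv w \<in> local_at n \<and> z = zpow t k \<otimes> w"
    using w v subringE(6)[OF V] by (intro exI[of _ "k - l"] exI[of _ "w \<otimes> inv v"]) simp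
qed

text \<open>With \<open>q \<in> n\<close> and \<open>e = 1 - q\<close> in all other primes, \<open>t e + q\<^sup>2\<close> is a uniformizer at \<open>n\<close> and a unit
  elsewhere; a power of \<open>x\<close> makes it regular.\<close>

lemma regprime_approx:
  assumes n: "regprime n" and t: "uniformizer n t" and J: "finite J" "\<And>m. m \<in> J \<Longrightarrow> regprime m \<and> m \<noteq> n"
  shows "\<exists>s\<in>Units Q. s \<otimes> inv t \<in> local_at n \<and> inv (s \<otimes> inv t) \<in> local_at n \<and> (\<forall>m\<in>J. s \<in> local_at m \<and> inv s \<in> local_at m)"
proof -
  note N = regprimeD[OF n]
  note V = local_at_subring[OF n]
  obtain y where y: "y \<in> Units Q" "y \<otimes> t \<in> B - n" "\<And>c. c \<in> n \<Longrightarrow> y \<otimes> c \<in> B" and tU: "t \<in> Units Q" and tn: "t \<in> n"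
    using t unfolding uniformizer_def by blast
  \<comment> \<open>Distinct regular primes do not contain each other, since they are maximal; so
    each m in J has an element outside n, and the product of these serves as p.\<close>
  have "\<exists>p\<in>B - n. \<forall>m\<in>J. p \<in> m"
    using J
  proof (induction J rule: finite_induct)
    case empty then show ?case using N(3) B_closed by blast
  next
    case (insert m J)
    then obtain p where p: "p \<in> B - n" "\<forall>m\<in>J. p \<in> m" by blast
    have m: "regprime m" "m \<noteq> n" using insert.prems by auto
    note Mm = regprimeD[OF m(1)]
    obtain c where c: "c \<in> m" "c \<notin> n"
    proof (rule ccontr)
      assume "\<not> thesis"
      then have mn: "m \<subseteq> n" using that by blast
      then obtain a where a: "a \<in> n" "a \<notin> m" using m by blast
      obtain d where d: "d \<in> B" "\<one> \<ominus> a \<otimes> d \<in> m" using regprime_inverse[OF m(1), of a] a N(2) by blast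
      have C: "a \<in> carrier Q" "d \<in> carrier Q" using a N(2) d BC by auto
      have "(\<one> \<ominus> a \<otimes> d) \<oplus> d \<otimes> a \<in> n" using submodD(4)[OF N(1)] submodD(5)[OF N(1) d(1) a(1)] d mn by blast
      moreover have "(\<one> \<ominus> a \<otimes> d) \<oplus> d \<otimes> a = \<one>" using C by algebra
      ultimately show False using N(3) by simp
    qed
    have cB: "c \<in> B" using c Mm(2) by blast
    have "p \<otimes> c \<in> m'" if "m' \<in> insert m J" for m'
    proof (cases "m' = m")
      case True then show ?thesis using submodD(5)[OF Mm(1), of p c] p c by blast
    next
      case False
      then have "m' \<in> J" using that by blast
      then have "c \<otimes> p \<in> m'" using submodD(5)[OF regprimeD(1)[of m'] cB] insert.prems p by blast
      then show ?thesis using m_comm[of p c] p cB BC by auto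
    qed
    moreover have "p \<otimes> c \<in> B - n" using regprime_mult[OF n p(1)] c cB by blast
    ultimately show ?case by blast
  qed
  then obtain p where p: "p \<in> B" "p \<notin> n" "\<And>m. m \<in> J \<Longrightarrow> p \<in> m" by blast
  obtain b where b: "b \<in> B" "\<one> \<ominus> p \<otimes> b \<in> n" using regprime_inverse[OF n p(1,2)] by blast
  define e where "e = p \<otimes> b"
  define q where "q = \<one> \<ominus> e"
  have eB: "e \<in> B" unfolding e_def using B_closed p b by blast
  have qn: "q \<in> n" using b(2) unfolding q_def e_def .
  have qB: "q \<in> B" using qn N by blast
  have C: "e \<in> carrier Q" "q \<in> carrier Q" "t \<in> carrier Q" "y \<in> carrier Q" "inv t \<in> carrier Q"
    using eB qB BC tU y by auto
  have tB: "t \<in> B" using tn N by blast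
  have en: "e \<notin> n"
  proof
    assume "e \<in> n"
    then have "q \<oplus> e \<in> n" using submodD(4)[OF N(1) qn] by blast
    moreover have "q \<oplus> e = \<one>" unfolding q_def using C by algebra
    ultimately show False using N by simp
  qed
  \<comment> \<open>e is 1 modulo n and 0 modulo each m in J, while q = 1 - e. The square matters:
    yq is only known to lie in B, whereas y q^2 lies in n and leaves y t e as the leading term of
    ys. Modulo m in J, s is congruent to q^2, hence to 1.\<close>
  define s0 where "s0 = t \<otimes> e \<oplus> q \<otimes> q"
  have s0C: "s0 \<in> carrier Q" unfolding s0_def using C by simp
  obtain j where j: "j \<ge> 2" "s0 \<oplus> x [^] (j::nat) \<in> Units Q" using unit_shift[OF s0C] by blast
  define s where "s = s0 \<oplus> x [^] j"
  have sU: "s \<in> Units Q" and sC: "s \<in> carrier Q" using j unfolding s_def by auto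
  obtain l where l: "j = Suc (Suc l)" using j(1) by (metis One_nat_def Suc_1 Suc_le_D le_SucE Suc_le_mono)
  have ys: "y \<otimes> s \<in> B - n"
  proof -
    have "y \<otimes> s = (y \<otimes> t) \<otimes> e \<oplus> ((y \<otimes> q) \<otimes> q \<oplus> (y \<otimes> x) \<otimes> x [^] Suc l)"
      unfolding s_def s0_def l using C xC by (simp add: r_distr m_ac a_ac)
    moreover have "(y \<otimes> t) \<otimes> e \<in> B - n" using regprime_mult[OF n y(2)] eB en by blast
    moreover have "(y \<otimes> q) \<otimes> q \<oplus> (y \<otimes> x) \<otimes> x [^] Suc l \<in> n"
      using submodD(4)[OF N(1) submodD(5)[OF N(1) y(3)[OF qn] qn] submodD(5)[OF N(1) y(3)[OF N(4)] xpow_regprime[OF n, of "Suc l"]]]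
      by simp
    ultimately show ?thesis using not_regprime_add[OF n] by simp
  qed
  have ytU: "y \<otimes> t \<in> Units Q" and ysU: "y \<otimes> s \<in> Units Q" using y tU sU by auto
  have st: "s \<otimes> inv t = inv (y \<otimes> t) \<otimes> (y \<otimes> s)"
  proof -
    have "inv (y \<otimes> t) \<otimes> (y \<otimes> s) = (inv y \<otimes> y) \<otimes> (s \<otimes> inv t)"
      unfolding inv_mult[OF y(1) tU] using C sC y by (simp add: m_ac)
    then show ?thesis using y sC C by simp
  qed
  have "s \<otimes> inv t \<in> local_at n"
    unfolding st using subringE(6)[OF V local_at_inv[OF y(2) ytU]] ys B_local_at[OF n] by blast
  moreover have "inv (s \<otimes> inv t) \<in> local_at n"
    unfolding st using inv_mult[OF Units_inv_Units[OF ytU] ysU] subringE(6)[OF V _ local_at_inv[OF ys ysU]] y(2) B_local_at[OF n] ytU by auto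
  moreover have "s \<in> local_at m \<and> inv s \<in> local_at m" if mJ: "m \<in> J" for m
  proof -
    have m: "regprime m" using J mJ by blast
    note Mm = regprimeD[OF m]
    have em: "e \<in> m" unfolding e_def using submodD(5)[OF Mm(1) b(1) p(3)[OF mJ]] m_comm[of p b] p(1) b(1) BC by simp
    have qm: "q \<notin> m"
    proof
      assume "q \<in> m"
      then have "q \<oplus> e \<in> m" using submodD(4)[OF Mm(1) _ em] by blast
      moreover have "q \<oplus> e = \<one>" unfolding q_def using C by algebra
      ultimately show False using Mm by simp
    qed
    have "t \<otimes> e \<oplus> x [^] j \<in> m"
      using submodD(4)[OF Mm(1) submodD(5)[OF Mm(1) tB em] xpow_regprime[OF m]] j by simp
    moreover have "q \<otimes> q \<in> B - m" using regprime_mult[OF m] qB qm by blast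
    moreover have "s = q \<otimes> q \<oplus> (t \<otimes> e \<oplus> x [^] j)" unfolding s_def s0_def using C xC by (simp add: a_ac)
    ultimately have "s \<in> B - m" using not_regprime_add[OF m] by simp
    then show ?thesis using local_at_inv[OF _ sU] B_local_at[OF m] by blast
  qed
  ultimately show ?thesis using sU by blast
qed

text \<open>The denominators of y form an ideal D of B containing a power of x. If D were proper, an
  ideal maximal among the proper ones above D would be a regular prime; but y being local there
  gives a denominator outside it.\<close>

lemma Int_local_at:
  assumes y: "y \<in> carrier Q" and V: "\<And>n. regprime n \<Longrightarrow> y \<in> local_at n" shows "y \<in> B"
proof -
  define D where "D = B \<inter> {b \<in> carrier Q. y \<otimes> b \<in> B}"
  have D: "submod B D" unfolding D_def using submod_Int[OF B_self submod_preimage[OF B_subring B_self y]] .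
  have DI: "d \<in> D \<longleftrightarrow> d \<in> B \<and> y \<otimes> d \<in> B" for d unfolding D_def using BC by blast
  obtain k where k: "x [^] (k::nat) \<otimes> y \<in> R" using xpow_frac[OF y] by blast
  have kD: "x [^] k \<in> D" using DI k RB y m_comm[OF y xpC] by auto
  have "\<one> \<in> D"
  proof (rule ccontr)
    assume oneD: "\<one> \<notin> D"
    define F where "F = {N. submod B N \<and> D \<subseteq> N \<and> N \<subseteq> B \<and> \<one> \<notin> N}"
    have FI: "N \<in> F \<longleftrightarrow> submod B N \<and> D \<subseteq> N \<and> N \<subseteq> B \<and> \<one> \<notin> N" for N unfolding F_def by blast
    have "D \<in> F" using FI D DI oneD by blast
    then have "\<exists>N\<in>F. \<forall>N'\<in>F. N \<subseteq> N' \<longrightarrow> N' = N"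
      by (intro B_maximal[where k = k]) (use FI kD in auto)
    then obtain N where NF: "N \<in> F" and max: "\<And>N'. N' \<in> F \<Longrightarrow> N \<subseteq> N' \<Longrightarrow> N' = N" by auto
    have N: "submod B N" "D \<subseteq> N" "N \<subseteq> B" "\<one> \<notin> N" using NF FI by auto
    have ex: "\<exists>c\<in>N. \<exists>d\<in>B. \<one> = c \<oplus> a \<otimes> d" if a: "a \<in> B" "a \<notin> N" for a
    proof -
      have ma: "submod B (scal a B)" using submod_scal[OF B_subring B_self BC[OF a(1)]] .
      have maB: "scal a B \<subseteq> B" using B_closed(4)[OF a(1)] unfolding scal_def by blast
      let ?N = "msum N (scal a B)"
      have "a \<in> scal a B" using scalI[of \<one> B a] B_closed BC[OF a(1)] by simp
      then have "a \<in> ?N" using msum_ge2[OF N(1) ma] by blast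
      then have "?N \<noteq> N" using a by blast
      then have "?N \<notin> F" using max msum_ge1[OF N(1) ma] by blast
      then have "\<one> \<in> ?N"
        using FI[of ?N] submod_msum[OF B_subring N(1) ma] msum_ge1[OF N(1) ma] N(2) msum_le[OF B_self N(3) maB] by blast
      then show ?thesis unfolding msum_def scal_def by blast
    qed
    have pr: "a \<in> N \<or> b \<in> N" if ab: "a \<in> B" "b \<in> B" "a \<otimes> b \<in> N" for a b
    proof (rule ccontr)
      assume "\<not> ?thesis"
      then obtain c d c' d' where c: "c \<in> N" "d \<in> B" "\<one> = c \<oplus> a \<otimes> d" and c': "c' \<in> N" "d' \<in> B" "\<one> = c' \<oplus> b \<otimes> d'"
        using ex[OF ab(1)] ex[OF ab(2)] by blast
      have C: "c \<in> carrier Q" "d \<in> carrier Q" "c' \<in> carrier Q" "d' \<in> carrier Q" "a \<in> carrier Q" "b \<in> carrier Q"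
        using c c' ab N(3) BC by auto
      have "\<one> = (c \<oplus> a \<otimes> d) \<otimes> (c' \<oplus> b \<otimes> d')" unfolding c(3)[symmetric] c'(3)[symmetric] by simp
      also have "\<dots> = (c' \<oplus> b \<otimes> d') \<otimes> c \<oplus> ((a \<otimes> d) \<otimes> c' \<oplus> (d \<otimes> d') \<otimes> (a \<otimes> b))" using C by algebra
      also have "\<dots> = \<one> \<otimes> c \<oplus> ((a \<otimes> d) \<otimes> c' \<oplus> (d \<otimes> d') \<otimes> (a \<otimes> b))" unfolding c'(3)[symmetric] ..
      also have "\<dots> \<in> N"
        using submodD(4)[OF N(1)] submodD(5)[OF N(1)] B_closed c c' ab by metis
      finally show False using N(4) by blast
    qed
    have xk: "x \<in> N" if "x [^] (k::nat) \<in> N" for k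
      using that
    proof (induction k)
      case 0 then show ?case using N by simp
    next
      case (Suc k) then show ?case using pr[of "x [^] k" x] xB by auto
    qed
    have "regprime N" unfolding regprime_def using N pr xk kD by blast
    from V[OF this] obtain u where u: "u \<in> B" "u \<notin> N" "u \<otimes> y \<in> B" "u \<in> carrier Q" by (auto elim: local_atE)
    then have "u \<in> D" using DI m_comm[OF y, of u] by simp
    then show False using N u by blast
  qed
  then show ?thesis using DI y by simp
qed

section \<open>Valuation rings\<close>

definition valring :: "'a set \<Rightarrow> bool" where
  "valring V \<longleftrightarrow> subring V Q \<and> R \<subseteq> V \<and> V \<noteq> carrier Q \<and>
     (\<forall>a\<in>carrier Q - V. \<forall>b\<in>carrier Q - V. a \<otimes> b \<notin> V)"

lemma valringD:
  assumes "valring V"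
  shows "subring V Q" "R \<subseteq> V" "V \<noteq> carrier Q"
    "\<And>a b. a \<in> carrier Q \<Longrightarrow> b \<in> carrier Q \<Longrightarrow> a \<otimes> b \<in> V \<Longrightarrow> a \<in> V \<or> b \<in> V"
  using assms unfolding valring_def by blast+

text \<open>For b outside V the relation b (b^(m + 1) - w) = s \<in> V forces b^(m + 1) - w \<in> V,
  an equation of smaller degree. This avoids dividing by b, which may be a zero divisor.\<close>

lemma valring_integral:
  assumes V: "valring V" and b: "b \<in> carrier Q" and p: "b [^] Suc m \<in> powspan V b m" shows "b \<in> V"
  using p
proof (induction m)
  case 0 then show ?case using b by simp
next
  case (Suc m)
  note VD = valringD[OF V]
  obtain s w where w: "s \<in> V" "w \<in> powspan V b m" "b [^] Suc (Suc m) = s \<oplus> b \<otimes> w"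
    using Suc.prems unfolding powspan.simps msum_def scal_def by blast
  have C: "s \<in> carrier Q" "w \<in> carrier Q" using w submodD(2)[OF submod_powspan[OF VD(1) b]] subringE(1)[OF VD(1)] by auto
  show ?case
  proof (cases "b \<in> V")
    case False
    have bC: "b [^] Suc m \<in> carrier Q" using b by simp
    have "b \<otimes> (b [^] Suc m \<ominus> w) = b [^] Suc (Suc m) \<ominus> b \<otimes> w"
      using b C bC by (simp add: a_minus_def r_distr r_minus m_comm)
    also have "\<dots> = s" unfolding w(3) using b C by algebra
    finally have "b \<otimes> (b [^] Suc m \<ominus> w) \<in> V" using w by simp
    then have d: "b [^] Suc m \<ominus> w \<in> V" using VD(4)[of b "b [^] Suc m \<ominus> w"] False b C by simp
    have V0: "V \<subseteq> powspan V b m" using powspan_mono[OF VD(1) b, of 0 m] by simp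
    have "(b [^] Suc m \<ominus> w) \<oplus> w \<in> powspan V b m"
      using submodD(4)[OF submod_powspan[OF VD(1) b]] d V0 w(2) by blast
    moreover have "(b [^] Suc m \<ominus> w) \<oplus> w = b [^] Suc m" using bC C by algebra
    ultimately show ?thesis using Suc.IH by simp
  qed
qed

lemma valring_B: assumes V: "valring V" shows "B \<subseteq> V"
proof
  fix b assume b: "b \<in> B"
  note VD = valringD[OF V]
  have bC: "b \<in> carrier Q" using BC b by blast
  have "powspan R b m \<subseteq> powspan V b m" for m
  proof (induction m)
    case 0 then show ?case using VD by simp
  next
    case (Suc m) then show ?case using msum_mono[OF VD(2) scal_mono] by simp
  qed
  then show "b \<in> V" using valring_integral[OF V bC, of mult_len] pow_bound[OF b] by blast
qed

text \<open>Otherwise V would contain all fractions with a power of x as denominator, hence all of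
  Q.\<close>

lemma valring_inv_x: assumes V: "valring V" shows "inv x \<notin> V"
proof
  note VD = valringD[OF V]
  assume i: "inv x \<in> V"
  have ip: "inv x [^] (n::nat) \<in> V" for n using i subringE(3,6)[OF VD(1)] by (induction n) auto
  have "carrier Q \<subseteq> V"
  proof
    fix y assume y: "y \<in> carrier Q"
    obtain n where n: "x [^] (n::nat) \<otimes> y \<in> R" using xpow_frac[OF y] by blast
    have "inv x [^] n \<otimes> (x [^] n \<otimes> y) \<in> V" using subringE(6)[OF VD(1) ip] n VD(2) by blast
    moreover have "inv x [^] n \<otimes> x [^] n = \<one>"
      using nat_pow_distrib[of "inv x" x n] xU xC by simp
    ultimately show "y \<in> V" using y xC xU by (simp add: m_assoc[symmetric])
  qed
  then show False using VD subringE(1)[OF VD(1)] by blast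
qed

text \<open>The elements of positive value, described without inverses so that zero divisors are
  covered.\<close>

definition vcenter :: "'a set \<Rightarrow> 'a set" where
  "vcenter V = {b \<in> V. \<exists>z\<in>carrier Q - V. b \<otimes> z \<in> V}"

lemma vcenter_submod:
  assumes V: "valring V" shows "submod V (vcenter V)"
proof (rule submodI)
  note VD = valringD[OF V]
  note VC = subringE(1)[OF VD(1)]
  show "vcenter V \<subseteq> carrier Q" unfolding vcenter_def using VC by blast
  have "\<zero> \<otimes> inv x \<in> V" using xU subringE(2)[OF VD(1)] by simp
  then show "\<zero> \<in> vcenter V" unfolding vcenter_def using valring_inv_x[OF V] xU subringE(2)[OF VD(1)] by blast
next
  note VD = valringD[OF V]
  note VC = subringE(1)[OF VD(1)]
  fix a b assume "a \<in> vcenter V" "b \<in> vcenter V"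
  then obtain y z where y: "a \<in> V" "y \<in> carrier Q" "y \<notin> V" "a \<otimes> y \<in> V" and z: "b \<in> V" "z \<in> carrier Q" "z \<notin> V" "b \<otimes> z \<in> V"
    unfolding vcenter_def by auto
  have C: "a \<in> carrier Q" "b \<in> carrier Q" using y z VC by auto
  have ab: "a \<oplus> b \<in> V" using subringE(7)[OF VD(1)] y z by blast
  \<comment> \<open>The product lies in V, so one of its factors does; hence z or y serves both
    summands.\<close>
  have "(a \<otimes> z) \<otimes> (b \<otimes> y) = (a \<otimes> y) \<otimes> (b \<otimes> z)" using C y z by algebra
  then have "(a \<otimes> z) \<otimes> (b \<otimes> y) \<in> V" using subringE(6)[OF VD(1)] y z by simp
  then have "a \<otimes> z \<in> V \<or> b \<otimes> y \<in> V" using VD(4)[of "a \<otimes> z" "b \<otimes> y"] C y z by simp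
  then consider "a \<otimes> z \<in> V" | "b \<otimes> y \<in> V" by blast
  then show "a \<oplus> b \<in> vcenter V"
  proof cases
    case 1
    then have "(a \<oplus> b) \<otimes> z \<in> V" using subringE(7)[OF VD(1)] z C by (simp add: l_distr)
    then show ?thesis unfolding vcenter_def using ab z by blast
  next
    case 2
    then have "(a \<oplus> b) \<otimes> y \<in> V" using subringE(7)[OF VD(1)] y C by (simp add: l_distr)
    then show ?thesis unfolding vcenter_def using ab y by blast
  qed
next
  note VD = valringD[OF V]
  fix s a assume s: "s \<in> V" and "a \<in> vcenter V"
  then obtain y where y: "a \<in> V" "y \<in> carrier Q" "y \<notin> V" "a \<otimes> y \<in> V" unfolding vcenter_def by blast
  have C: "a \<in> carrier Q" "s \<in> carrier Q" using y s subringE(1)[OF VD(1)] by auto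
  have "(s \<otimes> a) \<otimes> y \<in> V" using subringE(6)[OF VD(1) s y(4)] C y by (simp add: m_assoc)
  then show "s \<otimes> a \<in> vcenter V" unfolding vcenter_def using subringE(6)[OF VD(1) s y(1)] y by blast
qed

lemma vcenter_one: "\<one> \<notin> vcenter V"
proof
  assume "\<one> \<in> vcenter V"
  then obtain z where "z \<in> carrier Q" "z \<notin> V" "\<one> \<otimes> z \<in> V" unfolding vcenter_def by auto
  then show False by simp
qed

lemma vcenter_prime:
  assumes V: "valring V" and ab: "a \<in> V" "b \<in> V" "a \<otimes> b \<in> vcenter V" shows "a \<in> vcenter V \<or> b \<in> vcenter V"
proof -
  note VD = valringD[OF V]
  obtain z where z: "z \<in> carrier Q" "z \<notin> V" "a \<otimes> b \<otimes> z \<in> V" using ab unfolding vcenter_def by blast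
  have C: "a \<in> carrier Q" "b \<in> carrier Q" using ab subringE(1)[OF VD(1)] by auto
  show ?thesis
  proof (cases "a \<otimes> z \<in> V")
    case True then show ?thesis unfolding vcenter_def using ab z by blast
  next
    case False
    have "b \<otimes> (a \<otimes> z) \<in> V" using z C by (simp add: m_ac)
    then show ?thesis unfolding vcenter_def using ab False C z by blast
  qed
qed

lemma vcenter_x: assumes V: "valring V" shows "x \<in> vcenter V"
proof -
  note VD = valringD[OF V]
  have "x \<otimes> inv x \<in> V" using xU subringE(3)[OF VD(1)] by simp
  then show ?thesis unfolding vcenter_def using valring_inv_x[OF V] xU xR VD(2) by blast
qed

lemma vcenter_regprime: assumes V: "valring V" shows "regprime (vcenter V \<inter> B)"
  unfolding regprime_def
proof (intro conjI ballI impI)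
  show "submod B (vcenter V \<inter> B)" using submod_Int[OF submod_weaken[OF vcenter_submod[OF V] valring_B[OF V]] B_self] .
  show "\<one> \<notin> vcenter V \<inter> B" using vcenter_one by blast
  show "x \<in> vcenter V \<inter> B" using vcenter_x[OF V] xB by blast
  fix a b assume ab: "a \<in> B" "b \<in> B" "a \<otimes> b \<in> vcenter V \<inter> B"
  then show "a \<in> vcenter V \<inter> B \<or> b \<in> vcenter V \<inter> B"
    using vcenter_prime[OF V, of a b] valring_B[OF V] by blast
qed simp

lemma val_uniformizer_zpow:
  assumes V: "subring V Q" and t: "val_uniformizer V t" shows "zpow t k \<in> V \<longleftrightarrow> 0 \<le> k"
proof -
  have tV: "t \<in> V" "inv t \<notin> V" and tU: "t \<in> Units Q" using t unfolding val_uniformizer_def by auto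
  have nn: "zpow t (int j) \<in> V" for j
  proof -
    have "t [^] j \<in> V" using tV(1) subringE(3,6)[OF V] by (induction j) auto
    then show ?thesis using zpow_nat[OF tU] by simp
  qed
  show ?thesis
  proof
    assume k: "zpow t k \<in> V"
    show "0 \<le> k"
    proof (rule ccontr)
      assume "\<not> 0 \<le> k"
      define j where "j = nat (- 1 - k)"
      have j: "- 1 = k + int j" unfolding j_def using \<open>\<not> 0 \<le> k\<close> by simp
      have "inv t = zpow t k \<otimes> zpow t (int j)" using zpow_add[OF tU, of k "int j"] j zpow_neg1[OF tU] by simp
      then show False using subringE(6)[OF V k nn[of j]] tV by simp
    qed
  next
    assume "0 \<le> k" then show "zpow t k \<in> V" using nn[of "nat k"] by simp
  qed
qed

lemma valring_local_at_center: assumes V: "valring V" shows "V = local_at (vcenter V \<inter> B)"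
proof
  note VD = valringD[OF V]
  let ?n = "vcenter V \<inter> B"
  note n = vcenter_regprime[OF V]
  show sub: "local_at ?n \<subseteq> V"
  proof
    fix y assume "y \<in> local_at ?n"
    then obtain u where u: "u \<in> B" "u \<notin> ?n" "u \<otimes> y \<in> B" "y \<in> carrier Q" by (rule local_atE)
    show "y \<in> V"
    proof (rule ccontr)
      assume "y \<notin> V"
      then have "u \<in> vcenter V" unfolding vcenter_def using u valring_B[OF V] by blast
      then show False using u by blast
    qed
  qed
  show "V \<subseteq> local_at ?n"
  proof
    fix y assume y: "y \<in> V"
    have yC: "y \<in> carrier Q" using y subringE(1)[OF VD(1)] by blast
    obtain j where j: "y \<oplus> x [^] (j::nat) \<in> Units Q" using unit_shift[OF yC] by blast
    obtain t where t: "uniformizer ?n t" using regprime_uniformizer[OF n] by blast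
    have tU: "t \<in> Units Q" and tn: "t \<in> vcenter V" using t unfolding uniformizer_def by auto
    obtain k w where w: "w \<in> Units Q" "w \<in> local_at ?n" "inv w \<in> local_at ?n" "y \<oplus> x [^] j = zpow t k \<otimes> w"
      using uniformizer_val_uniformizer[OF n t] j unfolding val_uniformizer_def by blast
    have "y \<oplus> x [^] j \<in> V" using subringE(7)[OF VD(1) y] VD(2) xpR by blast
    then have "(y \<oplus> x [^] j) \<otimes> inv w \<in> V" using subringE(6)[OF VD(1)] w(3) sub by blast
    moreover have "(y \<oplus> x [^] j) \<otimes> inv w = zpow t k" unfolding w(4) using w(1) tU by (simp add: m_assoc Units_closed)
    ultimately have kV: "zpow t k \<in> V" by simp
    \<comment> \<open>The same t is a uniformizer for V: it lies in the center, and local units at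
      the center remain units in V. So the sign of the exponent k decides membership in both
      rings.\<close>
    have tV: "val_uniformizer V t"
      unfolding val_uniformizer_def
    proof (intro conjI ballI)
      show "t \<in> V" using tn unfolding vcenter_def by blast
      show "inv t \<notin> V"
      proof
        assume "inv t \<in> V"
        then have "inv t \<otimes> t \<in> vcenter V" using submodD(5)[OF vcenter_submod[OF V] _ tn] by blast
        then show False using vcenter_one tU by simp
      qed
      fix z assume "z \<in> Units Q"
      then obtain k w where "w \<in> Units Q" "w \<in> local_at ?n" "inv w \<in> local_at ?n" "z = zpow t k \<otimes> w"
        using uniformizer_val_uniformizer[OF n t] unfolding val_uniformizer_def by blast
      then show "\<exists>k w. w \<in> Units Q \<and> w \<in> V \<and> inv w \<in> V \<and> z = zpow t k \<otimes> w" using sub by blast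
    qed (rule tU)
    have "0 \<le> k" using kV val_uniformizer_zpow[OF VD(1) tV] by blast
    then have "zpow t k \<in> local_at ?n" using val_uniformizer_zpow[OF local_at_subring[OF n] uniformizer_val_uniformizer[OF n t]] by blast
    then have "y \<oplus> x [^] j \<in> local_at ?n" unfolding w(4) using subringE(6)[OF local_at_subring[OF n]] w(2) by blast
    then have "(y \<oplus> x [^] j) \<ominus> x [^] j \<in> local_at ?n"
      using submod_diff[OF submod_self[OF local_at_subring[OF n]] local_at_subring[OF n]] B_local_at[OF n] xpB by blast
    moreover have "(y \<oplus> x [^] j) \<ominus> x [^] j = y" using yC xpC[of j] by algebra
    ultimately show "y \<in> local_at ?n" by simp
  qed
qed

lemma valring_val_uniformizer: "valring V \<Longrightarrow> \<exists>t. uniformizer (vcenter V \<inter> B) t \<and> val_uniformizer V t"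
  using regprime_uniformizer[OF vcenter_regprime] uniformizer_val_uniformizer[OF vcenter_regprime] valring_local_at_center by metis

lemma local_at_valring: assumes n: "regprime n" shows "valring (local_at n)"
proof -
  note V = local_at_subring[OF n]
  have xi: "inv x \<notin> local_at n"
  proof
    assume "inv x \<in> local_at n"
    then obtain u where u: "u \<in> B" "u \<notin> n" "u \<otimes> inv x \<in> B" "u \<in> carrier Q" by (rule local_atE)
    have "(u \<otimes> inv x) \<otimes> x = u" using u xU xC by (simp add: m_assoc)
    then show False using submodD(5)[OF regprimeD(1)[OF n] u(3) regprimeD(4)[OF n]] u by simp
  qed
  obtain t where t: "uniformizer n t" using regprime_uniformizer[OF n] by blast
  note tV = uniformizer_val_uniformizer[OF n t]
  have tU: "t \<in> Units Q" using t unfolding uniformizer_def by blast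
  have Vsm: "submod R (local_at n)" using submod_weaken[OF submod_self[OF V]] B_local_at[OF n] RB by blast
  have neg: "\<exists>k w. k < 0 \<and> w \<in> Units Q \<and> w \<in> local_at n \<and> inv w \<in> local_at n \<and> y \<oplus> x [^] (j::nat) = zpow t k \<otimes> w"
    if y: "y \<in> carrier Q" "y \<notin> local_at n" "y \<oplus> x [^] (j::nat) \<in> Units Q" for y j
  proof -
    obtain k w where w: "w \<in> Units Q" "w \<in> local_at n" "inv w \<in> local_at n" "y \<oplus> x [^] j = zpow t k \<otimes> w"
      using tV y unfolding val_uniformizer_def by blast
    have "k < 0"
    proof (rule ccontr)
      assume "\<not> k < 0"
      then have "zpow t k \<otimes> w \<in> local_at n" using val_uniformizer_zpow[OF V tV] subringE(6)[OF V _ w(2)] by simp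
      then have "y \<oplus> x [^] j \<ominus> x [^] j \<in> local_at n"
        unfolding w(4)[symmetric] using submod_diff[OF submod_self[OF V] V] B_local_at[OF n] xpB by blast
      moreover have "y \<oplus> x [^] j \<ominus> x [^] j = y" using y xpC[of j] by algebra
      ultimately show False using y by simp
    qed
    then show ?thesis using w by blast
  qed
  have "a \<otimes> b \<notin> local_at n" if a: "a \<in> carrier Q" "a \<notin> local_at n" and b: "b \<in> carrier Q" "b \<notin> local_at n" for a b
  proof
    assume ab: "a \<otimes> b \<in> local_at n"
    obtain p q where p: "x [^] (p::nat) \<otimes> a \<in> R" and q: "x [^] (q::nat) \<otimes> b \<in> R"
      using xpow_frac a b by blast
    \<comment> \<open>The exponents are so large that x^i b and x^j a lie in R; in the product of
      the two shifted units every term other than ab is then harmless.\<close>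
    obtain i where i: "i \<ge> q" "a \<oplus> x [^] (i::nat) \<in> Units Q" using unit_shift[OF a(1)] by blast
    obtain j where j: "j \<ge> p" "b \<oplus> x [^] (j::nat) \<in> Units Q" using unit_shift[OF b(1)] by blast
    obtain k w where w: "k < 0" "w \<in> Units Q" "w \<in> local_at n" "inv w \<in> local_at n" "a \<oplus> x [^] i = zpow t k \<otimes> w"
      using neg[OF a i(2)] by blast
    obtain l v where v: "l < 0" "v \<in> Units Q" "v \<in> local_at n" "inv v \<in> local_at n" "b \<oplus> x [^] j = zpow t l \<otimes> v"
      using neg[OF b j(2)] by blast
    have C: "w \<in> carrier Q" "v \<in> carrier Q" "inv w \<in> carrier Q" "inv v \<in> carrier Q"
      "zpow t k \<in> carrier Q" "zpow t l \<in> carrier Q" using w v tU by auto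
    have 1: "x [^] i \<otimes> b \<in> local_at n" "x [^] j \<otimes> a \<in> local_at n" "x [^] i \<otimes> x [^] j \<in> local_at n"
      using xpow_mono[OF R_self q b(1) i(1)] xpow_mono[OF R_self p a(1) j(1)] RB B_local_at[OF n]
        R_closed(4)[OF xpR[of i] xpR[of j]] by blast+
    have "(a \<oplus> x [^] i) \<otimes> (b \<oplus> x [^] j) = (a \<otimes> b \<oplus> x [^] i \<otimes> b) \<oplus> (x [^] j \<otimes> a \<oplus> x [^] i \<otimes> x [^] j)"
      using a b xpC[of i] xpC[of j] by algebra
    also have "\<dots> \<in> local_at n" using subringE(7)[OF V] ab 1 by blast
    finally have "(inv w \<otimes> inv v) \<otimes> ((zpow t k \<otimes> w) \<otimes> (zpow t l \<otimes> v)) \<in> local_at n"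
      unfolding w(5) v(5) using subringE(6)[OF V] w(4) v(4) by blast
    moreover have "(inv w \<otimes> inv v) \<otimes> ((zpow t k \<otimes> w) \<otimes> (zpow t l \<otimes> v)) = (w \<otimes> inv w) \<otimes> (v \<otimes> inv v) \<otimes> (zpow t k \<otimes> zpow t l)"
      using C by algebra
    moreover have "\<dots> = zpow t (k + l)" using zpow_add[OF tU] w v C by simp
    ultimately have "zpow t (k + l) \<in> local_at n" by simp
    then show False using val_uniformizer_zpow[OF V tV] w v by simp
  qed
  then show ?thesis unfolding valring_def using V xi xU B_local_at[OF n] RB by blast
qed

lemma inv_x_B: "inv x \<notin> B"
proof
  assume "inv x \<in> B"
  then have ip: "inv x [^] (n::nat) \<in> B" for n by (induction n) (auto simp: B_closed)
  obtain k where k: "\<And>b. b \<in> B \<Longrightarrow> x [^] (k::nat) \<otimes> b \<in> R" using B_bounded by blast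
  have "x [^] k \<otimes> inv x [^] k = \<one>" using nat_pow_distrib[of x "inv x" k] xU xC by simp
  then have "x [^] k \<otimes> inv x [^] Suc k = inv x"
    using xU xC by (simp add: m_assoc[symmetric])
  then have "inv x \<in> R" using k[OF ip[of "Suc k"]] by simp
  then have "inv x \<otimes> x \<in> M" using submodD(5)[OF M _ xM] by blast
  then show False using one_M xU by simp
qed

lemma ex_valring: "\<exists>V. valring V"
  using Int_local_at[of "inv x"] inv_x_B local_at_valring xU by blast

lemma Int_valring: assumes "y \<in> carrier Q" "\<And>V. valring V \<Longrightarrow> y \<in> V" shows "y \<in> B"
  using Int_local_at[OF assms(1)] assms(2) local_at_valring by blast

text \<open>Maximality of tW is what allows residual rationality to be applied to W / tW. An element
  outside tW, shifted by a power of x \<in> tW, becomes a unit of Q of value 0, that is, a unit of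
  W.\<close>

lemma val_uniformizer_maximal:
  assumes W: "valring W" and t: "val_uniformizer W t" and J: "submod W J" "J \<subseteq> W" "scal t W \<subseteq> J" "J \<noteq> scal t W"
  shows "J = W"
proof -
  note WS = valringD(1)[OF W]
  have tU: "t \<in> Units Q" using t unfolding val_uniformizer_def by blast
  have WC: "W \<subseteq> carrier Q" using subringE(1)[OF WS] .
  obtain y where y: "y \<in> J" "y \<notin> scal t W" using J by blast
  have yC: "y \<in> carrier Q" using y J WC by blast
  have pos: "zpow t k \<otimes> w \<in> scal t W" if k: "k \<ge> 1" and w: "w \<in> W" for k w
  proof -
    have "zpow t (k - 1) \<in> W" using val_uniformizer_zpow[OF WS t] k by simp
    then have "zpow t (k - 1) \<otimes> w \<in> W" using subringE(6)[OF WS _ w] by blast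
    from scalI[OF this, of t] have "t \<otimes> (zpow t (k - 1) \<otimes> w) \<in> scal t W" .
    moreover have "t \<otimes> (zpow t (k - 1) \<otimes> w) = zpow t k \<otimes> w"
      using zpow_add[OF tU, of 1 "k - 1"] zpow_1[OF tU] w WC tU by (simp add: m_assoc[symmetric] Units_closed subset_eq)
    ultimately show ?thesis by simp
  qed
  have tm: "submod W (scal t W)" using submod_scal[OF WS submod_self[OF WS]] tU by blast
  have xt: "x \<in> scal t W"
  proof -
    obtain k w where w: "w \<in> Units Q" "w \<in> W" "inv w \<in> W" "x = zpow t k \<otimes> w" using t xU unfolding val_uniformizer_def by blast
    have "k \<ge> 1"
    proof (rule ccontr)
      assume "\<not> k \<ge> 1"
      then have "zpow t (- k) \<in> W" using val_uniformizer_zpow[OF WS t] by simp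
      then have "zpow t (- k) \<otimes> inv w \<in> W" using subringE(6)[OF WS] w by blast
      moreover have "x \<otimes> (zpow t (- k) \<otimes> inv w) = \<one>"
      proof -
        have c: "zpow t k \<in> carrier Q" "zpow t (- k) \<in> carrier Q" "w \<in> carrier Q" "inv w \<in> carrier Q" using tU w by auto
        have "x \<otimes> (zpow t (- k) \<otimes> inv w) = (zpow t k \<otimes> zpow t (- k)) \<otimes> (w \<otimes> inv w)" unfolding w(4) using c by algebra
        then show ?thesis using zpow_minus[OF tU] w(1) by simp
      qed
      then have "inv x = zpow t (- k) \<otimes> inv w" using Units_iff_inv[OF xC] tU w by simp
      ultimately show False using valring_inv_x[OF W] by simp
    qed
    then show ?thesis using pos w by simp
  qed
  obtain j where j: "j \<ge> 1" "y \<oplus> x [^] (j::nat) \<in> Units Q" using unit_shift[OF yC] by blast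
  have xj: "x [^] j \<in> scal t W"
  proof -
    obtain l where l: "j = Suc l" using j(1) by (cases j) auto
    have "x [^] l \<in> W" using valringD(2)[OF W] xpR by blast
    then show ?thesis unfolding l using submodD(5)[OF tm _ xt] by simp
  qed
  have yj: "y \<oplus> x [^] j \<in> J" using submodD(4)[OF J(1) y(1)] xj J(3) by blast
  obtain k w where w: "w \<in> Units Q" "w \<in> W" "inv w \<in> W" "y \<oplus> x [^] j = zpow t k \<otimes> w"
    using t j(2) unfolding val_uniformizer_def by blast
  have zk: "zpow t k = (y \<oplus> x [^] j) \<otimes> inv w" unfolding w(4) using w tU by (simp add: m_assoc Units_closed)
  have "zpow t k \<in> W" unfolding zk using subringE(6)[OF WS] yj J(2) w(3) by blast
  then have "0 \<le> k" using val_uniformizer_zpow[OF WS t] by blast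
  moreover have "\<not> k \<ge> 1"
  proof
    assume "k \<ge> 1"
    then have "y \<oplus> x [^] j \<in> scal t W" using pos w by simp
    then show False using submod_cancel[OF tm WS xj yC] y(2) a_comm[OF yC xpC[of j]] by simp
  qed
  ultimately have "k = 0" by simp
  then have "inv w \<otimes> (y \<oplus> x [^] j) = \<one>" using w by (simp add: Units_closed)
  then have 1: "\<one> \<in> J" using submodD(5)[OF J(1) w(3) yj] by simp
  have "a \<in> J" if "a \<in> W" for a using submodD(5)[OF J(1) that 1] WC that by auto
  then show ?thesis using J(2) by blast
qed

end

text \<open>\<open>resid\<close> says that R maps onto the residue field W / tW.
  \<open>resid_card\<close> says that R / M has at least r elements, in the form in which it is
  applied: fewer than r classes can be avoided. This also covers infinite residue fields.\<close>

locale valued_ring = one_dim Q R M x Mp for Q (structure) and R M x Mp +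
  fixes r :: nat and V :: "nat \<Rightarrow> 'a set"
  assumes V_bij: "bij_betw V {1..r} {W. valring W}"
    and resid: "valring W \<Longrightarrow> val_uniformizer W t \<Longrightarrow> w \<in> W \<Longrightarrow> \<exists>a\<in>R. inv t \<otimes> (w \<ominus> a) \<in> W"
    and resid_card: "finite A \<Longrightarrow> A \<subseteq> R \<Longrightarrow> card A < r \<Longrightarrow> \<exists>a\<in>R. \<forall>b\<in>A. a \<ominus> b \<notin> M"
begin

lemma V_valring: "i \<in> {1..r} \<Longrightarrow> valring (V i)"
  using V_bij unfolding bij_betw_def by blast

lemma V_surj: "valring W \<Longrightarrow> \<exists>i\<in>{1..r}. W = V i"
  using V_bij unfolding bij_betw_def by blast

lemma V_inj: "i \<in> {1..r} \<Longrightarrow> j \<in> {1..r} \<Longrightarrow> V i = V j \<Longrightarrow> i = j"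
  using V_bij unfolding bij_betw_def inj_on_def by blast

lemma r_pos: "r \<ge> 1"
  using ex_valring V_surj by fastforce

definition unz :: "nat \<Rightarrow> 'a" where
  "unz i = (SOME t. uniformizer (vcenter (V i) \<inter> B) t \<and> val_uniformizer (V i) t)"

lemma unz: assumes "i \<in> {1..r}" shows "uniformizer (vcenter (V i) \<inter> B) (unz i)" "val_uniformizer (V i) (unz i)"
  using someI_ex[OF valring_val_uniformizer[OF V_valring[OF assms]]] unfolding unz_def by auto

lemma unzU: "i \<in> {1..r} \<Longrightarrow> unz i \<in> Units Q"
  using unz unfolding val_uniformizer_def by blast

text \<open>\<open>val_ge i k\<close> is the set of \<open>y\<close> with \<open>v\<^sub>i(y) \<ge> k\<close>, where zero divisors may have infinite value;
  \<open>val i\<close> is meaningful on units only.\<close>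

definition val_ge :: "nat \<Rightarrow> int \<Rightarrow> 'a set" where
  "val_ge i k = {y \<in> carrier Q. zpow (unz i) (- k) \<otimes> y \<in> V i}"

definition val :: "nat \<Rightarrow> 'a \<Rightarrow> int" where
  "val i z = (THE k. \<exists>w. w \<in> Units Q \<and> w \<in> V i \<and> inv w \<in> V i \<and> z = zpow (unz i) k \<otimes> w)"

lemma valI:
  assumes i: "i \<in> {1..r}" and w: "w \<in> Units Q" "w \<in> V i" "inv w \<in> V i" and z: "z = zpow (unz i) k \<otimes> w"
  shows "val i z = k"
  unfolding val_def
proof (rule the_equality)
  show "\<exists>w. w \<in> Units Q \<and> w \<in> V i \<and> inv w \<in> V i \<and> z = zpow (unz i) k \<otimes> w" using w z by blast
  note VS = valringD(1)[OF V_valring[OF i]]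
  have tU: "unz i \<in> Units Q" using unzU i by blast
  have le: "l \<le> l'" if v: "v \<in> Units Q" "v \<in> V i" "inv v' \<in> V i" "v' \<in> Units Q" "zpow (unz i) l' \<otimes> v' = zpow (unz i) l \<otimes> v" for l l' v v'
  proof -
    have C: "v \<in> carrier Q" "v' \<in> carrier Q" "inv v' \<in> carrier Q" "zpow (unz i) l' \<in> carrier Q" "zpow (unz i) l \<in> carrier Q" "zpow (unz i) (-l) \<in> carrier Q"
      using v tU by auto
    have "zpow (unz i) (l' - l) = zpow (unz i) (- l) \<otimes> zpow (unz i) l' \<otimes> (v' \<otimes> inv v')"
      using zpow_add[OF tU, of "-l" l'] v C by simp
    also have "\<dots> = zpow (unz i) (- l) \<otimes> (zpow (unz i) l' \<otimes> v') \<otimes> inv v'" using C by algebra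
    also have "\<dots> = (zpow (unz i) (- l) \<otimes> zpow (unz i) l) \<otimes> (v \<otimes> inv v')" unfolding v(5) using C by algebra
    also have "\<dots> = v \<otimes> inv v'" using zpow_minus[OF tU] C by simp
    finally have "zpow (unz i) (l' - l) \<in> V i" using subringE(6)[OF VS v(2,3)] by simp
    then show ?thesis using val_uniformizer_zpow[OF VS unz(2)[OF i]] by simp
  qed
  fix l assume "\<exists>w. w \<in> Units Q \<and> w \<in> V i \<and> inv w \<in> V i \<and> z = zpow (unz i) l \<otimes> w"
  then obtain v where v: "v \<in> Units Q" "v \<in> V i" "inv v \<in> V i" "z = zpow (unz i) l \<otimes> v" by blast
  show "l = k" using le[of w v l k] le[of v w k l] v w z by auto
qed

lemma val_decomp:
  assumes i: "i \<in> {1..r}" and z: "z \<in> Units Q"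
  obtains w where "w \<in> Units Q" "w \<in> V i" "inv w \<in> V i" "z = zpow (unz i) (val i z) \<otimes> w"
proof -
  obtain k w where "w \<in> Units Q" "w \<in> V i" "inv w \<in> V i" "z = zpow (unz i) k \<otimes> w"
    using unz(2)[OF i] z unfolding val_uniformizer_def by blast
  then show ?thesis using valI[OF i] that by metis
qed

lemma val_ge_submod: assumes i: "i \<in> {1..r}" shows "submod (V i) (val_ge i k)"
proof -
  note VS = valringD(1)[OF V_valring[OF i]]
  show ?thesis unfolding val_ge_def using submod_preimage[OF VS submod_self[OF VS]] unzU[OF i] by simp
qed

lemma RV: "i \<in> {1..r} \<Longrightarrow> R \<subseteq> V i" using valringD(2)[OF V_valring] .
lemma val_ge_submodR: "i \<in> {1..r} \<Longrightarrow> submod R (val_ge i k)"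
  using submod_weaken[OF val_ge_submod RV] .

lemma val_ge_carrier: "y \<in> val_ge i k \<Longrightarrow> y \<in> carrier Q" unfolding val_ge_def by blast

lemma val_ge_0: "i \<in> {1..r} \<Longrightarrow> val_ge i 0 = V i"
  unfolding val_ge_def using subringE(1)[OF valringD(1)[OF V_valring]] by (auto simp: subset_eq)

lemma val_ge_mult:
  assumes i: "i \<in> {1..r}" and y: "y \<in> val_ge i k" "z \<in> val_ge i l" shows "y \<otimes> z \<in> val_ge i (k + l)"
proof -
  note VS = valringD(1)[OF V_valring[OF i]]
  have C: "y \<in> carrier Q" "z \<in> carrier Q" "zpow (unz i) (-k) \<in> carrier Q" "zpow (unz i) (-l) \<in> carrier Q"
    using y unzU[OF i] unfolding val_ge_def by auto
  have "(zpow (unz i) (-k) \<otimes> y) \<otimes> (zpow (unz i) (-l) \<otimes> z) \<in> V i"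
    using subringE(6)[OF VS] y unfolding val_ge_def by blast
  moreover have "(zpow (unz i) (-k) \<otimes> y) \<otimes> (zpow (unz i) (-l) \<otimes> z) = (zpow (unz i) (-k) \<otimes> zpow (unz i) (-l)) \<otimes> (y \<otimes> z)"
    using C by algebra
  moreover have "zpow (unz i) (-k) \<otimes> zpow (unz i) (-l) = zpow (unz i) (- (k + l))"
    using zpow_add[OF unzU[OF i], of "-k" "-l"] by simp
  ultimately show ?thesis unfolding val_ge_def using C by simp
qed

lemma val_ge_unit:
  assumes i: "i \<in> {1..r}" and z: "z \<in> Units Q" shows "z \<in> val_ge i k \<longleftrightarrow> k \<le> val i z"
proof -
  note VS = valringD(1)[OF V_valring[OF i]]
  obtain w where w: "w \<in> Units Q" "w \<in> V i" "inv w \<in> V i" "z = zpow (unz i) (val i z) \<otimes> w"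
    using val_decomp[OF i z] by blast
  have C: "w \<in> carrier Q" "inv w \<in> carrier Q" "zpow (unz i) (-k) \<in> carrier Q" "zpow (unz i) (val i z) \<in> carrier Q" "z \<in> carrier Q"
    using w z unzU[OF i] by auto
  have "zpow (unz i) (-k) \<otimes> z = zpow (unz i) (-k) \<otimes> zpow (unz i) (val i z) \<otimes> w"
    using w(4) C by (metis m_assoc)
  then have e: "zpow (unz i) (-k) \<otimes> z = zpow (unz i) (val i z - k) \<otimes> w"
    using zpow_add[OF unzU[OF i], of "-k" "val i z"] by simp
  have "zpow (unz i) (val i z - k) \<otimes> w \<in> V i \<longleftrightarrow> zpow (unz i) (val i z - k) \<in> V i"
  proof
    assume "zpow (unz i) (val i z - k) \<otimes> w \<in> V i"
    then have "(zpow (unz i) (val i z - k) \<otimes> w) \<otimes> inv w \<in> V i" using subringE(6)[OF VS] w by blast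
    then show "zpow (unz i) (val i z - k) \<in> V i" using C w unzU[OF i] by (simp add: m_assoc)
  qed (use subringE(6)[OF VS] w in blast)
  then show ?thesis unfolding val_ge_def using e C val_uniformizer_zpow[OF VS unz(2)[OF i]] by simp
qed

lemma val_eqI:
  assumes "i \<in> {1..r}" "z \<in> Units Q" "z \<in> val_ge i k" "z \<notin> val_ge i (k + 1)" shows "val i z = k"
  using val_ge_unit[OF assms(1,2)] assms(3,4) by (metis order_antisym_conv zle_iff_zadd add1_zle_eq not_le)

lemma val_ge_antimono:
  assumes i: "i \<in> {1..r}" and "k \<le> l" shows "val_ge i l \<subseteq> val_ge i k"
proof
  fix y assume y: "y \<in> val_ge i l"
  have "zpow (unz i) (l - k) \<in> V i" using val_uniformizer_zpow[OF valringD(1)[OF V_valring[OF i]] unz(2)[OF i]] assms by simp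
  then have "zpow (unz i) (l - k) \<otimes> (zpow (unz i) (- l) \<otimes> y) \<in> V i"
    using subringE(6)[OF valringD(1)[OF V_valring[OF i]]] y unfolding val_ge_def by blast
  moreover have "zpow (unz i) (l - k) \<otimes> (zpow (unz i) (- l) \<otimes> y) = zpow (unz i) (- k) \<otimes> y"
    using zpow_add[OF unzU[OF i], of "l - k" "- l"] y unzU[OF i] unfolding val_ge_def by (simp add: m_assoc)
  ultimately show "y \<in> val_ge i k" using y unfolding val_ge_def by simp
qed

lemma val_mult:
  assumes i: "i \<in> {1..r}" and y: "y \<in> Units Q" and z: "z \<in> Units Q" shows "val i (y \<otimes> z) = val i y + val i z"
proof -
  note VS = valringD(1)[OF V_valring[OF i]]
  obtain w where w: "w \<in> Units Q" "w \<in> V i" "inv w \<in> V i" "z = zpow (unz i) (val i z) \<otimes> w"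
    using val_decomp[OF i z] by blast
  obtain v where v: "v \<in> Units Q" "v \<in> V i" "inv v \<in> V i" "y = zpow (unz i) (val i y) \<otimes> v"
    using val_decomp[OF i y] by blast
  let ?a = "zpow (unz i) (val i z)" and ?b = "zpow (unz i) (val i y)"
  have C: "w \<in> carrier Q" "v \<in> carrier Q" "?a \<in> carrier Q" "?b \<in> carrier Q" using w v unzU[OF i] by auto
  have "(?b \<otimes> v) \<otimes> (?a \<otimes> w) = (?b \<otimes> ?a) \<otimes> (v \<otimes> w)" using C by algebra
  then have "y \<otimes> z = zpow (unz i) (val i y + val i z) \<otimes> (v \<otimes> w)"
    using zpow_add[OF unzU[OF i]] w(4) v(4) by metis
  moreover have "inv (v \<otimes> w) \<in> V i" using inv_mult w v subringE(6)[OF VS] by simp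
  ultimately show ?thesis using valI[OF i, of "v \<otimes> w"] w v subringE(6)[OF VS] by simp
qed

lemma val_one: "i \<in> {1..r} \<Longrightarrow> val i \<one> = 0"
  using val_mult[of i \<one> \<one>] by simp

lemma val_inv: "i \<in> {1..r} \<Longrightarrow> z \<in> Units Q \<Longrightarrow> val i (inv z) = - val i z"
  using val_mult[of i z "inv z"] val_one by simp

lemma val_zpow: "i \<in> {1..r} \<Longrightarrow> z \<in> Units Q \<Longrightarrow> val i (z [^] (n::nat)) = int n * val i z"
  by (induction n) (simp_all add: val_one val_mult Units_pow_closed algebra_simps)

lemma val_zpi:
  assumes "i \<in> {1..r}" "z \<in> Units Q" shows "val i (zpow z k) = k * val i z"
proof (cases "0 \<le> k")
  case True
  then show ?thesis using zpow_nat[OF assms(2), of "nat k"] val_zpow[OF assms, of "nat k"] by simp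
next
  case False
  have "val i (zpow z k) + val i (zpow z (- k)) = 0"
    using val_mult[OF assms(1), of "zpow z k" "zpow z (-k)"] assms(2) zpow_minus[OF assms(2)] val_one[OF assms(1)] by simp
  moreover have "val i (zpow z (- k)) = - k * val i z"
    using zpow_nat[OF assms(2), of "nat (- k)"] val_zpow[OF assms, of "nat (- k)"] False by simp
  ultimately show ?thesis by simp
qed

lemma val_M:
  assumes i: "i \<in> {1..r}" and a: "a \<in> R" "a \<notin> M" shows "a \<in> Units Q" "val i a = 0"
proof -
  have u: "a \<in> Units Q" "inv a \<in> R" using unit_R a by auto
  then show "a \<in> Units Q" by blast
  have "a \<in> val_ge i 0" "inv a \<in> val_ge i 0" using a u RV[OF i] val_ge_0[OF i] by auto
  then show "val i a = 0" using val_ge_unit[OF i u(1), of 0] val_ge_unit[OF i Units_inv_Units[OF u(1)], of 0] val_inv[OF i u(1)] by simp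
qed

lemma val_x: assumes i: "i \<in> {1..r}" shows "val i x \<ge> 1"
proof -
  have "inv x \<notin> val_ge i 0" using valring_inv_x[OF V_valring[OF i]] val_ge_0[OF i] by simp
  then show ?thesis using val_ge_unit[OF i Units_inv_Units[OF xU], of 0] val_inv[OF i xU] by simp
qed

lemma xpow_val_ge: assumes i: "i \<in> {1..r}" and "int n \<ge> k" shows "x [^] n \<in> val_ge i k"
proof -
  have "val i (x [^] n) = int n * val i x" using val_zpow[OF i xU] .
  moreover have "int n * 1 \<le> int n * val i x" using val_x[OF i] by (intro mult_left_mono) auto
  ultimately show ?thesis using val_ge_unit[OF i xpU] assms by simp
qed

lemma shift_unit:
  assumes y: "y \<in> carrier Q"
  shows "\<exists>s. (\<forall>i\<in>{1..r}. s \<in> val_ge i N) \<and> s \<in> carrier Q \<and> y \<oplus> s \<in> Units Q"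
proof -
  obtain j where j: "j \<ge> nat N" "y \<oplus> x [^] (j::nat) \<in> Units Q" using unit_shift[OF y] by blast
  have "x [^] j \<in> val_ge i N" if "i \<in> {1..r}" for i using xpow_val_ge[OF that, of N j] j by simp
  then show ?thesis using j xpC by blast
qed

text \<open>The quotient y / z has value 0, so its residue comes from some a in R; subtracting az
  cancels the leading term of y.\<close>

lemma resid_unit:
  assumes i: "i \<in> {1..r}" and y: "y \<in> Units Q" and z: "z \<in> Units Q" and e: "val i y = val i z"
  shows "\<exists>a\<in>R. a \<notin> M \<and> y \<ominus> a \<otimes> z \<in> val_ge i (val i y + 1)"
proof -
  note VS = valringD(1)[OF V_valring[OF i]]
  have yC: "y \<in> carrier Q" and zC: "z \<in> carrier Q" "inv z \<in> carrier Q" using y z by auto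
  define w where "w = y \<otimes> inv z"
  have wU: "w \<in> Units Q" unfolding w_def using y z by simp
  have w0: "val i w = 0" unfolding w_def using val_mult[OF i y Units_inv_Units[OF z]] val_inv[OF i z] e by simp
  have "w \<in> V i" using val_ge_unit[OF i wU, of 0] w0 val_ge_0[OF i] by simp
  then obtain a where a: "a \<in> R" "inv (unz i) \<otimes> (w \<ominus> a) \<in> V i" using resid[OF V_valring[OF i] unz(2)[OF i]] by blast
  have aC: "a \<in> carrier Q" and wC: "w \<in> carrier Q" using a RC wU by auto
  have wa: "w \<ominus> a \<in> val_ge i 1" unfolding val_ge_def using a zpow_neg1[OF unzU[OF i]] aC wC by simp
  have "z \<otimes> (w \<ominus> a) \<in> val_ge i (val i z + 1)" using val_ge_mult[OF i _ wa] val_ge_unit[OF i z] by simp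
  moreover have "z \<otimes> w = y" unfolding w_def using z yC zC by (simp add: m_lcomm)
  moreover have "z \<otimes> (w \<ominus> a) = z \<otimes> w \<ominus> a \<otimes> z" using zC aC wC by algebra
  \<comment> \<open>For a in M a power of a lies in xR, so a lies in the center of
    \<open>V i\<close>; then so does w, although it is a unit of \<open>V i\<close>.\<close>
  moreover have "a \<notin> M"
  proof
    assume aM: "a \<in> M"
    obtain m where m: "Mp m \<subseteq> scal x R" using artin_scal(2)[OF xR xU] by blast
    have "a [^] m \<in> Mp m"
    proof (induction m)
      case 0 then show ?case using Mp_0 R_closed by simp
    next
      case (Suc m) then show ?case using Mp_mult[OF aM Suc] aC by (simp add: m_comm)
    qed
    then obtain c where c: "c \<in> R" "a [^] m = x \<otimes> c" using m by (auto elim: scalE)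
    have wVU: "w \<in> val_ge i 0" "inv w \<in> val_ge i 0"
      using val_ge_unit[OF i wU] val_ge_unit[OF i Units_inv_Units[OF wU]] val_inv[OF i wU] w0 by auto
    have "a \<in> vcenter (V i)"
    proof -
      have aV: "a [^] n \<in> V i" for n :: nat using Rpow[OF a(1)] RV[OF i] by blast
      have "c \<otimes> x \<in> vcenter (V i)" using submodD(5)[OF vcenter_submod[OF V_valring[OF i]] _ vcenter_x[OF V_valring[OF i]]] c RV[OF i] by blast
      then have "a [^] m \<in> vcenter (V i)" using c(2) RC[OF c(1)] xC by (simp add: m_comm)
      then show ?thesis
      proof (induction m)
        case 0 then show ?case using vcenter_one by simp
      next
        case (Suc m)
        then show ?case using vcenter_prime[OF V_valring[OF i] aV[of m], of a] aV[of 1] aC by auto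
      qed
    qed
    moreover have tn: "unz i \<in> vcenter (V i)" using unz(1)[OF i] unfolding uniformizer_def by blast
    have "w \<ominus> a \<in> vcenter (V i)"
    proof -
      have "(inv (unz i) \<otimes> (w \<ominus> a)) \<otimes> unz i \<in> vcenter (V i)" using submodD(5)[OF vcenter_submod[OF V_valring[OF i]] a(2) tn] .
      moreover have "(inv (unz i) \<otimes> (w \<ominus> a)) \<otimes> unz i = (inv (unz i) \<otimes> unz i) \<otimes> (w \<ominus> a)"
        using unzU[OF i] aC wC by (simp add: m_ac Units_closed)
      ultimately show ?thesis using unzU[OF i] aC wC by simp
    qed
    ultimately have "(w \<ominus> a) \<oplus> a \<in> vcenter (V i)" using submodD(4)[OF vcenter_submod[OF V_valring[OF i]]] by blast
    moreover have "(w \<ominus> a) \<oplus> a = w" using aC wC by algebra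
    ultimately have "inv w \<otimes> w \<in> vcenter (V i)"
      using submodD(5)[OF vcenter_submod[OF V_valring[OF i]]] wVU val_ge_0[OF i] by simp
    then show False using vcenter_one wU by simp
  qed
  ultimately show ?thesis using a(1) e by auto
qed

text \<open>\<open>regprime_approx\<close> yields elements of value 1 at one place and 0 at the
  others; products of their integer powers realize every integer vector.\<close>

lemma approx: "\<exists>z\<in>Units Q. \<forall>i\<in>{1..r}. val i z = \<alpha> i"
proof -
  have "\<exists>s\<in>Units Q. val i s = 1 \<and> (\<forall>j\<in>{1..r} - {i}. val j s = 0)" if i: "i \<in> {1..r}" for i
  proof -
    let ?n = "\<lambda>i. vcenter (V i) \<inter> B"
    have n: "regprime (?n j)" "V j = local_at (?n j)" if "j \<in> {1..r}" for j
      using vcenter_regprime[OF V_valring[OF that]] valring_local_at_center[OF V_valring[OF that]] by auto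
    have J: "finite (?n ` ({1..r} - {i}))" by simp
    have J2: "regprime m \<and> m \<noteq> ?n i" if m: "m \<in> ?n ` ({1..r} - {i})" for m
    proof -
      obtain j where j: "j \<in> {1..r}" "j \<noteq> i" "m = ?n j" using m by blast
      have "?n j \<noteq> ?n i"
      proof
        assume "?n j = ?n i"
        then have "V j = V i" using n(2)[OF j(1)] n(2)[OF i] by argo
        then show False using V_inj[OF j(1) i] j by blast
      qed
      then show ?thesis using n(1)[OF j(1)] j(3) by simp
    qed
    obtain s where s: "s \<in> Units Q" "s \<otimes> inv (unz i) \<in> V i" "inv (s \<otimes> inv (unz i)) \<in> V i"
      "\<And>m. m \<in> ?n ` ({1..r} - {i}) \<Longrightarrow> s \<in> local_at m \<and> inv s \<in> local_at m"
      using regprime_approx[OF n(1)[OF i] unz(1)[OF i] J J2] n(2)[OF i] by auto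
    have C: "s \<in> carrier Q" "unz i \<in> carrier Q" "inv (unz i) \<in> carrier Q" using s unzU[OF i] by auto
    have sz: "s = zpow (unz i) 1 \<otimes> (s \<otimes> inv (unz i))" using zpow_1[OF unzU[OF i]] unzU[OF i] C by (simp add: m_lcomm)
    have 1: "val i s = 1" using valI[OF i _ s(2,3) sz] s(1) unzU[OF i] by simp
    have "val j s = 0" if j: "j \<in> {1..r} - {i}" for j
    proof -
      have jr: "j \<in> {1..r}" using j by blast
      have "s \<in> V j \<and> inv s \<in> V j" using s(4)[of "?n j"] j n(2)[OF jr] by blast
      then show ?thesis using valI[OF jr s(1), of s 0] C by simp
    qed
    then show ?thesis using s(1) 1 by blast
  qed
  then obtain s where s: "\<And>i. i \<in> {1..r} \<Longrightarrow> s i \<in> Units Q" "\<And>i. i \<in> {1..r} \<Longrightarrow> val i (s i) = 1"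
    "\<And>i j. i \<in> {1..r} \<Longrightarrow> j \<in> {1..r} \<Longrightarrow> j \<noteq> i \<Longrightarrow> val j (s i) = 0" by (metis Diff_iff singletonD)
  have "\<exists>z\<in>Units Q. \<forall>i\<in>{1..r}. val i z = (if i \<le> m then \<alpha> i else 0)" if "m \<le> r" for m
    using that
  proof (induction m)
    case 0 show ?case using val_one by (intro bexI[of _ \<one>]) auto
  next
    case (Suc m)
    then obtain z where z: "z \<in> Units Q" "\<And>i. i \<in> {1..r} \<Longrightarrow> val i z = (if i \<le> m then \<alpha> i else 0)" by auto
    have m: "Suc m \<in> {1..r}" using Suc by simp
    have u: "zpow (s (Suc m)) (\<alpha> (Suc m)) \<in> Units Q" using s(1)[OF m] by simp
    have "val i (z \<otimes> zpow (s (Suc m)) (\<alpha> (Suc m))) = (if i \<le> Suc m then \<alpha> i else 0)" if i: "i \<in> {1..r}" for i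
      using val_mult[OF i z(1) u] val_zpi[OF i s(1)[OF m]] z(2)[OF i] s(2)[OF m] s(3)[OF m i] by (auto simp: le_Suc_eq)
    then show ?case using z(1) u by blast
  qed
  from this[of r] show ?thesis by auto
qed

lemma V_Int_B: "y \<in> carrier Q \<Longrightarrow> (\<And>i. i \<in> {1..r} \<Longrightarrow> y \<in> V i) \<Longrightarrow> y \<in> B"
  using Int_valring V_surj by metis

lemma conductor_R: "\<exists>N. \<forall>y. (\<forall>i\<in>{1..r}. y \<in> val_ge i N) \<longrightarrow> y \<in> R"
proof -
  obtain k where k: "\<And>b. b \<in> B \<Longrightarrow> x [^] (k::nat) \<otimes> b \<in> R" using B_bounded by blast
  \<comment> \<open>The values of x^k are non-negative, so their sum bounds each of them.\<close>
  define N where "N = (\<Sum>i\<in>{1..r}. val i (x [^] k))"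
  have vx: "val i (x [^] k) \<ge> 0" if "i \<in> {1..r}" for i
    using val_ge_unit[OF that xpU, of k 0] xpow_val_ge[OF that, of 0 k] by simp
  have "y \<in> R" if y: "\<forall>i\<in>{1..r}. y \<in> val_ge i N" for y
  proof -
    have yC: "y \<in> carrier Q" using y r_pos val_ge_carrier[of y 1 N] by auto
    have "inv (x [^] k) \<otimes> y \<in> V i" if i: "i \<in> {1..r}" for i
    proof -
      have "val i (x [^] k) \<le> N" unfolding N_def using member_le_sum[of i "{1..r}" "\<lambda>i. val i (x [^] k)"] i vx by auto
      then have "inv (x [^] k) \<in> val_ge i (- N)" using val_ge_unit[OF i Units_inv_Units[OF xpU]] val_inv[OF i xpU] by simp
      then have "inv (x [^] k) \<otimes> y \<in> val_ge i (- N + N)" using val_ge_mult[OF i] y i by blast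
      then show ?thesis using val_ge_0[OF i] by simp
    qed
    then have "inv (x [^] k) \<otimes> y \<in> B" using V_Int_B yC by simp
    then have "x [^] k \<otimes> (inv (x [^] k) \<otimes> y) \<in> R" using k by blast
    then show ?thesis using yC by (simp add: m_assoc[symmetric])
  qed
  then show ?thesis by blast
qed

lemma bounded_below: assumes y: "y \<in> carrier Q" shows "\<exists>N. \<forall>i\<in>{1..r}. y \<in> val_ge i N"
proof -
  obtain k where k: "x [^] (k::nat) \<otimes> y \<in> R" using xpow_frac[OF y] by blast
  define N where "N = (\<Sum>i\<in>{1..r}. val i (x [^] k))"
  have vx: "val i (x [^] k) \<ge> 0" if "i \<in> {1..r}" for i
    using val_ge_unit[OF that xpU, of k 0] xpow_val_ge[OF that, of 0 k] by simp
  have "y \<in> val_ge i (- N)" if i: "i \<in> {1..r}" for i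
  proof -
    have "val i (x [^] k) \<le> N" unfolding N_def using member_le_sum[of i "{1..r}" "\<lambda>i. val i (x [^] k)"] i vx by auto
    then have "inv (x [^] k) \<in> val_ge i (- N)" using val_ge_unit[OF i Units_inv_Units[OF xpU]] val_inv[OF i xpU] by simp
    moreover have "x [^] k \<otimes> y \<in> val_ge i 0" using k RV[OF i] val_ge_0[OF i] by blast
    ultimately have "inv (x [^] k) \<otimes> (x [^] k \<otimes> y) \<in> val_ge i (- N + 0)" by (rule val_ge_mult[OF i])
    then show ?thesis using y by (simp add: m_assoc[symmetric])
  qed
  then show ?thesis by blast
qed

section \<open>Value sets\<close>

definition box :: "(nat \<Rightarrow> int) \<Rightarrow> 'a set" where
  "box \<alpha> = {y \<in> carrier Q. \<forall>i\<in>{1..r}. y \<in> val_ge i (\<alpha> i)}"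

text \<open>Regular fractional ideals as submodules squeezed between two sets {v \<ge> N}. The
  agreement with the definition by denominators is
  \<open>regular_fractional_ideal_iff\<close>.\<close>

definition regfrac :: "'a set \<Rightarrow> bool" where
  "regfrac I \<longleftrightarrow> submod R I \<and> (\<exists>N. box (\<lambda>_. N) \<subseteq> I) \<and> (\<exists>N. I \<subseteq> box (\<lambda>_. N))"

definition valvec :: "'a \<Rightarrow> nat \<Rightarrow> int" where "valvec z = (\<lambda>i\<in>{1..r}. val i z)"

definition valset :: "'a set \<Rightarrow> (nat \<Rightarrow> int) set" where "valset I = valvec ` (I \<inter> Units Q)"

lemma valvec_eqI: "\<alpha> \<in> int_vectors r \<Longrightarrow> (\<And>i. i \<in> {1..r} \<Longrightarrow> val i z = \<alpha> i) \<Longrightarrow> valvec z = \<alpha>"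
proof
  fix i assume a: "\<alpha> \<in> int_vectors r" and e: "\<And>i. i \<in> {1..r} \<Longrightarrow> val i z = \<alpha> i"
  show "valvec z i = \<alpha> i"
  proof (cases "i \<in> {1..r}")
    case True then show ?thesis using e[OF True] by (simp add: valvec_def)
  next
    case False
    then have "\<alpha> i = undefined" using a PiE_arb unfolding int_vectors_def by blast
    then show ?thesis using False unfolding valvec_def restrict_def by auto
  qed
qed

lemma valvec_int: "valvec z \<in> int_vectors r"
  unfolding valvec_def int_vectors_def by auto

lemma valset_int: "valset I \<subseteq> int_vectors r"
  unfolding valset_def using valvec_int by blast

lemma boxI: "y \<in> carrier Q \<Longrightarrow> (\<And>i. i \<in> {1..r} \<Longrightarrow> y \<in> val_ge i (\<alpha> i)) \<Longrightarrow> y \<in> box \<alpha>"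
  unfolding box_def by blast

lemma boxD: "y \<in> box \<alpha> \<Longrightarrow> i \<in> {1..r} \<Longrightarrow> y \<in> val_ge i (\<alpha> i)" "y \<in> box \<alpha> \<Longrightarrow> y \<in> carrier Q"
  unfolding box_def by auto

lemma box_submod: "submod R (box \<alpha>)"
proof (rule submodI)
  show "box \<alpha> \<subseteq> carrier Q" unfolding box_def by blast
  show "\<zero> \<in> box \<alpha>" by (rule boxI) (use submodD(3)[OF val_ge_submodR] in auto)
next
  fix a b assume a: "a \<in> box \<alpha>" and b: "b \<in> box \<alpha>"
  show "a \<oplus> b \<in> box \<alpha>"
  proof (rule boxI)
    show "a \<oplus> b \<in> carrier Q" using boxD(2)[OF a] boxD(2)[OF b] by simp
    fix i assume i: "i \<in> {1..r}"
    show "a \<oplus> b \<in> val_ge i (\<alpha> i)" using submodD(4)[OF val_ge_submodR[OF i] boxD(1)[OF a i] boxD(1)[OF b i]] .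
  qed
next
  fix s a assume s: "s \<in> R" and a: "a \<in> box \<alpha>"
  show "s \<otimes> a \<in> box \<alpha>"
  proof (rule boxI)
    show "s \<otimes> a \<in> carrier Q" using boxD(2)[OF a] RC[OF s] by simp
    fix i assume i: "i \<in> {1..r}"
    show "s \<otimes> a \<in> val_ge i (\<alpha> i)" using submodD(5)[OF val_ge_submodR[OF i] s boxD(1)[OF a i]] .
  qed
qed

lemma box_mult: assumes y: "y \<in> box \<alpha>" and z: "z \<in> box \<beta>" shows "y \<otimes> z \<in> box (\<lambda>i. \<alpha> i + \<beta> i)"
proof (rule boxI)
  show "y \<otimes> z \<in> carrier Q" using boxD(2)[OF y] boxD(2)[OF z] by simp
  fix i assume i: "i \<in> {1..r}"
  show "y \<otimes> z \<in> val_ge i (\<alpha> i + \<beta> i)" using val_ge_mult[OF i boxD(1)[OF y i] boxD(1)[OF z i]] .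
qed

lemma box_anti: assumes "\<And>i. i \<in> {1..r} \<Longrightarrow> \<alpha> i \<le> \<beta> i" shows "box \<beta> \<subseteq> box \<alpha>"
proof
  fix y assume y: "y \<in> box \<beta>"
  show "y \<in> box \<alpha>"
  proof (rule boxI[OF boxD(2)[OF y]])
    fix i assume i: "i \<in> {1..r}"
    show "y \<in> val_ge i (\<alpha> i)" using val_ge_antimono[OF i assms[OF i]] boxD(1)[OF y i] by blast
  qed
qed

lemma box_cong: assumes "\<And>i. i \<in> {1..r} \<Longrightarrow> \<alpha> i = \<beta> i" shows "box \<alpha> = box \<beta>"
  using box_anti[of \<alpha> \<beta>] box_anti[of \<beta> \<alpha>] assms by simp

lemma box_unit: "z \<in> Units Q \<Longrightarrow> z \<in> box \<alpha> \<longleftrightarrow> (\<forall>i\<in>{1..r}. \<alpha> i \<le> val i z)"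
  unfolding box_def using val_ge_unit by auto

lemma ex_bound: obtains N :: int where "\<And>i. i \<in> {1..r} \<Longrightarrow> \<alpha> i \<le> N" "K \<le> N"
proof
  define N where "N = \<bar>K\<bar> + (\<Sum>i\<in>{1..r}. \<bar>\<alpha> i\<bar>)"
  have "0 \<le> (\<Sum>i\<in>{1..r}. \<bar>\<alpha> i\<bar>)" by (rule sum_nonneg) simp
  then show "K \<le> N" unfolding N_def using abs_ge_self[of K] by linarith
  fix i assume "i \<in> {1..r}"
  then show "\<alpha> i \<le> N" unfolding N_def using member_le_sum[of i "{1..r}" "\<lambda>i. \<bar>\<alpha> i\<bar>"] by fastforce
qed

lemma regfrac_box: "regfrac (box \<alpha>)"
proof -
  obtain N where "\<And>i. i \<in> {1..r} \<Longrightarrow> \<alpha> i \<le> N" using ex_bound[of \<alpha>] by blast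
  then have "box (\<lambda>_. N) \<subseteq> box \<alpha>" by (rule box_anti)
  moreover obtain N' where "\<And>i. i \<in> {1..r} \<Longrightarrow> - \<alpha> i \<le> N'" using ex_bound[of "\<lambda>i. - \<alpha> i"] by blast
  then have "box \<alpha> \<subseteq> box (\<lambda>_. - N')" by (intro box_anti) force
  ultimately show ?thesis unfolding regfrac_def using box_submod by blast
qed

lemma regfrac_submod: "regfrac I \<Longrightarrow> submod R I" unfolding regfrac_def by blast

lemma regfrac_lower:
  assumes "regfrac I" obtains N where "box (\<lambda>_. N) \<subseteq> I" "K \<le> N"
proof -
  obtain N where N: "box (\<lambda>_. N) \<subseteq> I" using assms unfolding regfrac_def by blast
  have "box (\<lambda>_. max N K) \<subseteq> I" using box_anti[of "\<lambda>_. N" "\<lambda>_. max N K"] N by auto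
  then show ?thesis using that[of "max N K"] by simp
qed

lemma regfrac_upper: assumes "regfrac I" obtains N where "I \<subseteq> box (\<lambda>_. N)"
  using assms unfolding regfrac_def by blast

lemma regfrac_unit: assumes "regfrac I" obtains h where "h \<in> I" "h \<in> Units Q"
proof -
  obtain N where N: "box (\<lambda>_. N) \<subseteq> I" using regfrac_lower[OF assms, of 0] by blast
  obtain z where "z \<in> Units Q" "\<forall>i\<in>{1..r}. val i z = N" using approx[of "\<lambda>_. N"] by blast
  then show ?thesis using that[of z] N box_unit[of z "\<lambda>_. N"] by auto
qed

lemma regfrac_msum: assumes I: "regfrac I" and J: "regfrac J" shows "regfrac (msum I J)"
proof -
  note s = regfrac_submod[OF I] regfrac_submod[OF J]
  obtain N where N: "box (\<lambda>_. N) \<subseteq> I" using regfrac_lower[OF I] by blast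
  obtain K where K: "I \<subseteq> box (\<lambda>_. K)" using regfrac_upper[OF I] by blast
  obtain K' where K': "J \<subseteq> box (\<lambda>_. K')" using regfrac_upper[OF J] by blast
  have "box (\<lambda>_. K) \<subseteq> box (\<lambda>_. min K K')" "box (\<lambda>_. K') \<subseteq> box (\<lambda>_. min K K')" by (rule box_anti, simp)+
  then have "msum I J \<subseteq> box (\<lambda>_. min K K')" using msum_le[OF box_submod, of I _ J] K K' by blast
  moreover have "box (\<lambda>_. N) \<subseteq> msum I J" using N msum_ge1[OF s] by blast
  ultimately show ?thesis unfolding regfrac_def using submod_msum[OF R s] by blast
qed

lemma colon_iff: "y \<in> ideal_colon Q J I \<longleftrightarrow> y \<in> carrier Q \<and> (\<forall>b\<in>I. y \<otimes> b \<in> J)"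
  unfolding ideal_colon_def by blast

lemma regfrac_colon: assumes J: "regfrac J" and I: "regfrac I" shows "regfrac (ideal_colon Q J I)"
proof -
  note Is = regfrac_submod[OF I] and Js = regfrac_submod[OF J]
  have sm: "submod R (ideal_colon Q J I)"
  proof (rule submodI)
    show "ideal_colon Q J I \<subseteq> carrier Q" using colon_iff by blast
    show "\<zero> \<in> ideal_colon Q J I" using colon_iff submodD(2)[OF Is] submodD(3)[OF Js] by simp
  next
    fix a b assume "a \<in> ideal_colon Q J I" "b \<in> ideal_colon Q J I"
    then show "a \<oplus> b \<in> ideal_colon Q J I"
      unfolding colon_iff using submodD(4)[OF Js] submodD(2)[OF Is] by (simp add: l_distr)
  next
    fix s a assume "s \<in> R" "a \<in> ideal_colon Q J I"
    then show "s \<otimes> a \<in> ideal_colon Q J I"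
      unfolding colon_iff using submodD(5)[OF Js] submodD(2)[OF Is] RC by (simp add: m_assoc)
  qed
  obtain N where N: "box (\<lambda>_. N) \<subseteq> J" using regfrac_lower[OF J] by blast
  obtain K where K: "I \<subseteq> box (\<lambda>_. K)" using regfrac_upper[OF I] by blast
  have "box (\<lambda>_. N - K) \<subseteq> ideal_colon Q J I"
  proof
    fix y assume y: "y \<in> box (\<lambda>_. N - K)"
    have "y \<otimes> b \<in> J" if "b \<in> I" for b
      using box_mult[OF y, of b "\<lambda>_. K"] K N that by auto
    then show "y \<in> ideal_colon Q J I" unfolding colon_iff using boxD(2)[OF y] by blast
  qed
  moreover obtain h where h: "h \<in> I" "h \<in> Units Q" using regfrac_unit[OF I] by blast
  obtain L where L: "J \<subseteq> box (\<lambda>_. L)" using regfrac_upper[OF J] by blast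
  obtain P where P: "\<forall>i\<in>{1..r}. inv h \<in> val_ge i P" using bounded_below[of "inv h"] h by auto
  have hP: "inv h \<in> box (\<lambda>_. P)" by (rule boxI) (use P h in auto)
  have "ideal_colon Q J I \<subseteq> box (\<lambda>_. L + P)"
  proof
    fix y assume "y \<in> ideal_colon Q J I"
    then have y: "y \<in> carrier Q" "y \<otimes> h \<in> J" using h unfolding colon_iff by auto
    have "(y \<otimes> h) \<otimes> inv h \<in> box (\<lambda>_. L + P)" using box_mult[of "y \<otimes> h" "\<lambda>_. L", OF _ hP] y L by blast
    then show "y \<in> box (\<lambda>_. L + P)" using y h by (simp add: m_assoc Units_closed)
  qed
  ultimately show ?thesis unfolding regfrac_def using sm by blast
qed

lemma val_ge_exact_add:
  assumes i: "i \<in> {1..r}" and u: "u \<in> val_ge i k" "u \<notin> val_ge i (k + 1)" and v: "v \<in> val_ge i (k + 1)"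
  shows "u \<oplus> v \<in> val_ge i k" "u \<oplus> v \<notin> val_ge i (k + 1)"
proof -
  have "v \<in> val_ge i k" using val_ge_antimono[OF i, of k "k + 1"] v by auto
  then show "u \<oplus> v \<in> val_ge i k" using submodD(4)[OF val_ge_submodR[OF i] u(1)] by blast
  show "u \<oplus> v \<notin> val_ge i (k + 1)"
    using submod_cancel[OF val_ge_submodR[OF i] R v val_ge_carrier[OF u(1)]] a_comm[OF val_ge_carrier[OF u(1)] val_ge_carrier[OF v]] u(2) by metis
qed

lemma unit_exact: "i \<in> {1..r} \<Longrightarrow> z \<in> Units Q \<Longrightarrow> z \<in> val_ge i (val i z) \<and> z \<notin> val_ge i (val i z + 1)"
  using val_ge_unit by simp

text \<open>Adding s of value at least N \<ge> K everywhere preserves membership in I and every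
  comparison of values up to K. This is how facts about values of units reach arbitrary elements of
  I.\<close>

lemma lift_unit:
  assumes I: "regfrac I" and y: "y \<in> I"
  shows "\<exists>z\<in>I \<inter> Units Q. \<forall>i\<in>{1..r}. \<forall>k\<le>K. z \<in> val_ge i k \<longleftrightarrow> y \<in> val_ge i k"
proof -
  note Is = regfrac_submod[OF I]
  obtain N where N: "box (\<lambda>_. N) \<subseteq> I" "K \<le> N" using regfrac_lower[OF I, of K] by blast
  have yC: "y \<in> carrier Q" using submodD(2)[OF Is y] .
  obtain s where s: "\<forall>i\<in>{1..r}. s \<in> val_ge i N" "s \<in> carrier Q" "y \<oplus> s \<in> Units Q" using shift_unit[OF yC] by blast
  have "s \<in> I" using N(1) boxI[OF s(2), of "\<lambda>_. N"] s(1) by blast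
  then have zI: "y \<oplus> s \<in> I" using submodD(4)[OF Is y] by blast
  have "y \<oplus> s \<in> val_ge i k \<longleftrightarrow> y \<in> val_ge i k" if i: "i \<in> {1..r}" and k: "k \<le> K" for i k
  proof -
    have sk: "s \<in> val_ge i k" using val_ge_antimono[OF i, of k N] s(1) i k N(2) by auto
    show ?thesis
      using submodD(4)[OF val_ge_submodR[OF i] _ sk, of y] submod_cancel[OF val_ge_submodR[OF i] R sk yC] a_comm[OF yC s(2)] by metis
  qed
  then show ?thesis using zI s(3) by blast
qed

lemma realize:
  assumes I: "regfrac I" and y: "y \<in> I" and e: "\<And>i. i \<in> {1..r} \<Longrightarrow> y \<in> val_ge i (m i) \<and> y \<notin> val_ge i (m i + 1)"
  shows "\<exists>z\<in>I \<inter> Units Q. \<forall>i\<in>{1..r}. val i z = m i"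
proof -
  obtain K where K: "\<And>i. i \<in> {1..r} \<Longrightarrow> m i + 1 \<le> K" using ex_bound[of "\<lambda>i. m i + 1"] by blast
  obtain z where z: "z \<in> I" "z \<in> Units Q" "\<And>i k. i \<in> {1..r} \<Longrightarrow> k \<le> K \<Longrightarrow> z \<in> val_ge i k \<longleftrightarrow> y \<in> val_ge i k"
    using lift_unit[OF I y, of K] by blast
  have "val i z = m i" if i: "i \<in> {1..r}" for i
    using val_eqI[OF i z(2)] z(3)[OF i] e[OF i] K[OF i] by simp
  then show ?thesis using z by blast
qed

text \<open>A combination \<open>y - c z\<close> works as soon as the residue of \<open>c\<close> avoids \<open>0\<close> and one class for each
  coordinate in which the values agree; if neither value dominates the other, these are fewer than \<open>r\<close>.\<close>

lemma value_min:
  assumes I: "regfrac I" and y: "y \<in> I" "y \<in> Units Q" and z: "z \<in> I" "z \<in> Units Q"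
  shows "\<exists>w\<in>I \<inter> Units Q. \<forall>i\<in>{1..r}. val i w = min (val i y) (val i z)"
proof -
  note Is = regfrac_submod[OF I]
  have C: "y \<in> carrier Q" "z \<in> carrier Q" using y z by auto
  consider "\<forall>i\<in>{1..r}. val i y \<le> val i z" | "\<forall>i\<in>{1..r}. val i z \<le> val i y"
    | p q where "p \<in> {1..r}" "q \<in> {1..r}" "val p z < val p y" "val q y < val q z"
  proof (cases "\<forall>i\<in>{1..r}. val i y \<le> val i z")
    case True then show thesis using that(1) by blast
  next
    case False
    then obtain p where p: "p \<in> {1..r}" "\<not> val p y \<le> val p z" by blast
    show thesis
    proof (cases "\<forall>i\<in>{1..r}. val i z \<le> val i y")
      case True then show thesis using that(2) by blast
    next
      case False
      then obtain q where "q \<in> {1..r}" "\<not> val q z \<le> val q y" by blast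
      then show thesis using that(3)[of p q] p by simp
    qed
  qed
  then show ?thesis
  proof cases
    case 1 then show ?thesis using y by (intro bexI[of _ y]) auto
  next
    case 2 then show ?thesis using z by (intro bexI[of _ z]) auto
  next
    case 3
    define S where "S = {i\<in>{1..r}. val i y = val i z}"
    have "\<forall>i\<in>S. \<exists>a. a \<in> R \<and> y \<ominus> a \<otimes> z \<in> val_ge i (val i y + 1)"
      using resid_unit[OF _ y(2) z(2)] unfolding S_def by blast
    then obtain a where a: "\<forall>i\<in>S. a i \<in> R \<and> y \<ominus> a i \<otimes> z \<in> val_ge i (val i y + 1)" by (rule bchoice[THEN exE])
    define A where "A = insert \<zero> (a ` S)"
    have "S \<subseteq> {1..r} - {p, q}" unfolding S_def using 3 by auto
    then have "card S \<le> card ({1..r} - {p, q})" by (intro card_mono) auto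
    moreover have "card ({1..r} - {p, q}) = r - 2"
    proof -
      have "p \<noteq> q" using 3 by auto
      then show ?thesis using 3 by (subst card_Diff_subset) auto
    qed
    moreover have "r \<ge> 2"
    proof -
      have "p \<noteq> q" using 3 by auto
      then show ?thesis using 3(1,2) by auto
    qed
    moreover have Sf: "finite S" unfolding S_def by simp
    moreover have "card A \<le> Suc (card S)"
      unfolding A_def using card_insert_le_m1[of "Suc (card S)" "a ` S" \<zero>] card_image_le[OF Sf, of a] by simp
    ultimately have "card A < r" by linarith
    moreover have "A \<subseteq> R" unfolding A_def using a R_closed by auto
    moreover have "finite A" unfolding A_def using Sf by simp
    ultimately obtain c where c: "c \<in> R" "\<forall>b\<in>A. c \<ominus> b \<notin> M" using resid_card by blast
    have cC: "c \<in> carrier Q" using c RC by blast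
    have cM: "c \<notin> M"
    proof -
      have "c \<ominus> \<zero> \<notin> M" using c(2) unfolding A_def by blast
      then show ?thesis using cC by (simp add: a_minus_def)
    qed
    define w where "w = y \<ominus> c \<otimes> z"
    have wI: "w \<in> I" unfolding w_def using submod_diff[OF Is R y(1) submodD(5)[OF Is c(1) z(1)]] .
    have "w \<in> val_ge i (min (val i y) (val i z)) \<and> w \<notin> val_ge i (min (val i y) (val i z) + 1)" if i: "i \<in> {1..r}" for i
    proof -
      note Dm = val_ge_submodR[OF i]
      have cz: "c \<otimes> z \<in> val_ge i (val i z)" using submodD(5)[OF Dm c(1)] unit_exact[OF i z(2)] by blast
      have cu: "c \<in> Units Q" "val i c = 0" using val_M[OF i c(1) cM] by auto
      consider "val i y < val i z" | "val i z < val i y" | "val i y = val i z" by linarith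
      then show ?thesis
      proof cases
        case 1
        have "\<ominus> (c \<otimes> z) \<in> val_ge i (val i y + 1)"
          using submod_minus[OF Dm R] cz val_ge_antimono[OF i, of "val i y + 1" "val i z"] 1 by auto
        then show ?thesis using val_ge_exact_add[OF i _ _, of y "val i y"] unit_exact[OF i y(2)] 1
          unfolding w_def a_minus_def by simp
      next
        case 2
        have u: "\<ominus> (c \<otimes> z) \<in> Units Q \<and> val i (\<ominus> (c \<otimes> z)) = val i z"
        proof -
          have m1: "\<ominus> \<one> \<in> Units Q" "\<ominus> \<one> \<in> R" using Units_iff_inv[of "\<ominus> \<one>" "\<ominus> \<one>"] R_closed by (auto simp: l_minus)
          have "\<ominus> \<one> \<notin> M"
          proof
            assume "\<ominus> \<one> \<in> M" then have "\<ominus> (\<ominus> \<one>) \<in> M" using submod_minus[OF M R] by blast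
            then show False using one_M by simp
          qed
          then have "val i (\<ominus> \<one>) = 0" using val_M[OF i m1(2)] by blast
          moreover have "\<ominus> (c \<otimes> z) = \<ominus> \<one> \<otimes> (c \<otimes> z)" using cC C by (simp add: l_minus)
          ultimately show ?thesis using m1 cu z val_mult[OF i] by simp
        qed
        have "y \<in> val_ge i (val i z + 1)" using val_ge_unit[OF i y(2)] 2 by simp
        then show ?thesis using val_ge_exact_add[OF i _ _, of "\<ominus> (c \<otimes> z)" "val i z" y] unit_exact[OF i, of "\<ominus> (c \<otimes> z)"] u 2 cC C
          unfolding w_def a_minus_def by (simp add: a_comm)
      next
        case 3
        then have iS: "i \<in> S" unfolding S_def using i by simp
        have ai: "a i \<in> R" "y \<ominus> a i \<otimes> z \<in> val_ge i (val i y + 1)" using a iS by auto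
        have d: "a i \<ominus> c \<in> R" "a i \<ominus> c \<notin> M"
        proof -
          show "a i \<ominus> c \<in> R" using submod_diff[OF R_self R ai(1) c(1)] .
          show "a i \<ominus> c \<notin> M"
          proof
            assume "a i \<ominus> c \<in> M"
            then have "\<ominus> (a i \<ominus> c) \<in> M" using submod_minus[OF M R] by blast
            moreover have "\<ominus> (a i \<ominus> c) = c \<ominus> a i" using cC RC[OF ai(1)] by algebra
            ultimately show False using c(2) iS unfolding A_def by auto
          qed
        qed
        have du: "a i \<ominus> c \<in> Units Q" "val i (a i \<ominus> c) = 0" using val_M[OF i d] by auto
        have u: "(a i \<ominus> c) \<otimes> z \<in> Units Q" "val i ((a i \<ominus> c) \<otimes> z) = val i y"
          using du z val_mult[OF i du(1) z(2)] 3 by auto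
        have "w = (a i \<ominus> c) \<otimes> z \<oplus> (y \<ominus> a i \<otimes> z)" unfolding w_def using C cC RC[OF ai(1)] by algebra
        then show ?thesis using val_ge_exact_add[OF i _ _ ai(2), of "(a i \<ominus> c) \<otimes> z"] unit_exact[OF i u(1)] u(2) 3 by simp
      qed
    qed
    then show ?thesis by (rule realize[OF I wI])
  qed
qed

text \<open>The value vectors of the witnesses have componentwise minimum \<beta>, and
  \<open>value_min\<close> attains minima; the induction takes them one coordinate at a
  time.\<close>

lemma value_combine:
  assumes I: "regfrac I" and ex: "\<And>i. i \<in> {1..r} \<Longrightarrow> \<exists>y\<in>I \<inter> Units Q. val i y = \<beta> i \<and> (\<forall>j\<in>{1..r}. \<beta> j \<le> val j y)"
  shows "\<exists>w\<in>I \<inter> Units Q. \<forall>i\<in>{1..r}. val i w = \<beta> i"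
proof -
  have "\<exists>w\<in>I \<inter> Units Q. (\<forall>i\<in>{1..m}. val i w = \<beta> i) \<and> (\<forall>j\<in>{1..r}. \<beta> j \<le> val j w)" if "1 \<le> m" "m \<le> r" for m
    using that
  proof (induction m)
    case (Suc m)
    obtain y where y: "y \<in> I" "y \<in> Units Q" "val (Suc m) y = \<beta> (Suc m)" "\<forall>j\<in>{1..r}. \<beta> j \<le> val j y"
      using ex[of "Suc m"] Suc.prems by auto
    show ?case
    proof (cases "m = 0")
      case True then show ?thesis using y by (intro bexI[of _ y]) auto
    next
      case False
      then obtain w where w: "w \<in> I" "w \<in> Units Q" "\<forall>i\<in>{1..m}. val i w = \<beta> i" "\<forall>j\<in>{1..r}. \<beta> j \<le> val j w"
        using Suc by auto
      obtain z where z: "z \<in> I \<inter> Units Q" "\<forall>i\<in>{1..r}. val i z = min (val i w) (val i y)"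
        using value_min[OF I w(1,2) y(1,2)] by blast
      have "val i z = \<beta> i" if "i \<in> {1..Suc m}" for i
      proof (cases "i = Suc m")
        case True
        have "Suc m \<in> {1..r}" using Suc.prems by simp
        then have "val i z = min (val i w) (\<beta> i)" "\<beta> i \<le> val i w" using z(2) w(4) y(3) True by auto
        then show ?thesis by simp
      next
        case False
        then have i: "i \<in> {1..m}" "i \<in> {1..r}" using that Suc.prems by auto
        have "val i z = min (\<beta> i) (val i y)" "\<beta> i \<le> val i y" using bspec[OF z(2) i(2)] bspec[OF w(3) i(1)] bspec[OF y(4) i(2)] by auto
        then show ?thesis by simp
      qed
      then show ?thesis using z w y by (intro bexI[of _ z]) auto
    qed
  qed simp
  from this[of r] show ?thesis using r_pos by auto
qed

text \<open>Cancelling leading terms at j raises the value there. The multiplier has value 0 in all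
  coordinates, so elsewhere the ultrametric inequality holds, with equality where the two values
  differ.\<close>

lemma value_exchange:
  assumes I: "regfrac I" and y: "y \<in> I" "y \<in> Units Q" and z: "z \<in> I" "z \<in> Units Q"
    and j: "j \<in> {1..r}" "val j y = val j z"
  shows "\<exists>w\<in>I \<inter> Units Q. val j y < val j w \<and>
     (\<forall>i\<in>{1..r}. min (val i y) (val i z) \<le> val i w \<and> (val i y \<noteq> val i z \<longrightarrow> val i w = min (val i y) (val i z)))"
proof -
  note Is = regfrac_submod[OF I]
  have C: "y \<in> carrier Q" "z \<in> carrier Q" using y z by auto
  obtain a where a: "a \<in> R" "a \<notin> M" "y \<ominus> a \<otimes> z \<in> val_ge j (val j y + 1)" using resid_unit[OF j(1) y(2) z(2) j(2)] by blast
  have aC: "a \<in> carrier Q" using a RC by blast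
  have m: "\<ominus> a \<in> R" "\<ominus> a \<notin> M"
  proof -
    show "\<ominus> a \<in> R" using R_closed a by blast
    show "\<ominus> a \<notin> M" using submod_minus[OF M R, of "\<ominus> a"] a aC by auto
  qed
  define z' where "z' = \<ominus> a \<otimes> z"
  have z': "z' \<in> Units Q" "\<And>i. i \<in> {1..r} \<Longrightarrow> val i z' = val i z"
    unfolding z'_def using val_M[OF _ m] val_mult[OF _ _ z(2)] z(2) j(1) by auto
  define w where "w = y \<oplus> z'"
  have we: "w = y \<ominus> a \<otimes> z" unfolding w_def z'_def using C aC by algebra
  have z'I: "z' \<in> I" unfolding z'_def using submodD(5)[OF Is m(1) z(1)] .
  have wI: "w \<in> I" unfolding w_def using submodD(4)[OF Is y(1) z'I] .
  \<comment> \<open>w may be a zero divisor. K exceeds all values of y and z, so replacing w by a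
    unit u keeps the relevant comparisons.\<close>
  obtain K where K: "\<And>i. i \<in> {1..r} \<Longrightarrow> max (val i y) (val i z) + 1 \<le> K"
    using ex_bound[of "\<lambda>i. max (val i y) (val i z) + 1"] by blast
  obtain u where u: "u \<in> I" "u \<in> Units Q" "\<And>i k. i \<in> {1..r} \<Longrightarrow> k \<le> K \<Longrightarrow> u \<in> val_ge i k \<longleftrightarrow> w \<in> val_ge i k"
    using lift_unit[OF I wI, of K] by blast
  have "u \<in> val_ge j (val j y + 1)" using u(3)[OF j(1), of "val j y + 1"] K[OF j(1)] a(3) we by simp
  then have 1: "val j y < val j u" using val_ge_unit[OF j(1) u(2)] by simp
  have 2: "min (val i y) (val i z) \<le> val i u \<and> (val i y \<noteq> val i z \<longrightarrow> val i u = min (val i y) (val i z))" if i: "i \<in> {1..r}" for i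
  proof -
    let ?m = "min (val i y) (val i z)"
    have mK: "?m \<le> K" "?m + 1 \<le> K" using K[OF i] by auto
    have "y \<in> val_ge i ?m" "z' \<in> val_ge i ?m" using val_ge_unit[OF i y(2)] val_ge_unit[OF i z'(1)] z'(2)[OF i] by auto
    then have "w \<in> val_ge i ?m" unfolding w_def using submodD(4)[OF val_ge_submodR[OF i]] by blast
    then have "u \<in> val_ge i ?m" using u(3)[OF i mK(1)] by simp
    then have a1: "?m \<le> val i u" using val_ge_unit[OF i u(2)] by simp
    have "val i u = ?m" if "val i y \<noteq> val i z"
    proof -
      have "w \<in> val_ge i ?m \<and> w \<notin> val_ge i (?m + 1)"
      proof (cases "val i y < val i z")
        case True
        then have "z' \<in> val_ge i (val i y + 1)" using val_ge_unit[OF i z'(1)] z'(2)[OF i] by simp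
        then show ?thesis using val_ge_exact_add[OF i, of y "val i y" z'] unit_exact[OF i y(2)] True unfolding w_def by simp
      next
        case False
        then have "y \<in> val_ge i (val i z + 1)" using val_ge_unit[OF i y(2)] that by simp
        then show ?thesis using val_ge_exact_add[OF i, of z' "val i z" y] unit_exact[OF i z'(1)] z' i False that C
          unfolding w_def by (simp add: a_comm Units_closed)
      qed
      then show ?thesis using val_eqI[OF i u(2)] u(3)[OF i] mK by simp
    qed
    then show ?thesis using a1 by blast
  qed
  show ?thesis using u 1 2 by blast
qed

text \<open>Successive approximation by elements of \<open>I\<close> with the same value ends in the conductor.\<close>

lemma value_subset:
  assumes I: "regfrac I" and I': "regfrac I'"
    and valued_ring: "\<And>z. z \<in> I' \<Longrightarrow> z \<in> Units Q \<Longrightarrow> \<exists>h\<in>I \<inter> I' \<inter> Units Q. \<forall>i\<in>{1..r}. val i h = val i z"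
  shows "I' \<subseteq> I"
proof -
  note Is = regfrac_submod[OF I] and Is' = regfrac_submod[OF I']
  obtain N0 where N0: "box (\<lambda>_. N0) \<subseteq> I" using regfrac_lower[OF I] by blast
  obtain N where N: "box (\<lambda>_. N) \<subseteq> I'" "N0 \<le> N" using regfrac_lower[OF I'] by blast
  have NI: "box (\<lambda>_. N) \<subseteq> I" using box_anti[of "\<lambda>_. N0" "\<lambda>_. N"] N0 N by auto
  have main: "z \<in> I" if "z \<in> I'" "z \<in> box \<alpha>" "\<And>i. i \<in> {1..r} \<Longrightarrow> \<alpha> i \<le> N" for z \<alpha>
    using that
  \<comment> \<open>The measure is the total distance of \<alpha> below N. Each round raises one
    coordinate; once all have reached N, the element lies in a box contained in I.\<close>
  proof (induction "\<Sum>i\<in>{1..r}. nat (N - \<alpha> i)" arbitrary: z \<alpha> rule: less_induct)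
    case less
    have zC: "z \<in> carrier Q" using boxD(2)[OF less.prems(2)] .
    show ?case
    proof (cases "\<forall>i\<in>{1..r}. N \<le> \<alpha> i")
      case True
      then have "z \<in> box (\<lambda>_. N)" using box_anti[of "\<lambda>_. N" \<alpha>] less.prems(2) by auto
      then show ?thesis using NI by blast
    next
      case False
      then obtain i where i: "i \<in> {1..r}" "\<alpha> i < N" by auto
      define \<beta> where "\<beta> = \<alpha>(i := \<alpha> i + 1)"
      have \<beta>N: "\<beta> j \<le> N" if "j \<in> {1..r}" for j unfolding \<beta>_def using less.prems(3)[OF that] i by auto
      have sm: "(\<Sum>i\<in>{1..r}. nat (N - \<beta> i)) < (\<Sum>i\<in>{1..r}. nat (N - \<alpha> i))"
      proof (rule sum_strict_mono_ex1)
        show "\<forall>j\<in>{1..r}. nat (N - \<beta> j) \<le> nat (N - \<alpha> j)" unfolding \<beta>_def by auto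
        show "\<exists>j\<in>{1..r}. nat (N - \<beta> j) < nat (N - \<alpha> j)" unfolding \<beta>_def using i by (intro bexI[of _ i]) auto
      qed simp
      obtain s where s: "\<forall>i\<in>{1..r}. s \<in> val_ge i N" "s \<in> carrier Q" "z \<oplus> s \<in> Units Q" using shift_unit[OF zC] by blast
      have sB: "s \<in> box (\<lambda>_. N)" by (rule boxI) (use s in auto)
      define z' where "z' = z \<oplus> s"
      have z'U: "z' \<in> Units Q" and z'C: "z' \<in> carrier Q" unfolding z'_def using s zC by auto
      have z'I: "z' \<in> I'" unfolding z'_def using submodD(4)[OF Is' less.prems(1)] sB N by blast
      have sj: "s \<in> val_ge j (\<alpha> j)" if j: "j \<in> {1..r}" for j
        using val_ge_antimono[OF j less.prems(3)[OF j]] s(1) j by auto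
      have z'D: "z' \<in> val_ge j (\<alpha> j)" if j: "j \<in> {1..r}" for j
        unfolding z'_def using submodD(4)[OF val_ge_submodR[OF j] boxD(1)[OF less.prems(2) j] sj[OF j]] .
      have \<beta>I: "u \<in> box \<beta>" if u: "u \<in> carrier Q" "u \<in> val_ge i (\<alpha> i + 1)" "\<And>j. j \<in> {1..r} \<Longrightarrow> u \<in> val_ge j (\<alpha> j)" for u
        using u by (intro boxI) (auto simp: \<beta>_def)
      have z'in: "z' \<in> I"
      proof (cases "z' \<in> val_ge i (\<alpha> i + 1)")
        case True
        then show ?thesis using less.hyps[OF sm z'I \<beta>I[OF z'C True z'D] \<beta>N] by blast
      next
        case False
        then have v: "val i z' = \<alpha> i" using val_eqI[OF i(1) z'U z'D[OF i(1)]] by blast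
        \<comment> \<open>h has the same value as z' in every coordinate, so subtracting a suitable
          multiple gains at i and loses nowhere.\<close>
        obtain h where h: "h \<in> I" "h \<in> I'" "h \<in> Units Q" "\<forall>i\<in>{1..r}. val i h = val i z'" using valued_ring[OF z'I z'U] by blast
        have hC: "h \<in> carrier Q" using h by blast
        obtain a where a: "a \<in> R" "z' \<ominus> a \<otimes> h \<in> val_ge i (\<alpha> i + 1)"
          using resid_unit[OF i(1) z'U h(3)] h(4) i(1) v by auto
        have aC: "a \<in> carrier Q" using a RC by blast
        have "z' \<ominus> a \<otimes> h \<in> val_ge j (\<alpha> j)" if j: "j \<in> {1..r}" for j
        proof -
          have "h \<in> val_ge j (\<alpha> j)" using val_ge_unit[OF j h(3)] val_ge_unit[OF j z'U] z'D[OF j] h(4) j by simp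
          then show ?thesis using submod_diff[OF val_ge_submodR[OF j] R z'D[OF j]] submodD(5)[OF val_ge_submodR[OF j] a(1)] by blast
        qed
        then have "z' \<ominus> a \<otimes> h \<in> box \<beta>" using \<beta>I[of "z' \<ominus> a \<otimes> h"] a z'C hC aC by simp
        moreover have "z' \<ominus> a \<otimes> h \<in> I'" using submod_diff[OF Is' R z'I] submodD(5)[OF Is' a(1) h(2)] by blast
        ultimately have "z' \<ominus> a \<otimes> h \<in> I" using less.hyps[OF sm _ _ \<beta>N] by blast
        then show ?thesis using submod_cancel_diff[OF Is R submodD(5)[OF Is a(1) h(1)] z'C] by blast
      qed
      have "s \<in> I" using sB NI by blast
      then show ?thesis using submod_cancel[OF Is R, of s z] zC z'in a_comm[OF zC s(2)] unfolding z'_def by simp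
    qed
  qed
  obtain K where K: "I' \<subseteq> box (\<lambda>_. K)" using regfrac_upper[OF I'] by blast
  have "box (\<lambda>_. K) \<subseteq> box (\<lambda>_. min K N)" by (rule box_anti) simp
  then show ?thesis using main[of _ "\<lambda>_. min K N"] K by auto
qed

lemma approx_box: "\<exists>z\<in>Units Q. z \<in> box \<alpha> \<and> (\<forall>i\<in>{1..r}. val i z = \<alpha> i)"
proof -
  obtain z where z: "z \<in> Units Q" "\<forall>i\<in>{1..r}. val i z = \<alpha> i" using approx[of \<alpha>] by blast
  then show ?thesis using box_unit[OF z(1), of \<alpha>] by (intro bexI[of _ z]) simp_all
qed

lemma valset_iff: "\<beta> \<in> int_vectors r \<Longrightarrow> \<beta> \<in> valset I \<longleftrightarrow> (\<exists>h\<in>I \<inter> Units Q. \<forall>i\<in>{1..r}. val i h = \<beta> i)"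
proof
  assume "\<beta> \<in> valset I"
  then obtain h where "h \<in> I \<inter> Units Q" "\<beta> = valvec h" unfolding valset_def by blast
  then show "\<exists>h\<in>I \<inter> Units Q. \<forall>i\<in>{1..r}. val i h = \<beta> i" by (intro bexI[of _ h]) (auto simp: valvec_def)
next
  assume "\<beta> \<in> int_vectors r" "\<exists>h\<in>I \<inter> Units Q. \<forall>i\<in>{1..r}. val i h = \<beta> i"
  then obtain h where h: "h \<in> I \<inter> Units Q" "valvec h = \<beta>" using valvec_eqI by metis
  then show "\<beta> \<in> valset I" unfolding valset_def by blast
qed

text \<open>If v(z) \<ge> min(\<delta>, \<delta>'), then v(z) is the minimum of max(v(z), \<delta>)
  and max(v(z), \<delta>'), both of which are values of elements of J.\<close>

lemma box_min:
  assumes J: "regfrac J" and d: "box \<delta> \<subseteq> J" "box \<delta>' \<subseteq> J" shows "box (\<lambda>i. min (\<delta> i) (\<delta>' i)) \<subseteq> J"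
proof (rule value_subset[OF J regfrac_box])
  fix z assume z: "z \<in> box (\<lambda>i. min (\<delta> i) (\<delta>' i))" "z \<in> Units Q"
  have mz: "min (\<delta> i) (\<delta>' i) \<le> val i z" if "i \<in> {1..r}" for i using bspec[OF iffD1[OF box_unit[OF z(2)] z(1)] that] .
  obtain y where y: "y \<in> Units Q" "y \<in> box (\<lambda>i. max (val i z) (\<delta> i))" "\<forall>i\<in>{1..r}. val i y = max (val i z) (\<delta> i)"
    using approx_box[of "\<lambda>i. max (val i z) (\<delta> i)"] by blast
  obtain y' where y': "y' \<in> Units Q" "y' \<in> box (\<lambda>i. max (val i z) (\<delta>' i))" "\<forall>i\<in>{1..r}. val i y' = max (val i z) (\<delta>' i)"
    using approx_box[of "\<lambda>i. max (val i z) (\<delta>' i)"] by blast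
  have "y \<in> J" using box_unit[OF y(1), of \<delta>] y(3) d(1) by auto
  moreover have "y' \<in> J" using box_unit[OF y'(1), of \<delta>'] y'(3) d(2) by auto
  ultimately obtain w where w: "w \<in> J \<inter> Units Q" "\<forall>i\<in>{1..r}. val i w = min (val i y) (val i y')"
    using value_min[OF J _ y(1) _ y'(1)] by blast
  have e: "val i w = val i z" if i: "i \<in> {1..r}" for i
    using w(2) i y(3)[rule_format, OF i] y'(3)[rule_format, OF i] mz[OF i] by auto
  then have "w \<in> box (\<lambda>i. min (\<delta> i) (\<delta>' i))" using box_unit[of w] w(1) mz by simp
  then show "\<exists>h\<in>J \<inter> box (\<lambda>i. min (\<delta> i) (\<delta>' i)) \<inter> Units Q. \<forall>i\<in>{1..r}. val i h = val i z"
    using w(1) e by blast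
qed

section \<open>Conductors and duality\<close>

definition is_cond :: "'a set \<Rightarrow> (nat \<Rightarrow> int) \<Rightarrow> bool" where
  "is_cond J \<gamma> \<longleftrightarrow> box \<gamma> \<subseteq> J \<and> (\<forall>\<delta>. box \<delta> \<subseteq> J \<longrightarrow> (\<forall>i\<in>{1..r}. \<gamma> i \<le> \<delta> i))"

text \<open>A bound with minimal coordinate sum is least, since otherwise \<open>box_min\<close>
  would produce a smaller one. K lies below all candidates, so \<open>nat\<close> truncates
  nothing.\<close>

lemma ex_cond: assumes J: "regfrac J" shows "\<exists>\<gamma>\<in>int_vectors r. is_cond J \<gamma>"
proof -
  obtain K where K: "J \<subseteq> box (\<lambda>_. K)" using regfrac_upper[OF J] by blast
  obtain N where N: "box (\<lambda>_. N) \<subseteq> J" using regfrac_lower[OF J] by blast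
  have low: "K \<le> \<delta> i" if d: "box \<delta> \<subseteq> J" and i: "i \<in> {1..r}" for \<delta> i
  proof -
    obtain z where z: "z \<in> Units Q" "z \<in> box \<delta>" "\<forall>i\<in>{1..r}. val i z = \<delta> i" using approx_box[of \<delta>] by blast
    then have "z \<in> box (\<lambda>_. K)" using d K by blast
    then show ?thesis using box_unit[OF z(1), of "\<lambda>_. K"] z(3)[rule_format, OF i] i by fastforce
  qed
  define m where "m \<delta> = (\<Sum>i\<in>{1..r}. nat (\<delta> i - K))" for \<delta>
  obtain \<gamma> where g: "box \<gamma> \<subseteq> J" and gm: "\<And>\<delta>. box \<delta> \<subseteq> J \<Longrightarrow> m \<gamma> \<le> m \<delta>"
    using ex_has_least_nat[of "\<lambda>\<delta>. box \<delta> \<subseteq> J" "\<lambda>_. N" m] N by blast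
  have least: "\<gamma> i \<le> \<delta> i" if d: "box \<delta> \<subseteq> J" and i: "i \<in> {1..r}" for \<delta> i
  proof (rule ccontr)
    assume "\<not> \<gamma> i \<le> \<delta> i"
    then have lt: "\<delta> i < \<gamma> i" by simp
    let ?e = "\<lambda>i. min (\<gamma> i) (\<delta> i)"
    have "m ?e < m \<gamma>"
      unfolding m_def
    proof (rule sum_strict_mono_ex1)
      show "\<forall>j\<in>{1..r}. nat (?e j - K) \<le> nat (\<gamma> j - K)" by auto
      show "\<exists>j\<in>{1..r}. nat (?e j - K) < nat (\<gamma> j - K)" using i lt low[OF d i] by (intro bexI[of _ i]) auto
    qed simp
    then show False using gm[OF box_min[OF J g d]] by simp
  qed
  define \<gamma>' where "\<gamma>' = (\<lambda>i\<in>{1..r}. \<gamma> i)"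
  have "box \<gamma>' = box \<gamma>" by (rule box_cong) (simp add: \<gamma>'_def)
  then have "is_cond J \<gamma>'" unfolding is_cond_def using g least by (simp add: \<gamma>'_def)
  moreover have "\<gamma>' \<in> int_vectors r" unfolding \<gamma>'_def int_vectors_def by auto
  ultimately show ?thesis by blast
qed

text \<open>The passage from values to elements is \<open>value_subset\<close>: each unit in the box
  has the same value as some unit of J, which then lies in the box as well.\<close>

lemma conductor_set_iff:
  assumes J: "regfrac J" and d: "\<delta> \<in> int_vectors r"
  shows "\<delta> \<in> valset J \<and> (\<forall>\<nu> :: nat \<Rightarrow> nat. (\<lambda>i\<in>{1..r}. \<delta> i + int (\<nu> i)) \<in> valset J) \<longleftrightarrow> box \<delta> \<subseteq> J"
proof
  have ev: "(\<lambda>i\<in>{1..r}. \<delta> i + int (\<nu> i)) \<in> int_vectors r" for \<nu> :: "nat \<Rightarrow> nat" unfolding int_vectors_def by auto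
  assume *: "\<delta> \<in> valset J \<and> (\<forall>\<nu> :: nat \<Rightarrow> nat. (\<lambda>i\<in>{1..r}. \<delta> i + int (\<nu> i)) \<in> valset J)"
  show "box \<delta> \<subseteq> J"
  proof (rule value_subset[OF J regfrac_box])
    fix z assume z: "z \<in> box \<delta>" "z \<in> Units Q"
    define \<nu> where "\<nu> i = nat (val i z - \<delta> i)" for i
    have n: "\<delta> i + int (\<nu> i) = val i z" if i: "i \<in> {1..r}" for i
      unfolding \<nu>_def using box_unit[OF z(2)] z(1) i by auto
    obtain h where h: "h \<in> J \<inter> Units Q" "\<forall>i\<in>{1..r}. val i h = (\<lambda>i\<in>{1..r}. \<delta> i + int (\<nu> i)) i"
      using * valset_iff[OF ev] by blast
    have e: "val i h = val i z" if i: "i \<in> {1..r}" for i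
    proof -
      have "val i h = (\<lambda>i\<in>{1..r}. \<delta> i + int (\<nu> i)) i" using h(2) i by blast
      also have "\<dots> = val i z" unfolding restrict_def using i n[OF i] by presburger
      finally show ?thesis .
    qed
    then have "h \<in> box \<delta>" using box_unit[of h \<delta>] box_unit[OF z(2), of \<delta>] h(1) z(1) by simp
    then show "\<exists>h\<in>J \<inter> box \<delta> \<inter> Units Q. \<forall>i\<in>{1..r}. val i h = val i z" using h(1) e by blast
  qed
next
  assume B: "box \<delta> \<subseteq> J"
  have *: "\<epsilon> \<in> valset J" if e: "\<epsilon> \<in> int_vectors r" "\<And>i. i \<in> {1..r} \<Longrightarrow> \<delta> i \<le> \<epsilon> i" for \<epsilon>
  proof -
    obtain z where z: "z \<in> Units Q" "z \<in> box \<epsilon>" "\<forall>i\<in>{1..r}. val i z = \<epsilon> i" using approx_box[of \<epsilon>] by blast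
    have "z \<in> J" using box_anti[of \<delta> \<epsilon>] e z(2) B by blast
    then show ?thesis using valset_iff[OF e(1)] z by blast
  qed
  have "(\<lambda>i\<in>{1..r}. \<delta> i + int (\<nu> i)) \<in> valset J" for \<nu> :: "nat \<Rightarrow> nat"
    by (rule *) (auto simp: int_vectors_def)
  then show "\<delta> \<in> valset J \<and> (\<forall>\<nu> :: nat \<Rightarrow> nat. (\<lambda>i\<in>{1..r}. \<delta> i + int (\<nu> i)) \<in> valset J)" using *[OF d] by blast
qed

lemma conductor_is_cond:
  assumes J: "regfrac J" shows "is_cond J (conductor r (valset J))"
proof -
  obtain \<gamma> where g: "\<gamma> \<in> int_vectors r" "is_cond J \<gamma>" using ex_cond[OF J] by blast
  define C where "C = {\<delta> \<in> valset J. \<forall>\<nu> :: nat \<Rightarrow> nat. (\<lambda>i\<in>{1..r}. \<delta> i + int (\<nu> i)) \<in> valset J}"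
  have C: "\<delta> \<in> C \<longleftrightarrow> \<delta> \<in> int_vectors r \<and> box \<delta> \<subseteq> J" for \<delta>
    unfolding C_def using conductor_set_iff[OF J, of \<delta>] valset_int by blast
  have ic: "is_conductor r (valset J) \<delta> \<longleftrightarrow> \<delta> \<in> C \<and> (\<forall>\<epsilon>\<in>C. \<forall>i\<in>{1..r}. \<delta> i \<le> \<epsilon> i)" for \<delta>
    unfolding is_conductor_def C_def Let_def ..
  have "conductor r (valset J) = \<gamma>"
    unfolding conductor_def
  proof (rule the_equality)
    have "\<gamma> \<in> C" using g C unfolding is_cond_def by blast
    moreover have "\<forall>\<epsilon>\<in>C. \<forall>i\<in>{1..r}. \<gamma> i \<le> \<epsilon> i" using g(2) C unfolding is_cond_def by simp
    ultimately show 1: "is_conductor r (valset J) \<gamma>" unfolding ic by blast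
    fix \<delta> assume d: "is_conductor r (valset J) \<delta>"
    have di: "\<delta> \<in> int_vectors r" using d ic C by blast
    have "\<delta> i = \<gamma> i" if "i \<in> {1..r}" for i
    proof (rule order_antisym)
      have "\<delta> \<in> C" "\<gamma> \<in> C" using d 1 unfolding ic by blast+
      then show "\<delta> i \<le> \<gamma> i" "\<gamma> i \<le> \<delta> i" using d 1 that unfolding ic by blast+
    qed
    then show "\<delta> = \<gamma>" using PiE_ext[of \<delta> "{1..r}" "\<lambda>_. UNIV" \<gamma>] di g(1) unfolding int_vectors_def by blast
  qed
  then show ?thesis using g by simp
qed

text \<open>Such an h would allow \<open>c i\<close> to be lowered by one: an element of value
  exactly \<open>c i - 1\<close> at i moves into \<open>box c\<close> after subtracting a multiple
  of h. So the fibers of the value set of J at its Frobenius vector are empty.\<close>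

lemma cond_no_fiber:
  assumes J: "regfrac J" and c: "is_cond J c" and h: "h \<in> J" "h \<in> Units Q" and i: "i \<in> {1..r}"
    and hi: "val i h = c i - 1" and hj: "\<And>j. j \<in> {1..r} - {i} \<Longrightarrow> c j \<le> val j h"
  shows False
proof -
  note Js = regfrac_submod[OF J]
  define c' where "c' = c(i := c i - 1)"
  have "box c' \<subseteq> J"
  proof
    fix z assume z: "z \<in> box c'"
    have zC: "z \<in> carrier Q" using boxD(2)[OF z] .
    obtain N where N: "\<And>i. i \<in> {1..r} \<Longrightarrow> c i \<le> N" using ex_bound[of c] by blast
    obtain s where s: "\<forall>i\<in>{1..r}. s \<in> val_ge i N" "s \<in> carrier Q" "z \<oplus> s \<in> Units Q" using shift_unit[OF zC] by blast
    have "s \<in> box (\<lambda>_. N)" by (rule boxI) (use s in auto)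
    then have sc: "s \<in> box c" using box_anti[of c "\<lambda>_. N"] N by blast
    have cJ: "box c \<subseteq> J" using c unfolding is_cond_def by blast
    have cc: "box c \<subseteq> box c'" by (rule box_anti) (simp add: c'_def)
    define z' where "z' = z \<oplus> s"
    have z'U: "z' \<in> Units Q" and z'C: "z' \<in> carrier Q" unfolding z'_def using s zC by auto
    have z'B: "z' \<in> box c'" unfolding z'_def using submodD(4)[OF box_submod z] sc cc by blast
    have inc: "u \<in> J" if u: "u \<in> box c'" "u \<in> val_ge i (c i)" for u
    proof -
      have "u \<in> box c"
      proof (rule boxI[OF boxD(2)[OF u(1)]])
        fix j assume j: "j \<in> {1..r}"
        show "u \<in> val_ge j (c j)" using boxD(1)[OF u(1) j] u(2) unfolding c'_def by (cases "j = i") auto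
      qed
      then show ?thesis using cJ by blast
    qed
    have "z' \<in> J"
    proof (cases "z' \<in> val_ge i (c i)")
      case True then show ?thesis using inc z'B by blast
    next
      case False
      have "z' \<in> val_ge i (c i - 1)" using boxD(1)[OF z'B i] unfolding c'_def by simp
      then have v: "val i z' = c i - 1" using val_eqI[OF i z'U, of "c i - 1"] False by simp
      obtain a where a: "a \<in> R" "z' \<ominus> a \<otimes> h \<in> val_ge i (c i)" using resid_unit[OF i z'U h(2)] v hi by auto
      have "h \<in> box c'" unfolding box_unit[OF h(2)] c'_def using hi hj by auto
      then have "z' \<ominus> a \<otimes> h \<in> box c'" using submod_diff[OF box_submod R z'B submodD(5)[OF box_submod a(1)]] by blast
      then have "z' \<ominus> a \<otimes> h \<in> J" using inc a by blast
      then show ?thesis using submod_cancel_diff[OF Js R submodD(5)[OF Js a(1) h(1)] z'C] by blast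
    qed
    moreover have "s \<in> J" using sc cJ by blast
    ultimately show "z \<in> J" using submod_cancel[OF Js R, of s z] zC a_comm[OF zC s(2)] unfolding z'_def by simp
  qed
  then have "c i \<le> c' i" using c i unfolding is_cond_def by blast
  then show False unfolding c'_def by simp
qed

text \<open>If a unit w multiplies \<open>box \<alpha>\<close> into J, then J contains the box at
  v(w) + \<alpha>, and leastness of c gives v(w) \<ge> c - \<alpha>. Other elements are first
  shifted to units.\<close>

lemma colon_box:
  assumes J: "regfrac J" and c: "is_cond J c"
  shows "ideal_colon Q J (box \<alpha>) = box (\<lambda>i. c i - \<alpha> i)"
proof
  note Js = regfrac_submod[OF J]
  have cJ: "box c \<subseteq> J" using c unfolding is_cond_def by blast
  show "box (\<lambda>i. c i - \<alpha> i) \<subseteq> ideal_colon Q J (box \<alpha>)"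
  proof
    fix y assume y: "y \<in> box (\<lambda>i. c i - \<alpha> i)"
    have "y \<otimes> b \<in> J" if "b \<in> box \<alpha>" for b
      using box_mult[OF y that] cJ by auto
    then show "y \<in> ideal_colon Q J (box \<alpha>)" unfolding colon_iff using boxD(2)[OF y] by blast
  qed
  show "ideal_colon Q J (box \<alpha>) \<subseteq> box (\<lambda>i. c i - \<alpha> i)"
  proof
    fix y assume yc: "y \<in> ideal_colon Q J (box \<alpha>)"
    obtain N where N: "\<And>i. i \<in> {1..r} \<Longrightarrow> c i - \<alpha> i \<le> N" using ex_bound[of "\<lambda>i. c i - \<alpha> i"] by blast
    have yC: "y \<in> carrier Q" using yc colon_iff by blast
    obtain s where s: "\<forall>i\<in>{1..r}. s \<in> val_ge i N" "s \<in> carrier Q" "y \<oplus> s \<in> Units Q" using shift_unit[OF yC] by blast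
    have "s \<in> box (\<lambda>_. N)" by (rule boxI) (use s in auto)
    then have sB: "s \<in> box (\<lambda>i. c i - \<alpha> i)" using box_anti[of "\<lambda>i. c i - \<alpha> i" "\<lambda>_. N"] N by blast
    define w where "w = y \<oplus> s"
    have wU: "w \<in> Units Q" and wC: "w \<in> carrier Q" unfolding w_def using s yC by auto
    have wJ: "w \<otimes> b \<in> J" if b: "b \<in> box \<alpha>" for b
    proof -
      have "w \<otimes> b = y \<otimes> b \<oplus> s \<otimes> b" unfolding w_def using yC s(2) boxD(2)[OF b] by (simp add: l_distr)
      moreover have "s \<otimes> b \<in> J" using box_mult[OF sB b] cJ by auto
      ultimately show ?thesis using submodD(4)[OF Js] yc b unfolding colon_iff by simp
    qed
    have "box (\<lambda>i. val i w + \<alpha> i) \<subseteq> J"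
    proof
      fix u assume u: "u \<in> box (\<lambda>i. val i w + \<alpha> i)"
      have "inv w \<in> box (\<lambda>i. - val i w)" using box_unit[OF Units_inv_Units[OF wU]] val_inv[OF _ wU] by simp
      from box_mult[OF this u] have "inv w \<otimes> u \<in> box \<alpha>" by simp
      from wJ[OF this] show "u \<in> J" using wU wC boxD(2)[OF u] by (simp add: m_assoc[symmetric])
    qed
    then have "\<forall>i\<in>{1..r}. c i \<le> val i w + \<alpha> i" using c unfolding is_cond_def by blast
    then have "w \<in> box (\<lambda>i. c i - \<alpha> i)" using box_unit[OF wU] by fastforce
    then show "y \<in> box (\<lambda>i. c i - \<alpha> i)"
      using submod_cancel[OF box_submod R sB yC] a_comm[OF yC s(2)] unfolding w_def by simp
  qed
qed

text \<open>The Frobenius vector is c - (1, ..., 1), so over the integers being strictly above it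
  minus \<beta> means being at least c - \<beta>.\<close>

lemma fibers_empty_iff:
  assumes c: "c = conductor r (valset J)"
  shows "fibers r (valset I) (\<lambda>i\<in>{1..r}. frobenius_vector r (valset J) i - \<beta> i) = {} \<longleftrightarrow>
    (\<forall>h\<in>I \<inter> Units Q. \<forall>i\<in>{1..r}. \<not> (val i h = c i - 1 - \<beta> i \<and> (\<forall>j\<in>{1..r} - {i}. c j - \<beta> j \<le> val j h)))"
proof -
  let ?\<alpha> = "\<lambda>i\<in>{1..r}. frobenius_vector r (valset J) i - \<beta> i"
  have al: "?\<alpha> i = c i - 1 - \<beta> i" if "i \<in> {1..r}" for i using that unfolding frobenius_vector_def c by simp
  have "valvec h \<in> fiber r (valset I) ?\<alpha> i \<longleftrightarrow> val i h = c i - 1 - \<beta> i \<and> (\<forall>j\<in>{1..r} - {i}. c j - \<beta> j \<le> val j h)"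
    if h: "h \<in> I \<inter> Units Q" and i: "i \<in> {1..r}" for h i
  proof -
    have "valvec h \<in> valset I" using h unfolding valset_def by blast
    moreover have "valvec h j = val j h" if "j \<in> {1..r}" for j using that unfolding valvec_def by simp
    moreover have "?\<alpha> j < val j h \<longleftrightarrow> c j - \<beta> j \<le> val j h" if "j \<in> {1..r}" for j using al[OF that] by linarith
    ultimately show ?thesis unfolding fiber_def mem_Collect_eq using al[OF i] i by auto
  qed
  note f = this
  have "fibers r (valset I) ?\<alpha> = {} \<longleftrightarrow> (\<forall>\<epsilon>\<in>valset I. \<forall>i\<in>{1..r}. \<epsilon> \<notin> fiber r (valset I) ?\<alpha> i)"
    unfolding fibers_def fiber_def by blast
  also have "\<dots> \<longleftrightarrow> (\<forall>h\<in>I \<inter> Units Q. \<forall>i\<in>{1..r}. valvec h \<notin> fiber r (valset I) ?\<alpha> i)"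
    unfolding valset_def by blast
  finally show ?thesis using f by simp
qed

text \<open>An empty fiber means that \<open>I \<inter> {v \<ge> c - \<beta>}\<close> does not grow when one coordinate of the bound is
  lowered. Dually \<open>(J : I) + {v \<ge> \<beta>}\<close> does not shrink when that coordinate of \<open>\<beta>\<close> is raised, so
  \<open>J : I\<close> reaches \<open>\<beta>\<close> in each coordinate separately.\<close>

lemma canonical_imp_value_duality:
  assumes J: "regfrac J" and can: "\<And>I. regfrac I \<Longrightarrow> ideal_colon Q J (ideal_colon Q J I) = I" and I: "regfrac I"
    and c: "is_cond J c" and b: "\<beta> \<in> int_vectors r"
  shows "\<beta> \<in> valset (ideal_colon Q J I) \<longleftrightarrow>
    (\<forall>h\<in>I \<inter> Units Q. \<forall>i\<in>{1..r}. \<not> (val i h = c i - 1 - \<beta> i \<and> (\<forall>j\<in>{1..r} - {i}. c j - \<beta> j \<le> val j h)))"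
proof
  assume "\<beta> \<in> valset (ideal_colon Q J I)"
  then obtain z where z: "z \<in> ideal_colon Q J I" "z \<in> Units Q" "\<forall>i\<in>{1..r}. val i z = \<beta> i" using valset_iff[OF b] by blast
  show "\<forall>h\<in>I \<inter> Units Q. \<forall>i\<in>{1..r}. \<not> (val i h = c i - 1 - \<beta> i \<and> (\<forall>j\<in>{1..r} - {i}. c j - \<beta> j \<le> val j h))"
  proof (intro ballI notI)
    fix h i assume h: "h \<in> I \<inter> Units Q" and i: "i \<in> {1..r}"
      and f: "val i h = c i - 1 - \<beta> i \<and> (\<forall>j\<in>{1..r} - {i}. c j - \<beta> j \<le> val j h)"
    have zh: "z \<otimes> h \<in> J" "z \<otimes> h \<in> Units Q" using z h unfolding colon_iff by auto
    have v: "val j (z \<otimes> h) = \<beta> j + val j h" if "j \<in> {1..r}" for j using val_mult[OF that z(2)] h z(3) that by simp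
    show False
    proof (rule cond_no_fiber[OF J c zh i])
      show "val i (z \<otimes> h) = c i - 1" using v[OF i] f by simp
      fix j assume j: "j \<in> {1..r} - {i}"
      then have "c j - \<beta> j \<le> val j h" using f by blast
      then show "c j \<le> val j (z \<otimes> h)" using v[of j] j by simp
    qed
  qed
next
  assume f: "\<forall>h\<in>I \<inter> Units Q. \<forall>i\<in>{1..r}. \<not> (val i h = c i - 1 - \<beta> i \<and> (\<forall>j\<in>{1..r} - {i}. c j - \<beta> j \<le> val j h))"
  let ?K = "ideal_colon Q J I"
  note Kr = regfrac_colon[OF J I]
  have dual: "msum ?K (box (\<lambda>i. c i - \<alpha> i)) = ideal_colon Q J (I \<inter> box \<alpha>)" for \<alpha>
  proof -
    let ?S = "msum ?K (box (\<lambda>i. c i - \<alpha> i))"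
    have S: "regfrac ?S" using regfrac_msum[OF Kr regfrac_box] .
    note km = regfrac_submod[OF Kr] and bm = box_submod[of "\<lambda>i. c i - \<alpha> i"]
    \<comment> \<open>The colon of a sum is an intersection, which biduality and
      \<open>colon_box\<close> evaluate to I \<inter> \<open>box \<alpha>\<close>. Taking the colon
      once more recovers the sum.\<close>
    have "ideal_colon Q J ?S = ideal_colon Q J ?K \<inter> ideal_colon Q J (box (\<lambda>i. c i - \<alpha> i))"
    proof
      show "ideal_colon Q J ?S \<subseteq> ideal_colon Q J ?K \<inter> ideal_colon Q J (box (\<lambda>i. c i - \<alpha> i))"
        using msum_ge1[OF km bm] msum_ge2[OF km bm] unfolding ideal_colon_def by blast
      show "ideal_colon Q J ?K \<inter> ideal_colon Q J (box (\<lambda>i. c i - \<alpha> i)) \<subseteq> ideal_colon Q J ?S"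
      proof
        fix y assume y: "y \<in> ideal_colon Q J ?K \<inter> ideal_colon Q J (box (\<lambda>i. c i - \<alpha> i))"
        then have ya: "y \<in> ideal_colon Q J ?K" and yb: "y \<in> ideal_colon Q J (box (\<lambda>i. c i - \<alpha> i))" by auto
        have yC: "y \<in> carrier Q" using ya colon_iff by blast
        have y1: "y \<otimes> a \<in> J" if "a \<in> ?K" for a using ya that colon_iff[of y J ?K] by blast
        have y2: "y \<otimes> a \<in> J" if "a \<in> box (\<lambda>i. c i - \<alpha> i)" for a using yb that colon_iff[of y J "box (\<lambda>i. c i - \<alpha> i)"] by blast
        have "y \<otimes> u \<in> J" if u: "u \<in> ?S" for u
        proof -
          obtain a b where ab: "a \<in> ?K" "b \<in> box (\<lambda>i. c i - \<alpha> i)" "u = a \<oplus> b" using u by (rule msumE)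
          have "y \<otimes> u = y \<otimes> a \<oplus> y \<otimes> b" unfolding ab(3) using yC submodD(2)[OF km ab(1)] boxD(2)[OF ab(2)] by (simp add: r_distr)
          then show ?thesis using submodD(4)[OF regfrac_submod[OF J] y1[OF ab(1)] y2[OF ab(2)]] by simp
        qed
        then show "y \<in> ideal_colon Q J ?S" unfolding colon_iff using yC by blast
      qed
    qed
    also have "\<dots> = I \<inter> box \<alpha>" using can[OF I] colon_box[OF J c] by simp
    finally show ?thesis using can[OF S] by simp
  qed
  define \<alpha> where "\<alpha> i = c i - \<beta> i" for i
  have same: "I \<inter> box (\<alpha>(i := \<alpha> i - 1)) = I \<inter> box \<alpha>" if i: "i \<in> {1..r}" for i
  proof
    have "box \<alpha> \<subseteq> box (\<alpha>(i := \<alpha> i - 1))" by (rule box_anti) simp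
    then show "I \<inter> box \<alpha> \<subseteq> I \<inter> box (\<alpha>(i := \<alpha> i - 1))" by blast
    show "I \<inter> box (\<alpha>(i := \<alpha> i - 1)) \<subseteq> I \<inter> box \<alpha>"
    proof
      fix y assume y: "y \<in> I \<inter> box (\<alpha>(i := \<alpha> i - 1))"
      then have yj: "y \<in> val_ge j ((\<alpha>(i := \<alpha> i - 1)) j)" if "j \<in> {1..r}" for j using boxD(1)[of y _ j] that by blast
      have "y \<in> val_ge i (\<alpha> i)"
      proof (rule ccontr)
        assume n: "y \<notin> val_ge i (\<alpha> i)"
        obtain K where K: "\<And>i. i \<in> {1..r} \<Longrightarrow> \<alpha> i \<le> K" using ex_bound[of \<alpha>] by blast
        obtain h where h: "h \<in> I \<inter> Units Q" "\<forall>i\<in>{1..r}. \<forall>k\<le>K. h \<in> val_ge i k \<longleftrightarrow> y \<in> val_ge i k"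
          using lift_unit[OF I, of y K] y by blast
        have hU: "h \<in> Units Q" using h by blast
        have "h \<in> val_ge i (\<alpha> i - 1)" using h(2) K[OF i] yj[OF i] i by simp
        moreover have "h \<notin> val_ge i (\<alpha> i)" using h(2) K[OF i] n i by simp
        ultimately have "val i h = \<alpha> i - 1" using val_eqI[OF i hU, of "\<alpha> i - 1"] by simp
        then have "val i h = c i - 1 - \<beta> i" unfolding \<alpha>_def by simp
        moreover have "c j - \<beta> j \<le> val j h" if j: "j \<in> {1..r} - {i}" for j
        proof -
          have "y \<in> val_ge j (\<alpha> j)" using yj[of j] j by simp
          then have "h \<in> val_ge j (\<alpha> j)" using h(2) K[of j] j by blast
          then show ?thesis using val_ge_unit[of j h "\<alpha> j"] hU j unfolding \<alpha>_def by blast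
        qed
        ultimately show False using f h(1) i by blast
      qed
      then have "y \<in> val_ge j (\<alpha> j)" if "j \<in> {1..r}" for j using yj[OF that] by (cases "j = i") auto
      then show "y \<in> I \<inter> box \<alpha>" using y boxI[of y \<alpha>] boxD(2)[of y] by blast
    qed
  qed
  obtain z where z: "z \<in> Units Q" "z \<in> box \<beta>" "\<forall>i\<in>{1..r}. val i z = \<beta> i" using approx_box[of \<beta>] by blast
  have "\<exists>w\<in>?K \<inter> Units Q. \<forall>i\<in>{1..r}. val i w = \<beta> i"
  proof (rule value_combine[OF Kr])
    fix i assume i: "i \<in> {1..r}"
    let ?\<beta>' = "\<beta>(i := \<beta> i + 1)"
    have 1: "box (\<lambda>i. c i - \<alpha> i) = box \<beta>" by (rule box_cong) (simp add: \<alpha>_def)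
    have 2: "box (\<lambda>j. c j - (\<alpha>(i := \<alpha> i - 1)) j) = box ?\<beta>'" by (rule box_cong) (simp add: \<alpha>_def)
    have "msum ?K (box \<beta>) = msum ?K (box ?\<beta>')"
      using dual[of \<alpha>] dual[of "\<alpha>(i := \<alpha> i - 1)"] same[OF i] unfolding 1 2 by simp
    \<comment> \<open>z has value exactly \<beta> and w is larger at i, so y = z - w has value
      \<open>\<beta> i\<close> at i and at least \<beta> elsewhere.\<close>
    then have "z \<in> msum ?K (box ?\<beta>')" using msum_ge2[OF regfrac_submod[OF Kr] box_submod, of \<beta>] z(2) by blast
    then obtain y w where y: "y \<in> ?K" "w \<in> box ?\<beta>'" "z = y \<oplus> w" by (rule msumE)
    have C: "y \<in> carrier Q" "w \<in> carrier Q" "z \<in> carrier Q" using submodD(2)[OF regfrac_submod[OF Kr] y(1)] boxD(2)[OF y(2)] z(1) by auto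
    have yz: "y = z \<oplus> \<ominus> w" unfolding y(3) using C by algebra
    have mw: "\<ominus> w \<in> box ?\<beta>'" using submod_minus[OF box_submod R y(2)] .
    have "box ?\<beta>' \<subseteq> box \<beta>" by (rule box_anti) simp
    then have "\<ominus> w \<in> box \<beta>" using mw by blast
    then have yB: "y \<in> box \<beta>" unfolding yz using submodD(4)[OF box_submod z(2)] by blast
    have "\<ominus> w \<in> val_ge i (\<beta> i + 1)" using boxD(1)[OF mw i] by simp
    then have yi: "y \<in> val_ge i (\<beta> i) \<and> y \<notin> val_ge i (\<beta> i + 1)"
      unfolding yz using val_ge_exact_add[OF i, of z "\<beta> i"] unit_exact[OF i z(1)] z(3)[rule_format, OF i] by auto
    obtain K where K: "\<And>i. i \<in> {1..r} \<Longrightarrow> \<beta> i + 1 \<le> K" using ex_bound[of "\<lambda>i. \<beta> i + 1"] by blast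
    obtain h where h: "h \<in> ?K \<inter> Units Q" "\<forall>i\<in>{1..r}. \<forall>k\<le>K. h \<in> val_ge i k \<longleftrightarrow> y \<in> val_ge i k"
      using lift_unit[OF Kr y(1), of K] by blast
    have hU: "h \<in> Units Q" using h by blast
    have "val i h = \<beta> i" using val_eqI[OF i hU, of "\<beta> i"] h(2) K[OF i] yi i by simp
    moreover have "\<beta> j \<le> val j h" if j: "j \<in> {1..r}" for j
    proof -
      have "\<beta> j \<le> K" using K[OF j] by simp
      then have "h \<in> val_ge j (\<beta> j)" using h(2) boxD(1)[OF yB j] j by blast
      then show ?thesis using val_ge_unit[OF j hU] by blast
    qed
    ultimately show "\<exists>y\<in>?K \<inter> Units Q. val i y = \<beta> i \<and> (\<forall>j\<in>{1..r}. \<beta> j \<le> val j y)" using h(1) by blast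
  qed
  then show "\<beta> \<in> valset ?K" using valset_iff[OF b] by blast
qed

text \<open>For a value \<open>\<alpha>\<close> outside \<open>valset I\<close> take \<open>\<delta>\<close> minimal with \<open>\<delta>\<^sub>i = \<alpha>\<^sub>i\<close>, \<open>\<delta>\<^sub>j < \<alpha>\<^sub>j\<close> for \<open>j \<noteq> i\<close> and empty
  \<open>i\<close>-th fiber. By the exchange property all fibers of \<open>valset I\<close> at \<open>\<delta>\<close> are empty, hence \<open>f - \<delta>\<close> is a
  value of \<open>J : I\<close>, which excludes \<open>\<alpha>\<close> as a value of \<open>J : (J : I)\<close>.\<close>

lemma value_duality_imp_canonical:
  assumes J: "regfrac J" and c: "is_cond J c" and I: "regfrac I"
    and dual: "\<And>\<beta>. \<beta> \<in> int_vectors r \<Longrightarrow>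
      (\<forall>h\<in>I \<inter> Units Q. \<forall>i\<in>{1..r}. \<not> (val i h = c i - 1 - \<beta> i \<and> (\<forall>j\<in>{1..r} - {i}. c j - \<beta> j \<le> val j h))) \<Longrightarrow>
      \<beta> \<in> valset (ideal_colon Q J I)"
  shows "ideal_colon Q J (ideal_colon Q J I) = I"
proof
  note Is = regfrac_submod[OF I]
  show sub: "I \<subseteq> ideal_colon Q J (ideal_colon Q J I)"
  proof
    fix y assume y: "y \<in> I"
    have "y \<otimes> b \<in> J" if b: "b \<in> ideal_colon Q J I" for b
      using b y m_comm[of b y] submodD(2)[OF Is y] unfolding colon_iff by auto
    then show "y \<in> ideal_colon Q J (ideal_colon Q J I)"
      using colon_iff[of y J "ideal_colon Q J I"] submodD(2)[OF Is y] by blast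
  qed
  show "ideal_colon Q J (ideal_colon Q J I) \<subseteq> I"
  proof (rule value_subset[OF I regfrac_colon[OF J regfrac_colon[OF J I]]], rule ccontr)
    fix z assume z: "z \<in> ideal_colon Q J (ideal_colon Q J I)" "z \<in> Units Q"
      and "\<not> (\<exists>h\<in>I \<inter> ideal_colon Q J (ideal_colon Q J I) \<inter> Units Q. \<forall>i\<in>{1..r}. val i h = val i z)"
    then have no: "\<not> (\<exists>h\<in>I \<inter> Units Q. \<forall>i\<in>{1..r}. val i h = val i z)" using sub by blast
    define \<alpha> where "\<alpha> i = val i z" for i
    \<comment> \<open>If each coordinate of \<alpha> were attained separately,
      \<open>value_combine\<close> would attain \<alpha> itself.\<close>
    obtain i where i: "i \<in> {1..r}" and noi: "\<not> (\<exists>h\<in>I \<inter> Units Q. val i h = \<alpha> i \<and> (\<forall>j\<in>{1..r}. \<alpha> j \<le> val j h))"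
      using value_combine[OF I, of \<alpha>] no unfolding \<alpha>_def by blast
    obtain K where K: "I \<subseteq> box (\<lambda>_. K)" using regfrac_upper[OF I] by blast
    have low: "K \<le> val j h" if h: "h \<in> I \<inter> Units Q" and j: "j \<in> {1..r}" for h j
      using box_unit[of h "\<lambda>_. K"] K h j by blast
    define P where "P \<delta> \<longleftrightarrow> \<delta> i = \<alpha> i \<and> (\<forall>j\<in>{1..r} - {i}. \<delta> j < \<alpha> j) \<and>
      (\<forall>h\<in>I \<inter> Units Q. \<not> (val i h = \<alpha> i \<and> (\<forall>j\<in>{1..r} - {i}. \<delta> j < val j h)))" for \<delta>
    \<comment> \<open>K bounds the values of I from below. The added 1 makes the sum drop even when
      a coordinate equal to K is lowered; the coordinate lowered below is a value of an element of
      I, hence at least K.\<close>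
    define m where "m \<delta> = (\<Sum>j\<in>{1..r}. nat (\<delta> j - K + 1))" for \<delta> :: "nat \<Rightarrow> int"
    have "P (\<lambda>j. if j = i then \<alpha> j else \<alpha> j - 1)"
      unfolding P_def
    proof (intro conjI ballI notI)
      fix h assume h: "h \<in> I \<inter> Units Q"
        and f: "val i h = \<alpha> i \<and> (\<forall>j\<in>{1..r} - {i}. (if j = i then \<alpha> j else \<alpha> j - 1) < val j h)"
      have "\<alpha> j \<le> val j h" if j: "j \<in> {1..r}" for j
      proof (cases "j = i")
        case False
        then have "(if j = i then \<alpha> j else \<alpha> j - 1) < val j h" using f j by blast
        then show ?thesis using False by simp
      qed (use f in simp)
      then show False using noi h f by blast
    qed auto
    then obtain \<delta> where d: "P \<delta>" and dm: "\<And>\<epsilon>. P \<epsilon> \<Longrightarrow> m \<delta> \<le> m \<epsilon>" using ex_has_least_nat[of P _ m] by blast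
    have di: "\<delta> i = \<alpha> i" and dj: "\<And>j. j \<in> {1..r} - {i} \<Longrightarrow> \<delta> j < \<alpha> j"
      and dF: "\<And>h. h \<in> I \<inter> Units Q \<Longrightarrow> val i h = \<alpha> i \<Longrightarrow> (\<And>j. j \<in> {1..r} - {i} \<Longrightarrow> \<delta> j < val j h) \<Longrightarrow> False"
      using d unfolding P_def by blast+
    have F: False if h: "h \<in> I \<inter> Units Q" and k: "k \<in> {1..r}" and hk: "val k h = \<delta> k"
      and hj: "\<And>j. j \<in> {1..r} - {k} \<Longrightarrow> \<delta> j < val j h" for h k
    proof (cases "k = i")
      case True then show False using dF[OF h] hk hj di by simp
    next
      case False
      define \<epsilon> where "\<epsilon> = \<delta>(k := \<delta> k - 1)"
      have "m \<epsilon> < m \<delta>"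
        unfolding m_def
      proof (rule sum_strict_mono_ex1)
        show "\<forall>j\<in>{1..r}. nat (\<epsilon> j - K + 1) \<le> nat (\<delta> j - K + 1)" unfolding \<epsilon>_def by auto
        show "\<exists>j\<in>{1..r}. nat (\<epsilon> j - K + 1) < nat (\<delta> j - K + 1)"
          unfolding \<epsilon>_def using k low[OF h k] hk by (intro bexI[of _ k]) auto
      qed simp
      then have "\<not> P \<epsilon>" using dm by fastforce
      moreover have "\<epsilon> i = \<alpha> i" unfolding \<epsilon>_def using di False by simp
      moreover have "\<forall>j\<in>{1..r} - {i}. \<epsilon> j < \<alpha> j"
      proof
        fix j assume "j \<in> {1..r} - {i}"
        from dj[OF this] show "\<epsilon> j < \<alpha> j" unfolding \<epsilon>_def by (cases "j = k") auto
      qed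
      ultimately obtain h' where h': "h' \<in> I \<inter> Units Q" "val i h' = \<alpha> i" "\<forall>j\<in>{1..r} - {i}. \<epsilon> j < val j h'"
        unfolding P_def by blast
      have h'j: "\<delta> j < val j h'" if "j \<in> {1..r} - {i}" "j \<noteq> k" for j
        using bspec[OF h'(3) that(1)] that(2) unfolding \<epsilon>_def by simp
      have ki: "k \<in> {1..r} - {i}" using k False by blast
      have "\<not> \<delta> k < val k h'"
      proof
        assume a: "\<delta> k < val k h'"
        have "\<delta> j < val j h'" if "j \<in> {1..r} - {i}" for j using h'j[OF that] a by (cases "j = k") auto
        then show False using dF[OF h'(1,2)] by blast
      qed
      moreover have "\<delta> k - 1 < val k h'" using bspec[OF h'(3) ki] unfolding \<epsilon>_def by simp
      ultimately have e: "val k h = val k h'" using hk by simp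
      \<comment> \<open>Minimality of \<delta> produced h', which agrees with h at k. Exchanging
        there gives an element of the i-th fiber at \<delta>, because h' has the smaller value
        \<open>\<alpha> i\<close> at i.\<close>
      obtain w where w: "w \<in> I \<inter> Units Q" "val k h < val k w"
        "\<forall>j\<in>{1..r}. min (val j h) (val j h') \<le> val j w \<and> (val j h \<noteq> val j h' \<longrightarrow> val j w = min (val j h) (val j h'))"
        using value_exchange[OF I _ _ _ _ k e] h h'(1) by blast
      have "\<alpha> i < val i h" using hj[of i] i False di by simp
      then have "val i w = \<alpha> i" using bspec[OF w(3) i] h'(2) by simp
      moreover have "\<delta> j < val j w" if j: "j \<in> {1..r} - {i}" for j
      proof (cases "j = k")
        case True then show ?thesis using w(2) hk by simp
      next
        case False
        then have "\<delta> j < val j h" "\<delta> j < val j h'" using hj[of j] h'j[OF j] j by auto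
        moreover have "min (val j h) (val j h') \<le> val j w" using w(3) j by blast
        ultimately show ?thesis by linarith
      qed
      ultimately show False using dF[OF w(1)] by blast
    qed
    \<comment> \<open>\<beta> is the Frobenius vector minus \<delta>. For g of this value, zg has
      value \<open>c i - 1\<close> at i and, as \<delta> is smaller than \<alpha> off i, at least
      \<open>c j\<close> elsewhere: exactly what \<open>cond_no_fiber\<close> forbids.\<close>
    define \<beta> where "\<beta> = (\<lambda>j\<in>{1..r}. c j - 1 - \<delta> j)"
    have bi: "\<beta> \<in> int_vectors r" unfolding \<beta>_def int_vectors_def by auto
    have bj: "\<beta> j = c j - 1 - \<delta> j" if "j \<in> {1..r}" for j using that unfolding \<beta>_def by simp
    have "\<beta> \<in> valset (ideal_colon Q J I)"
    proof (rule dual[OF bi], intro ballI notI)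
      fix h k assume h: "h \<in> I \<inter> Units Q" and k: "k \<in> {1..r}"
        and f: "val k h = c k - 1 - \<beta> k \<and> (\<forall>j\<in>{1..r} - {k}. c j - \<beta> j \<le> val j h)"
      show False
      proof (rule F[OF h k])
        show "val k h = \<delta> k" using f bj[OF k] by simp
        fix j assume j: "j \<in> {1..r} - {k}"
        then have "c j - \<beta> j \<le> val j h" using f by blast
        then show "\<delta> j < val j h" using bj[of j] j by simp
      qed
    qed
    then obtain g where g: "g \<in> ideal_colon Q J I" "g \<in> Units Q" "\<forall>j\<in>{1..r}. val j g = \<beta> j" using valset_iff[OF bi] by blast
    have zg: "z \<otimes> g \<in> J" "z \<otimes> g \<in> Units Q" using z g colon_iff[of z J "ideal_colon Q J I"] by auto
    have v: "val j (z \<otimes> g) = \<alpha> j + (c j - 1 - \<delta> j)" if j: "j \<in> {1..r}" for j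
      using val_mult[OF j z(2) g(2)] bspec[OF g(3) j] bj[OF j] unfolding \<alpha>_def by simp
    show False
    proof (rule cond_no_fiber[OF J c zg i])
      show "val i (z \<otimes> g) = c i - 1" using v[OF i] di by simp
      fix j assume j: "j \<in> {1..r} - {i}"
      then show "c j \<le> val j (z \<otimes> g)" using v[of j] dj[OF j] by simp
    qed
  qed
qed

theorem canonical_iff_value_duality:
  assumes J: "regfrac J"
  shows "(\<forall>I. regfrac I \<longrightarrow> ideal_colon Q J (ideal_colon Q J I) = I) \<longleftrightarrow>
    (\<forall>I. regfrac I \<longrightarrow> valset (ideal_colon Q J I) =
       {\<beta> \<in> int_vectors r. fibers r (valset I) (\<lambda>i\<in>{1..r}. frobenius_vector r (valset J) i - \<beta> i) = {}})"
proof
  note c = conductor_is_cond[OF J]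
  assume can: "\<forall>I. regfrac I \<longrightarrow> ideal_colon Q J (ideal_colon Q J I) = I"
  show "\<forall>I. regfrac I \<longrightarrow> valset (ideal_colon Q J I) =
       {\<beta> \<in> int_vectors r. fibers r (valset I) (\<lambda>i\<in>{1..r}. frobenius_vector r (valset J) i - \<beta> i) = {}}"
  proof (intro allI impI Set.set_eqI)
    fix I \<beta> assume I: "regfrac I"
    show "\<beta> \<in> valset (ideal_colon Q J I) \<longleftrightarrow>
      \<beta> \<in> {\<beta> \<in> int_vectors r. fibers r (valset I) (\<lambda>i\<in>{1..r}. frobenius_vector r (valset J) i - \<beta> i) = {}}"
    proof (cases "\<beta> \<in> int_vectors r")
      case True
      have can': "ideal_colon Q J (ideal_colon Q J I) = I" if "regfrac I" for I using can that by blast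
      show ?thesis
        unfolding fibers_empty_iff[OF refl] using canonical_imp_value_duality[OF J can' I c True] True by simp
    next
      case False then show ?thesis using valset_int by blast
    qed
  qed
next
  note c = conductor_is_cond[OF J]
  assume dual: "\<forall>I. regfrac I \<longrightarrow> valset (ideal_colon Q J I) =
       {\<beta> \<in> int_vectors r. fibers r (valset I) (\<lambda>i\<in>{1..r}. frobenius_vector r (valset J) i - \<beta> i) = {}}"
  show "\<forall>I. regfrac I \<longrightarrow> ideal_colon Q J (ideal_colon Q J I) = I"
  proof (intro allI impI)
    fix I assume I: "regfrac I"
    show "ideal_colon Q J (ideal_colon Q J I) = I"
    proof (rule value_duality_imp_canonical[OF J c I])
      fix \<beta> assume "\<beta> \<in> int_vectors r" "\<forall>h\<in>I \<inter> Units Q. \<forall>i\<in>{1..r}. \<not> (val i h = conductor r (valset J) i - 1 - \<beta> i \<and>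
        (\<forall>j\<in>{1..r} - {i}. conductor r (valset J) j - \<beta> j \<le> val j h))"
      then have "\<beta> \<in> {\<beta> \<in> int_vectors r. fibers r (valset I) (\<lambda>i\<in>{1..r}. frobenius_vector r (valset J) i - \<beta> i) = {}}"
        unfolding fibers_empty_iff[OF refl] by blast
      then show "\<beta> \<in> valset (ideal_colon Q J I)" using dual I by blast
    qed
  qed
qed

section \<open>Identification with the valuations and fractional ideals of the statement\<close>

lemma valuation_of_V:
  assumes i: "i \<in> {1..r}" and reg: "regular_elements Q = Units Q" and h: "h \<in> Units Q"
  shows "valuation_of Q (V i) h = val i h"
proof -
  note VS = valringD(1)[OF V_valring[OF i]]
  define v where "v = (\<lambda>z\<in>Units Q. val i z)"
  have tU: "unz i \<in> Units Q" using unzU[OF i] .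
  have t1: "val i (unz i) = 1" using valI[OF i Units_one_closed, of "unz i" 1] subringE(3)[OF VS] zpow_1[OF tU] tU by (simp add: Units_closed)
  have V0: "z \<in> V i \<longleftrightarrow> 0 \<le> val i z" if "z \<in> Units Q" for z using val_ge_unit[OF i that, of 0] val_ge_0[OF i] by simp
  have nv: "is_normalized_valuation Q (V i) v"
    unfolding is_normalized_valuation_def reg
  proof (intro conjI ballI impI)
    show "v \<in> extensional (Units Q)" unfolding v_def by simp
    show "v ` Units Q = UNIV"
    proof -
      have "k \<in> v ` Units Q" for k
      proof (rule image_eqI)
        show "k = v (zpow (unz i) k)" unfolding v_def using val_zpi[OF i tU, of k] t1 tU by simp
        show "zpow (unz i) k \<in> Units Q" using tU by simp
      qed
      then show ?thesis by blast
    qed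
  next
    fix y z assume yz: "y \<in> Units Q" "z \<in> Units Q"
    show "v (y \<otimes> z) = v y + v z" unfolding v_def using val_mult[OF i yz] yz by simp
    assume s: "y \<oplus> z \<in> Units Q"
    let ?m = "min (val i y) (val i z)"
    have "y \<in> val_ge i ?m" "z \<in> val_ge i ?m" using val_ge_unit[OF i yz(1)] val_ge_unit[OF i yz(2)] by auto
    then have "y \<oplus> z \<in> val_ge i ?m" using submodD(4)[OF val_ge_submodR[OF i]] by blast
    then show "min (v y) (v z) \<le> v (y \<oplus> z)" unfolding v_def using val_ge_unit[OF i s] yz s by simp
  next
    fix z assume "z \<in> Units Q"
    then show "z \<in> V i \<longleftrightarrow> 0 \<le> v z" unfolding v_def using V0 by simp
  qed
  have "valuation_of Q (V i) = v"
    unfolding valuation_of_def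
  proof (rule the_equality[where P = "is_normalized_valuation Q (V i)", OF nv])
    fix v' assume "is_normalized_valuation Q (V i) v'"
    then have e: "v' \<in> extensional (Units Q)" and surj: "v' ` Units Q = UNIV"
      and mult: "\<And>y z. y \<in> Units Q \<Longrightarrow> z \<in> Units Q \<Longrightarrow> v' (y \<otimes> z) = v' y + v' z"
      and pos: "\<And>z. z \<in> Units Q \<Longrightarrow> z \<in> V i \<longleftrightarrow> 0 \<le> v' z"
      unfolding is_normalized_valuation_def reg by auto
    have one: "v' \<one> = 0" using mult[of \<one> \<one>] by simp
    have inv: "v' (inv z) = - v' z" if "z \<in> Units Q" for z using mult[OF that Units_inv_Units[OF that]] one that by simp
    have u0: "v' w = 0" if w: "w \<in> Units Q" "w \<in> V i" "inv w \<in> V i" for w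
      using pos[OF w(1)] pos[OF Units_inv_Units[OF w(1)]] inv[OF w(1)] w by simp
    let ?c = "v' (unz i)"
    have nn: "v' (zpow (unz i) (int n)) = int n * ?c" for n
    proof (induction n)
      case (Suc n)
      have "zpow (unz i) (int (Suc n)) = zpow (unz i) (int n) \<otimes> unz i"
        using zpow_nat[OF tU, of n] zpow_nat[OF tU, of "Suc n"] by (simp del: of_nat_Suc)
      then show ?case using mult[OF zpow_Units[OF tU] tU] Suc by (simp add: algebra_simps)
    qed (simp add: one)
    have zpv: "v' (zpow (unz i) k) = k * ?c" for k
    proof (cases "0 \<le> k")
      case True then show ?thesis using nn[of "nat k"] by simp
    next
      case False
      have "v' (zpow (unz i) k) + v' (zpow (unz i) (- k)) = 0"
        using mult[of "zpow (unz i) k" "zpow (unz i) (- k)"] tU zpow_minus[OF tU] one by simp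
      then show ?thesis using nn[of "nat (- k)"] False by simp
    qed
    \<comment> \<open>A normalized valuation with ring \<open>V i\<close> vanishes on the units of
      \<open>V i\<close>, so it is determined by its value on the uniformizer. Surjectivity makes
      that value 1 or -1, and the uniformizer lying in \<open>V i\<close> excludes -1.\<close>
    have dec: "v' z = val i z * ?c" if z: "z \<in> Units Q" for z
    proof -
      obtain w where w: "w \<in> Units Q" "w \<in> V i" "inv w \<in> V i" "z = zpow (unz i) (val i z) \<otimes> w"
        using val_decomp[OF i z] by blast
      have "v' z = v' (zpow (unz i) (val i z)) + v' w" using mult[OF zpow_Units[OF tU] w(1)] w(4) by metis
      then show ?thesis using zpv u0[OF w(1-3)] by simp
    qed
    have "?c \<ge> 0" using pos[OF tU] V0[OF tU] t1 by simp
    moreover obtain z where z: "z \<in> Units Q" "v' z = 1" using surj by (metis UNIV_I imageE)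
    then have "val i z * ?c = 1" using dec by simp
    then have "?c = 1 \<or> ?c = - 1" by (auto simp: zmult_eq_1_iff)
    ultimately have "?c = 1" by linarith
    then have "v' z = v z" if "z \<in> Units Q" for z using dec[OF that] that unfolding v_def by simp
    moreover have "v \<in> extensional (Units Q)" unfolding v_def by simp
    ultimately show "v' = v" using extensionalityI[OF e] by blast
  qed
  then show ?thesis unfolding v_def using h by simp
qed

lemma value_set_eq:
  assumes reg: "regular_elements Q = Units Q" shows "value_set Q r V I = valset I"
  unfolding value_set_def valset_def valvec_def reg
proof (rule image_cong[OF refl])
  fix h assume "h \<in> I \<inter> Units Q"
  then have h: "h \<in> Units Q" by blast
  show "(\<lambda>i\<in>{1..r}. valuation_of Q (V i) h) = (\<lambda>i\<in>{1..r}. val i h)"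
    by (rule restrict_ext) (rule valuation_of_V[OF _ reg h])
qed

lemma regular_fractional_ideal_iff:
  assumes reg: "regular_elements Q = Units Q" "regular_elements (Q\<lparr>carrier := R\<rparr>) = R \<inter> Units Q"
  shows "regular_fractional_ideal Q R I \<longleftrightarrow> regfrac I"
proof
  obtain G where G: "\<And>y. (\<forall>i\<in>{1..r}. y \<in> val_ge i G) \<Longrightarrow> y \<in> R" using conductor_R by blast
  have RB0: "R \<subseteq> box (\<lambda>_. 0)"
  proof
    fix a assume a: "a \<in> R"
    show "a \<in> box (\<lambda>_. 0)" by (rule boxI[OF RC[OF a]]) (use a RV val_ge_0 in blast)
  qed
  have GR: "y \<in> R" if "y \<in> box (\<lambda>_. G)" for y using G boxD(1)[OF that] by blast
  {
    assume "regular_fractional_ideal Q R I"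
    then have I: "submod R I" and ex: "\<exists>d\<in>R \<inter> Units Q. \<forall>y\<in>I. d \<otimes> y \<in> R" and h: "\<exists>h. h \<in> I \<and> h \<in> Units Q"
      unfolding regular_fractional_ideal_def fractional_ideal_def reg using additive_subgroup_submod[OF R] by blast+
    obtain d where d: "d \<in> R" "d \<in> Units Q" "\<And>y. y \<in> I \<Longrightarrow> d \<otimes> y \<in> R" using ex by blast
    obtain h where h: "h \<in> I" "h \<in> Units Q" using h by blast
    obtain P where P: "\<forall>i\<in>{1..r}. inv h \<in> val_ge i P" using bounded_below[of "inv h"] h by auto
    obtain P' where P': "\<forall>i\<in>{1..r}. inv d \<in> val_ge i P'" using bounded_below[of "inv d"] d by auto
    have hP: "inv h \<in> box (\<lambda>_. P)" by (rule boxI) (use P h in auto)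
    have dP: "inv d \<in> box (\<lambda>_. P')" by (rule boxI) (use P' d in auto)
    have "box (\<lambda>_. G - P) \<subseteq> I"
    proof
      fix y assume y: "y \<in> box (\<lambda>_. G - P)"
      have "y \<otimes> inv h \<in> R" using GR[of "y \<otimes> inv h"] box_mult[OF y hP] by simp
      then have "(y \<otimes> inv h) \<otimes> h \<in> I" using submodD(5)[OF I _ h(1)] by blast
      then show "y \<in> I" using boxD(2)[OF y] h by (simp add: m_assoc Units_closed)
    qed
    moreover have "I \<subseteq> box (\<lambda>_. P')"
    proof
      fix y assume y: "y \<in> I"
      have "d \<otimes> y \<in> box (\<lambda>_. 0)" using d(3)[OF y] RB0 by blast
      from box_mult[OF dP this] have "inv d \<otimes> (d \<otimes> y) \<in> box (\<lambda>_. P')" by simp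
      then show "y \<in> box (\<lambda>_. P')" using d(2) submodD(2)[OF I y] by (simp add: m_assoc[symmetric] Units_closed)
    qed
    ultimately show "regfrac I" unfolding regfrac_def using I by blast
  }
  {
    assume I: "regfrac I"
    note Is = regfrac_submod[OF I]
    obtain K where K: "I \<subseteq> box (\<lambda>_. K)" using regfrac_upper[OF I] by blast
    \<comment> \<open>The bound G puts d into R, and G - K puts dI into R.\<close>
    obtain d where d: "d \<in> Units Q" "\<forall>i\<in>{1..r}. val i d = max G (G - K)" using approx[of "\<lambda>_. max G (G - K)"] by blast
    have dG: "d \<in> box (\<lambda>_. G)" "d \<in> box (\<lambda>_. G - K)" using box_unit[OF d(1)] d(2) by auto
    have "d \<otimes> y \<in> R" if "y \<in> I" for y
      using GR[of "d \<otimes> y"] box_mult[OF dG(2), of y "\<lambda>_. K"] K that by auto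
    then have "\<exists>d\<in>R \<inter> Units Q. \<forall>y\<in>I. d \<otimes> y \<in> R" using GR[OF dG(1)] d(1) by blast
    moreover obtain h where "h \<in> I" "h \<in> Units Q" using regfrac_unit[OF I] by blast
    moreover have "additive_subgroup I Q" "\<forall>a\<in>R. \<forall>y\<in>I. a \<otimes> y \<in> I" using additive_subgroup_submod[OF R] Is by auto
    ultimately show "regular_fractional_ideal Q R I"
      unfolding regular_fractional_ideal_def fractional_ideal_def reg by blast
  }
qed

end

section \<open>Admissible rings\<close>

locale frac_ring = cring Q for Q (structure) +
  fixes R :: "'a set"
  assumes tot: "total_ring_of_fractions Q R"
begin

abbreviation A where "A \<equiv> Q\<lparr>carrier := R\<rparr>"

lemma R: "subring R Q"
  using tot unfolding total_ring_of_fractions_def subcring_def by blast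

lemma RC: "a \<in> R \<Longrightarrow> a \<in> carrier Q"
  using subringE(1)[OF R] by blast

lemma A_cring: "cring A"
  using tot subcring_iff[OF subringE(1)[OF R]] unfolding total_ring_of_fractions_def by simp

lemma reg_unit: "u \<in> Units Q \<Longrightarrow> y \<in> carrier Q \<Longrightarrow> u \<otimes> y = \<zero> \<Longrightarrow> y = \<zero>"
  by (metis Units_closed Units_inv_closed Units_l_inv l_one m_assoc r_null)

lemma reg_A: "regular_elements A = R \<inter> Units Q"
proof
  show "regular_elements A \<subseteq> R \<inter> Units Q"
    using tot unfolding total_ring_of_fractions_def regular_elements_def by auto
  show "R \<inter> Units Q \<subseteq> regular_elements A"
    unfolding regular_elements_def using reg_unit RC by auto
qed

lemma frac: assumes y: "y \<in> carrier Q" shows "\<exists>s\<in>R \<inter> Units Q. y \<otimes> s \<in> R"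
proof -
  obtain a s where a: "a \<in> R" "s \<in> regular_elements A" "y = a \<otimes> inv s"
    using y tot unfolding total_ring_of_fractions_def by auto
  have s: "s \<in> R" "s \<in> Units Q" using a(2) reg_A by auto
  have "y \<otimes> s = a" unfolding a(3) using s RC[OF a(1)] by (simp add: m_assoc Units_closed)
  then show ?thesis using s a(1) by (intro bexI[of _ s]) simp_all
qed

text \<open>With s regular and ys in R, regularity of y passes to ys as an element of R, where it
  means being a unit of Q.\<close>

lemma reg_Q: "regular_elements Q = Units Q"
proof
  show "Units Q \<subseteq> regular_elements Q" unfolding regular_elements_def using reg_unit by auto
  show "regular_elements Q \<subseteq> Units Q"
  proof
    fix y assume y: "y \<in> regular_elements Q"
    then have yC: "y \<in> carrier Q" and yr: "\<And>z. z \<in> carrier Q \<Longrightarrow> y \<otimes> z = \<zero> \<Longrightarrow> z = \<zero>"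
      unfolding regular_elements_def by auto
    obtain s where s: "s \<in> R" "s \<in> Units Q" "y \<otimes> s \<in> R" using frac[OF yC] by blast
    have sC: "s \<in> carrier Q" using s by blast
    have "y \<otimes> s \<in> regular_elements A"
      unfolding regular_elements_def
    proof (simp add: s(3), intro ballI impI)
      fix z assume z: "z \<in> R" "y \<otimes> s \<otimes> z = \<zero>"
      then have "y \<otimes> (s \<otimes> z) = \<zero>" using yC sC RC by (simp add: m_assoc)
      then have "s \<otimes> z = \<zero>" using yr[of "s \<otimes> z"] sC RC[OF z(1)] by simp
      then show "z = \<zero>" using reg_unit[OF s(2) RC[OF z(1)]] by simp
    qed
    then have u: "y \<otimes> s \<in> Units Q" using reg_A by blast
    have "y \<otimes> (s \<otimes> inv (y \<otimes> s)) = \<one>" using u yC sC by (simp add: m_assoc[symmetric])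
    then show "y \<in> Units Q" using Units_iff_inv[OF yC, of "s \<otimes> inv (y \<otimes> s)"] sC u by simp
  qed
qed

text \<open>The union of a chain of ideals of a noetherian ring belongs to the chain, so Zorn's
  lemma gives the maximal condition.\<close>

lemma noetherian_maximal:
  assumes n: "noetherian_ring A" and ne: "F \<noteq> {}" and F: "\<And>N. N \<in> F \<Longrightarrow> submod R N \<and> N \<subseteq> R"
  shows "\<exists>N\<in>F. \<forall>N'\<in>F. N \<subseteq> N' \<longrightarrow> N' = N"
proof (rule subset_Zorn_nonempty[OF ne])
  fix C assume C: "C \<noteq> {}" "subset.chain F C"
  have CF: "C \<subseteq> F" using C(2) unfolding pred_on.chain_def by blast
  have "C \<subseteq> {I. ideal I A}"
  proof
    fix N assume "N \<in> C"
    then show "N \<in> {I. ideal I A}" using F[of N] CF ideal_subring_iff[OF R, of N] by auto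
  qed
  then have "subset.chain {I. ideal I A} C" using C(2) unfolding pred_on.chain_def by blast
  then have "\<Union>C \<in> C" by (rule noetherian_ring.ideal_chain_is_trivial[OF n C(1)])
  then show "\<Union>C \<in> F" using CF by blast
qed

lemma maximal_M:
  assumes l: "local_ring A M"
  shows "submod R M" "M \<subseteq> R" "\<one> \<notin> M"
    "\<And>N. submod R N \<Longrightarrow> N \<subseteq> R \<Longrightarrow> \<one> \<notin> N \<Longrightarrow> (\<And>N'. submod R N' \<Longrightarrow> N' \<subseteq> R \<Longrightarrow> N \<subseteq> N' \<Longrightarrow> N' = N \<or> N' = R) \<Longrightarrow> N = M"
proof -
  have m: "maximalideal M A" using l unfolding local_ring_def by blast
  have i: "ideal M A" "R \<noteq> M" using m maximalideal.axioms(1) maximalideal.I_notcarr by fastforce+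
  show s: "submod R M" "M \<subseteq> R" using i(1) ideal_subring_iff[OF R] by auto
  show "\<one> \<notin> M"
  proof
    assume 1: "\<one> \<in> M"
    have "a \<in> M" if "a \<in> R" for a using submodD(5)[OF s(1) that 1] RC[OF that] by simp
    then show False using i s by blast
  qed
  fix N assume N: "submod R N" "N \<subseteq> R" "\<one> \<notin> N" "\<And>N'. submod R N' \<Longrightarrow> N' \<subseteq> R \<Longrightarrow> N \<subseteq> N' \<Longrightarrow> N' = N \<or> N' = R"
  have "ideal N A" using ideal_subring_iff[OF R] N by simp
  moreover have "R \<noteq> N" using N(3) subringE(3)[OF R] by blast
  ultimately have "maximalideal N A"
    unfolding maximalideal_def maximalideal_axioms_def using N(4) ideal_subring_iff[OF R] by auto
  then show "N = M" using l unfolding local_ring_def by blast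
qed

text \<open>An element that is no unit of R generates a proper ideal; a maximal ideal above it can
  only be M.\<close>

lemma local_unit:
  assumes n: "noetherian_ring A" and l: "local_ring A M" and a: "a \<in> R" "a \<notin> M"
  shows "a \<in> Units Q \<and> inv a \<in> R"
proof -
  have aC: "a \<in> carrier Q" using RC a by blast
  have s: "submod R (scal a R)" "scal a R \<subseteq> R" "a \<in> scal a R"
    using submod_scal[OF R submod_self[OF R] aC] subringE(6)[OF R a(1)] scalI[OF subringE(3)[OF R], of a] aC
    unfolding scal_def by auto
  have "\<one> \<in> scal a R"
  proof (rule ccontr)
    assume no: "\<one> \<notin> scal a R"
    define F where "F = {N. submod R N \<and> scal a R \<subseteq> N \<and> N \<subseteq> R \<and> \<one> \<notin> N}"
    have FI: "N \<in> F \<longleftrightarrow> submod R N \<and> scal a R \<subseteq> N \<and> N \<subseteq> R \<and> \<one> \<notin> N" for N unfolding F_def by blast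
    have "F \<noteq> {}" using FI[of "scal a R"] s no by blast
    then have "\<exists>N\<in>F. \<forall>N'\<in>F. N \<subseteq> N' \<longrightarrow> N' = N" by (rule noetherian_maximal[OF n]) (simp add: FI)
    then obtain N where N: "N \<in> F" "\<forall>N'\<in>F. N \<subseteq> N' \<longrightarrow> N' = N" by blast
    have Nf: "submod R N" "scal a R \<subseteq> N" "N \<subseteq> R" "\<one> \<notin> N" using N(1) FI by auto
    have "N = M"
    proof (rule maximal_M(4)[OF l Nf(1,3,4)])
      fix N' assume N': "submod R N'" "N' \<subseteq> R" "N \<subseteq> N'"
      show "N' = N \<or> N' = R"
      proof (cases "\<one> \<in> N'")
        case True
        have "b \<in> N'" if "b \<in> R" for b using submodD(5)[OF N'(1) that True] RC[OF that] by simp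
        then show ?thesis using N' by blast
      next
        case False
        then have "N' \<in> F" using FI N' Nf by blast
        then show ?thesis using N(2) N'(3) by blast
      qed
    qed
    then show False using a s Nf by blast
  qed
  then obtain b where b: "b \<in> R" "\<one> = a \<otimes> b" by (rule scalE)
  then show ?thesis using Units_iff_inv[OF aC RC[OF b(1)]] by simp
qed

text \<open>A prime \<open>P \<noteq> M\<close> containing a regular \<open>s\<close> would not be minimal: an ideal maximal among those
  avoiding all \<open>s\<^sup>k t\<close> with \<open>t \<notin> P\<close> is a smaller prime.\<close>

lemma prime_dim_one:
  assumes n: "noetherian_ring A" and l: "local_ring A M" and d: "krull_dim A = 1"
    and P: "submod R P" "P \<subseteq> R" "\<one> \<notin> P" "\<And>a b. a \<in> R \<Longrightarrow> b \<in> R \<Longrightarrow> a \<otimes> b \<in> P \<Longrightarrow> a \<in> P \<or> b \<in> P"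
    and s: "s \<in> P" "s \<in> Units Q"
  shows "M \<subseteq> P"
proof (rule ccontr)
  assume nM: "\<not> M \<subseteq> P"
  note Mm = maximal_M[OF l]
  have PM: "P \<subseteq> M"
  proof
    fix a assume a: "a \<in> P"
    show "a \<in> M"
    proof (rule ccontr)
      assume "a \<notin> M"
      then have u: "a \<in> Units Q" "inv a \<in> R" using local_unit[OF n l] a P(2) by auto
      have "inv a \<otimes> a \<in> P" using submodD(5)[OF P(1) u(2) a] .
      then show False using u P(3) by simp
    qed
  qed
  have sR: "s \<in> R" and sC: "s \<in> carrier Q" using s P by auto
  define T where "T = {s [^] k \<otimes> t | (k::nat) t. t \<in> R \<and> t \<notin> P}"
  have TI: "s [^] k \<otimes> t \<in> T" if "t \<in> R" "t \<notin> P" for k :: nat and t unfolding T_def using that by blast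
  have T_mult: "a \<otimes> b \<in> T" if T: "a \<in> T" "b \<in> T" for a b
  proof -
    obtain k t where a: "a = s [^] (k::nat) \<otimes> t" "t \<in> R" "t \<notin> P" using T(1) unfolding T_def by blast
    obtain k' t' where b: "b = s [^] (k'::nat) \<otimes> t'" "t' \<in> R" "t' \<notin> P" using T(2) unfolding T_def by blast
    have "a \<otimes> b = s [^] (k + k') \<otimes> (t \<otimes> t')"
      unfolding a b using sC RC a b by (simp add: nat_pow_mult[symmetric] m_ac)
    moreover have "t \<otimes> t' \<in> R" "t \<otimes> t' \<notin> P" using a b P(4)[of t t'] subringE(6)[OF R] by auto
    ultimately show ?thesis using TI by simp
  qed
  have zT: "\<zero> \<notin> T"
  proof
    assume "\<zero> \<in> T"
    then obtain k t where k: "\<zero> = s [^] (k::nat) \<otimes> t" "t \<in> R" "t \<notin> P" unfolding T_def by blast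
    have "t = \<zero>" using reg_unit[OF Units_pow_closed[OF s(2), of k] RC[OF k(2)]] k(1) by simp
    then show False using k submodD(3)[OF P(1)] by simp
  qed
  define F where "F = {N. submod R N \<and> N \<subseteq> R \<and> N \<inter> T = {}}"
  have FI: "N \<in> F \<longleftrightarrow> submod R N \<and> N \<subseteq> R \<and> N \<inter> T = {}" for N unfolding F_def by blast
  have "submod R {\<zero>}" using RC by (intro submodI) auto
  then have "{\<zero>} \<in> F" using FI zT subringE(2)[OF R] by blast
  then have "F \<noteq> {}" by blast
  then have "\<exists>N\<in>F. \<forall>N'\<in>F. N \<subseteq> N' \<longrightarrow> N' = N" by (rule noetherian_maximal[OF n]) (simp add: FI)
  then obtain N where N: "N \<in> F" "\<forall>N'\<in>F. N \<subseteq> N' \<longrightarrow> N' = N" by blast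
  have Nf: "submod R N" "N \<subseteq> R" "N \<inter> T = {}" using N(1) FI by auto
  have oneT: "\<one> \<in> T" using TI[of \<one> 0] P(3) subringE(3)[OF R] by simp
  have meet: "\<exists>c\<in>N. \<exists>q\<in>R. c \<oplus> a \<otimes> q \<in> T" if a: "a \<in> R" "a \<notin> N" for a
  proof -
    have aR: "submod R (scal a R)" "scal a R \<subseteq> R" "a \<in> scal a R"
      using submod_scal[OF R submod_self[OF R] RC[OF a(1)]] subringE(6)[OF R a(1)] scalI[OF subringE(3)[OF R], of a] RC[OF a(1)]
      unfolding scal_def by auto
    let ?N = "msum N (scal a R)"
    have "a \<in> ?N" using msum_ge2[OF Nf(1) aR(1)] aR(3) by blast
    then have "?N \<noteq> N" using a by blast
    then have "?N \<notin> F" using N(2) msum_ge1[OF Nf(1) aR(1)] by blast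
    then have "?N \<inter> T \<noteq> {}"
      using FI[of ?N] submod_msum[OF R Nf(1) aR(1)] msum_le[OF submod_self[OF R] Nf(2) aR(2)] by blast
    then show ?thesis unfolding msum_def scal_def by blast
  qed
  have Np: "a \<in> N \<or> b \<in> N" if ab: "a \<in> R" "b \<in> R" "a \<otimes> b \<in> N" for a b
  proof (rule ccontr)
    assume "\<not> ?thesis"
    then obtain c q c' q' where c: "c \<in> N" "q \<in> R" "c \<oplus> a \<otimes> q \<in> T" and c': "c' \<in> N" "q' \<in> R" "c' \<oplus> b \<otimes> q' \<in> T"
      using meet[OF ab(1)] meet[OF ab(2)] by blast
    have C: "c \<in> carrier Q" "q \<in> carrier Q" "c' \<in> carrier Q" "q' \<in> carrier Q" "a \<in> carrier Q" "b \<in> carrier Q"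
      using c c' ab Nf RC by auto
    have RR: "c' \<oplus> b \<otimes> q' \<in> R" "a \<otimes> q \<in> R" "q \<otimes> q' \<in> R"
      using c c' ab Nf(2) subringE(6,7)[OF R] by auto
    have "(c \<oplus> a \<otimes> q) \<otimes> (c' \<oplus> b \<otimes> q') = (c' \<oplus> b \<otimes> q') \<otimes> c \<oplus> ((a \<otimes> q) \<otimes> c' \<oplus> (q \<otimes> q') \<otimes> (a \<otimes> b))"
      using C by algebra
    also have "\<dots> \<in> N"
      using submodD(4)[OF Nf(1) submodD(5)[OF Nf(1) RR(1) c(1)] submodD(4)[OF Nf(1) submodD(5)[OF Nf(1) RR(2) c'(1)] submodD(5)[OF Nf(1) RR(3) ab(3)]]] .
    finally show False using T_mult[OF c(3) c'(3)] Nf(3) by blast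
  qed
  have NP: "N \<subseteq> P"
  proof
    fix a assume a: "a \<in> N"
    show "a \<in> P"
    proof (rule ccontr)
      assume "a \<notin> P"
      then have "s [^] (0::nat) \<otimes> a \<in> T" using TI a Nf(2) by blast
      moreover have "a \<in> carrier Q" using a Nf(2) RC by blast
      ultimately have "a \<in> T" by simp
      then show False using a Nf(3) by blast
    qed
  qed
  have sN: "s \<notin> N"
  proof
    assume "s \<in> N"
    moreover have "s \<in> T" using TI[of \<one> 1] P(3) subringE(3)[OF R] sC by simp
    ultimately show False using Nf by blast
  qed
  \<comment> \<open>The two strict inclusions N < P < M already exceed dimension one.\<close>
  define ch where "ch i = (if i = 0 then N else if i = 1 then P else M)" for i :: nat
  have pN: "primeideal N A" unfolding primeideal_subring_iff[OF R] using Nf Np oneT by blast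
  have pP: "primeideal P A" unfolding primeideal_subring_iff[OF R] using P by blast
  have pM: "primeideal M A"
    unfolding primeideal_subring_iff[OF R]
  proof (intro conjI ballI impI)
    fix a b assume ab: "a \<in> R" "b \<in> R" "a \<otimes> b \<in> M"
    show "a \<in> M \<or> b \<in> M"
    proof (cases "a \<in> M")
      case False
      then have u: "a \<in> Units Q" "inv a \<in> R" using local_unit[OF n l] ab by auto
      have "inv a \<otimes> (a \<otimes> b) \<in> M" using submodD(5)[OF Mm(1) u(2) ab(3)] .
      then show ?thesis using u RC[OF ab(2)] by (simp add: m_assoc[symmetric] Units_closed)
    qed simp
  qed (use Mm(1-3) in auto)
  have "(\<forall>i\<le>2. primeideal (ch i) A) \<and> (\<forall>i<2. ch i \<subset> ch (Suc i))"
  proof (intro conjI allI impI)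
    fix i :: nat show "primeideal (ch i) A" unfolding ch_def using pN pP pM by simp
  next
    fix i :: nat assume "i < 2"
    then have "i = 0 \<or> i = 1" by auto
    then show "ch i \<subset> ch (Suc i)" unfolding ch_def using NP sN s PM nM by auto
  qed
  then have "enat 2 \<le> krull_dim A" unfolding krull_dim_def by (intro Sup_upper) blast
  then show False using d by (simp add: one_enat_def)
qed

text \<open>Positive depth gives a non-empty regular sequence in M. Its first element is regular
  modulo the ideal generated by the empty set, that is, modulo zero.\<close>

lemma ex_regular:
  assumes l: "local_ring A M" and d: "depth A M = 1" shows "\<exists>x\<in>M. x \<in> Units Q"
proof -
  interpret A: cring A by (rule A_cring)
  let ?S = "{enat (length xs) | xs. regular_sequence A xs \<and> set xs \<subseteq> M}"
  have "\<exists>k\<in>?S. 0 < k"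
  proof (rule ccontr)
    assume "\<not> ?thesis"
    then have "Sup ?S \<le> 0" by (intro Sup_least) (auto simp: not_less)
    then show False using d unfolding depth_def by simp
  qed
  then obtain xs where xs: "regular_sequence A xs" "set xs \<subseteq> M" "0 < length xs" by (auto simp: zero_enat_def)
  define x where "x = xs ! 0"
  have xM: "x \<in> M" using xs unfolding x_def by (metis nth_mem subsetD)
  have xR: "x \<in> R" using xM maximal_M(2)[OF l] by blast
  have gen: "genideal A {} = {\<zero>}"
    using A.zeroideal A.genideal_minimal[of "{\<zero>}" "{}"] additive_subgroup.zero_closed[OF ideal.axioms(1)[OF A.genideal_ideal[of "{}"]]] by auto
  have reg: "{\<zero>} +>\<^bsub>A\<^esub> x \<in> regular_elements (A Quot {\<zero>})"
    using xs(1,3) unfolding regular_sequence_def Let_def x_def by (force simp: gen)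
  interpret I: ideal "{\<zero>}" A using A.zeroideal by simp
  have z: "submod R {\<zero>}" using RC by (intro submodI) auto
  have "x \<in> regular_elements A"
    unfolding regular_elements_def
  proof (simp add: xR, intro ballI impI)
    fix y assume y: "y \<in> R" "x \<otimes> y = \<zero>"
    have "({\<zero>} +>\<^bsub>A\<^esub> x) \<otimes>\<^bsub>A Quot {\<zero>}\<^esub> ({\<zero>} +>\<^bsub>A\<^esub> y) = {\<zero>} +>\<^bsub>A\<^esub> (x \<otimes>\<^bsub>A\<^esub> y)"
      using I.rcoset_mult_add[of x y] xR y(1) by (simp add: FactRing_def)
    also have "\<dots> = {\<zero>}" using y(2) I.a_rcos_const[of \<zero>] by simp
    finally have e: "({\<zero>} +>\<^bsub>A\<^esub> x) \<otimes>\<^bsub>A Quot {\<zero>}\<^esub> ({\<zero>} +>\<^bsub>A\<^esub> y) = \<zero>\<^bsub>A Quot {\<zero>}\<^esub>"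
      by (simp add: FactRing_def)
    have "{\<zero>} +>\<^bsub>A\<^esub> y \<in> carrier (A Quot {\<zero>})"
      using A.a_rcosetsI[of "{\<zero>}" y] y(1) subringE(2)[OF R] by (simp add: FactRing_def)
    then have "{\<zero>} +>\<^bsub>A\<^esub> y = {\<zero>}" using reg e unfolding regular_elements_def by (auto simp: FactRing_def)
    then have "\<zero> \<oplus> y \<in> {\<zero>}" unfolding a_r_coset_def' by auto
    then show "y = \<zero>" using RC[OF y(1)] by simp
  qed
  then show ?thesis using xM reg_A by blast
qed

section \<open>Powers of the maximal ideal and the completion\<close>

lemma Mp_facts:
  assumes M: "ideal M A"
  shows "submod R (ideal_power A M n)" "ideal_power A M 0 = R"
    "\<And>a b. a \<in> M \<Longrightarrow> b \<in> ideal_power A M n \<Longrightarrow> a \<otimes> b \<in> ideal_power A M (Suc n)"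
    "\<And>N. submod R N \<Longrightarrow> (\<And>a b. a \<in> M \<Longrightarrow> b \<in> ideal_power A M n \<Longrightarrow> a \<otimes> b \<in> N) \<Longrightarrow> ideal_power A M (Suc n) \<subseteq> N"
    "ideal_power A M n \<subseteq> R" "ideal_power A M (Suc n) \<subseteq> ideal_power A M n"
proof -
  interpret A: cring A by (rule A_cring)
  have P0: "ideal_power A M 0 = R" unfolding nat_pow_def by (simp add: ideals_set_def)
  have S: "ideal_power A M (Suc n) = ideal_prod A (ideal_power A M n) M" for n
    unfolding nat_pow_def by (simp add: ideals_set_def)
  have I: "ideal (ideal_power A M n) A" for n
  proof (induction n)
    case 0 then show ?case unfolding P0 using A.oneideal by simp
  next
    case (Suc n) then show ?case unfolding S using A.ideal_prod_is_ideal M by blast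
  qed
  have MR: "M \<subseteq> R" using M ideal_subring_iff[OF R] by simp
  show sm: "submod R (ideal_power A M n)" for n using I ideal_subring_iff[OF R] by simp
  show iR: "ideal_power A M n \<subseteq> R" for n using I ideal_subring_iff[OF R] by simp
  show "ideal_power A M 0 = R" by (rule P0)
  show "a \<otimes> b \<in> ideal_power A M (Suc n)" if "a \<in> M" "b \<in> ideal_power A M n" for a b
  proof -
    have "b \<otimes>\<^bsub>A\<^esub> a \<in> ideal_power A M (Suc n)" unfolding S using ideal_prod.prod[OF that(2,1)] .
    then show ?thesis using m_comm[of a b] that MR iR RC by (simp add: subset_eq)
  qed
  show least: "ideal_power A M (Suc n) \<subseteq> N"
    if N: "submod R N" and h: "\<And>a b. a \<in> M \<Longrightarrow> b \<in> ideal_power A M n \<Longrightarrow> a \<otimes> b \<in> N" for N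
  proof
    fix y assume "y \<in> ideal_power A M (Suc n)"
    then have "y \<in> ideal_prod A (ideal_power A M n) M" unfolding S .
    then show "y \<in> N"
    proof (induction rule: ideal_prod.induct)
      case (prod i j)
      have "i \<in> carrier Q" "j \<in> carrier Q" using prod MR iR RC by auto
      then show ?case using h[OF prod(2,1)] m_comm by simp
    next
      case (sum s t) then show ?case using submodD(4)[OF N] by simp
    qed
  qed
  show "ideal_power A M (Suc n) \<subseteq> ideal_power A M n"
    by (rule least[OF sm]) (use submodD(5)[OF sm] MR in blast)
qed

text \<open>The cosets of \<open>u n\<close> form a compatible family, since consecutive terms agree
  modulo \<open>M^n\<close>. Its e-th power vanishes in every component, so it is nilpotent in the
  completion and hence zero.\<close>

lemma complete_reduced:
  assumes M: "ideal M A" and red: "reduced_ring (adic_completion A M)"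
    and u: "\<And>n. u n \<in> R" "\<And>n. u (Suc n) \<ominus> u n \<in> ideal_power A M n" "\<And>n. u n [^] (e::nat) \<in> ideal_power A M n"
  shows "u n \<in> ideal_power A M n"
proof -
  interpret A: cring A by (rule A_cring)
  let ?P = "ideal_power A M" and ?C = "adic_completion A M"
  note Mp = Mp_facts[OF M]
  have I: "ideal (?P n) A" for n using Mp(1,5) ideal_subring_iff[OF R] by simp
  have upR: "u n [^] (k::nat) \<in> R" for n k by (induction k) (auto simp: subringE(3,6)[OF R] u(1))
  have co: "?P n +>\<^bsub>A\<^esub> a = ?P n +>\<^bsub>A\<^esub> b \<longleftrightarrow> a \<ominus> b \<in> ?P n" if "a \<in> R" "b \<in> R" for n a b
    unfolding coset_subring using coset_eq_iff[OF R Mp(1)] that RC by simp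
  define f where "f n = ?P n +>\<^bsub>A\<^esub> u n" for n
  have fq: "f n \<in> carrier (A Quot ?P n)" for n
    unfolding f_def using A.a_rcosetsI[of "?P n" "u n"] Mp(5)[of n] u(1) by (simp add: FactRing_def)
  have fc: "f n = ?P n <+>\<^bsub>A\<^esub> f (Suc n)" for n
  proof -
    have 1: "?P n +>\<^bsub>A\<^esub> u n = ?P n +>\<^bsub>A\<^esub> u (Suc n)"
    proof -
      have "\<ominus> (u (Suc n) \<ominus> u n) \<in> ?P n" using submod_minus[OF Mp(1) R u(2)] .
      moreover have "\<ominus> (u (Suc n) \<ominus> u n) = u n \<ominus> u (Suc n)" using RC[OF u(1)[of n]] RC[OF u(1)[of "Suc n"]] by algebra
      ultimately show ?thesis using co[OF u(1) u(1)] by simp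
    qed
    \<comment> \<open>The transition map enlarges the coset at level n + 1: adding
      \<open>M^n\<close> absorbs \<open>M^(n+1)\<close>.\<close>
    have "?P n <+>\<^bsub>A\<^esub> f (Suc n) = ?P n +>\<^bsub>A\<^esub> u (Suc n)"
    proof
      show "?P n <+>\<^bsub>A\<^esub> f (Suc n) \<subseteq> ?P n +>\<^bsub>A\<^esub> u (Suc n)"
      proof
        fix y assume "y \<in> ?P n <+>\<^bsub>A\<^esub> f (Suc n)"
        then obtain a b where ab: "a \<in> ?P n" "b \<in> ?P (Suc n)" "y = a \<oplus> (b \<oplus> u (Suc n))"
          unfolding f_def set_add_def' a_r_coset_def' by auto
        have "a \<oplus> b \<in> ?P n" using submodD(4)[OF Mp(1) ab(1)] ab(2) Mp(6)[of n] by blast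
        moreover have "y = (a \<oplus> b) \<oplus> u (Suc n)"
          unfolding ab(3) using a_assoc[OF submodD(2)[OF Mp(1) ab(1)] submodD(2)[OF Mp(1) ab(2)] RC[OF u(1)]] by simp
        ultimately show "y \<in> ?P n +>\<^bsub>A\<^esub> u (Suc n)" unfolding a_r_coset_def' by auto
      qed
      show "?P n +>\<^bsub>A\<^esub> u (Suc n) \<subseteq> ?P n <+>\<^bsub>A\<^esub> f (Suc n)"
      proof
        fix y assume "y \<in> ?P n +>\<^bsub>A\<^esub> u (Suc n)"
        then obtain a where a: "a \<in> ?P n" "y = a \<oplus> u (Suc n)" unfolding a_r_coset_def' by auto
        have "y = a \<oplus> (\<zero> \<oplus> u (Suc n))" using a RC u(1) by simp
        moreover have "\<zero> \<oplus> u (Suc n) \<in> f (Suc n)"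
          unfolding f_def a_r_coset_def' using submodD(3)[OF Mp(1)[of "Suc n"]] by auto
        ultimately show "y \<in> ?P n <+>\<^bsub>A\<^esub> f (Suc n)" unfolding set_add_def' using a(1) by auto
      qed
    qed
    then show ?thesis using 1 unfolding f_def by simp
  qed
  have "\<forall>n. f n \<in> carrier (A Quot ?P n) \<and> f n = ?P n <+>\<^bsub>A\<^esub> f (Suc n)"
    by (rule allI, rule conjI, rule fq, rule fc)
  moreover have "carrier ?C = {f. \<forall>n. f n \<in> carrier (A Quot ?P n) \<and> f n = ?P n <+>\<^bsub>A\<^esub> f (Suc n)}"
    by (simp only: adic_completion_def partial_object.select_convs)
  ultimately have fC: "f \<in> carrier ?C" by blast
  have pow: "f [^]\<^bsub>?C\<^esub> (k::nat) = (\<lambda>n. ?P n +>\<^bsub>A\<^esub> (u n [^] k))" for k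
  proof (induction k)
    case 0 show ?case by (simp add: adic_completion_def FactRing_def nat_pow_def)
  next
    case (Suc k)
    have "f [^]\<^bsub>?C\<^esub> Suc k = (\<lambda>n. (f [^]\<^bsub>?C\<^esub> k) n \<otimes>\<^bsub>A Quot ?P n\<^esub> f n)"
      by (simp add: adic_completion_def nat_pow_def)
    also have "\<dots> = (\<lambda>n. ?P n +>\<^bsub>A\<^esub> (u n [^] Suc k))"
    proof
      fix n
      have "(?P n +>\<^bsub>A\<^esub> (u n [^] k)) \<otimes>\<^bsub>A Quot ?P n\<^esub> f n = ?P n +>\<^bsub>A\<^esub> (u n [^] k \<otimes>\<^bsub>A\<^esub> u n)"
        unfolding f_def using ideal.rcoset_mult_add[OF I, of "u n [^] k" "u n" n] upR u(1) by (simp add: FactRing_def)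
      then show "(f [^]\<^bsub>?C\<^esub> k) n \<otimes>\<^bsub>A Quot ?P n\<^esub> f n = ?P n +>\<^bsub>A\<^esub> (u n [^] Suc k)" unfolding Suc by simp
    qed
    finally show ?case .
  qed
  have coz: "?P n +>\<^bsub>A\<^esub> a = ?P n \<longleftrightarrow> a \<in> ?P n" if "a \<in> R" for n a
  proof
    assume "?P n +>\<^bsub>A\<^esub> a = ?P n"
    moreover have "\<zero> \<oplus> a \<in> ?P n +>\<^bsub>A\<^esub> a" unfolding a_r_coset_def' using submodD(3)[OF Mp(1)] by auto
    ultimately show "a \<in> ?P n" using RC[OF that] by simp
  next
    interpret J: ideal "?P n" A by (rule I)
    assume "a \<in> ?P n" then show "?P n +>\<^bsub>A\<^esub> a = ?P n" by (rule J.a_rcos_const)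
  qed
  have z: "\<zero>\<^bsub>?C\<^esub> = (\<lambda>n. ?P n)" by (simp add: adic_completion_def FactRing_def)
  have "f [^]\<^bsub>?C\<^esub> e = \<zero>\<^bsub>?C\<^esub>" unfolding pow z
  proof
    fix n show "?P n +>\<^bsub>A\<^esub> (u n [^] e) = ?P n" using coz[OF upR[of n e]] u(3)[of n] by blast
  qed
  then have "f = \<zero>\<^bsub>?C\<^esub>" using red fC unfolding reduced_ring_def by blast
  then have "f n = ?P n" unfolding z by simp
  then show ?thesis using coz[OF u(1)] unfolding f_def by simp
qed

text \<open>Residual rationality speaks of regular maximal ideals. tW is one: it is maximal by
  \<open>val_uniformizer_maximal\<close> and contains the unit t of Q. So the coset of w is that of
  some a in R.\<close>

lemma residual:
  assumes o: "one_dim Q R M x Mp" and rr: "residually_rational Q R"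
    and W: "one_dim.valring Q R W" and t: "one_dim.val_uniformizer Q W t" and w: "w \<in> W"
    and VR: "W \<in> valuation_rings_over Q R"
  shows "\<exists>a\<in>R. inv t \<otimes> (w \<ominus> a) \<in> W"
proof -
  interpret O: one_dim Q R M x Mp by (rule o)
  note WS = O.valringD(1)[OF W]
  have WC: "W \<subseteq> carrier Q" using subringE(1)[OF WS] .
  have tU: "t \<in> Units Q" and tW: "t \<in> W" and ti: "inv t \<notin> W" using t unfolding O.val_uniformizer_def by auto
  let ?m = "scal t W" and ?B = "Q\<lparr>carrier := W\<rparr>"
  have sm: "submod W ?m" using submod_scal[OF WS submod_self[OF WS]] tU by blast
  have mW: "?m \<subseteq> W" using subringE(6)[OF WS tW] unfolding scal_def by auto
  have tm: "t \<in> ?m" using scalI[OF subringE(3)[OF WS], of t] tU by (simp add: Units_closed)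
  have i: "ideal ?m ?B" using ideal_subring_iff[OF WS] sm mW by simp
  have ne: "W \<noteq> ?m"
  proof
    assume "W = ?m"
    then have "\<one> \<in> ?m" using subringE(3)[OF WS] by blast
    then obtain v where v: "v \<in> W" "\<one> = t \<otimes> v" by (rule scalE)
    then have "inv t = v" using Units_iff_inv[of t v] tU WC by (simp add: Units_closed subset_eq)
    then show False using v ti by simp
  qed
  have "maximalideal ?m ?B"
    unfolding maximalideal_def maximalideal_axioms_def
  proof (intro conjI i allI impI)
    show "carrier ?B \<noteq> ?m" using ne by simp
    fix J assume J: "ideal J ?B" "?m \<subseteq> J" "J \<subseteq> carrier ?B"
    have J': "submod W J" "J \<subseteq> W" using J(1) ideal_subring_iff[OF WS] by auto
    show "J = ?m \<or> J = carrier ?B" using O.val_uniformizer_maximal[OF W t J' J(2)] by auto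
  qed
  then have "regular_maximal_ideal Q W ?m"
    unfolding regular_maximal_ideal_def reg_Q using tm tU by blast
  then have e: "(\<lambda>a. ?m +>\<^bsub>?B\<^esub> a) ` R = carrier (?B Quot ?m)"
    using rr VR unfolding residually_rational_def by blast
  interpret B: cring ?B using subcring_iff[OF WC] subcringI'[OF WS] by simp
  have "?m +>\<^bsub>?B\<^esub> w \<in> carrier (?B Quot ?m)"
    using B.a_rcosetsI[of ?m w] mW w by (simp add: FactRing_def)
  then have "?m +>\<^bsub>?B\<^esub> w \<in> (\<lambda>a. ?m +>\<^bsub>?B\<^esub> a) ` R" unfolding e .
  then obtain a where a: "a \<in> R" "?m +>\<^bsub>?B\<^esub> w = ?m +>\<^bsub>?B\<^esub> a" by blast
  have wC: "w \<in> carrier Q" using w WC by blast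
  have "w \<ominus> a \<in> ?m" using a(2) coset_eq_iff[OF WS sm wC RC[OF a(1)]] unfolding coset_subring by blast
  then obtain v where v: "v \<in> W" "w \<ominus> a = t \<otimes> v" by (rule scalE)
  have "inv t \<otimes> (w \<ominus> a) = v" unfolding v(2) using tU v(1) WC by (simp add: m_assoc[symmetric] Units_closed subset_eq)
  then show ?thesis using a(1) v(1) by auto
qed

text \<open>Otherwise the cosets of F would cover the residue field, which would then be finite with
  fewer than r elements.\<close>

lemma residue_classes:
  assumes M: "submod R M" and le: "{1..r} \<lesssim> carrier (A Quot M)"
    and F: "finite F" "F \<subseteq> R" "card F < r"
  shows "\<exists>a\<in>R. \<forall>b\<in>F. a \<ominus> b \<notin> M"
proof (rule ccontr)
  assume "\<not> ?thesis"
  then have no: "\<exists>b\<in>F. a \<ominus> b \<in> M" if "a \<in> R" for a using that by blast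
  have sub: "carrier (A Quot M) \<subseteq> (\<lambda>b. M +> b) ` F"
  proof
    fix C assume "C \<in> carrier (A Quot M)"
    then obtain a where a: "a \<in> R" "C = M +>\<^bsub>A\<^esub> a" by (auto simp: FactRing_def A_RCOSETS_def')
    obtain b where b: "b \<in> F" "a \<ominus> b \<in> M" using no[OF a(1)] by blast
    have "b \<in> carrier Q" using b(1) F(2) RC by blast
    then have "M +> a = M +> b" using coset_eq_iff[OF R M RC[OF a(1)]] b(2) by simp
    then have "C = M +> b" using a(2) unfolding coset_subring by simp
    then show "C \<in> (\<lambda>b. M +> b) ` F" using b(1) by (rule image_eqI)
  qed
  have fin: "finite (carrier (A Quot M))" using finite_subset[OF sub finite_imageI[OF F(1)]] .
  have "card (carrier (A Quot M)) \<le> card F"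
    using card_mono[OF finite_imageI[OF F(1)] sub] card_image_le[OF F(1), of "\<lambda>b. M +> b"] by simp
  moreover have "r \<le> card (carrier (A Quot M))"
    using iffD1[OF lepoll_iff_card_le[OF finite_atLeastAtMost fin] le] by simp
  ultimately show False using F(3) by simp
qed

lemma valued_ring_axioms:
  assumes adm: "admissible_ring Q R" and bij: "bij_betw V {1..r} (valuation_rings_over Q R)"
  shows "\<exists>M x Mp. valued_ring Q R M x Mp r V"
proof -
  obtain M where M: "cohen_macaulay_local A M" "krull_dim A = 1" "reduced_ring (adic_completion A M)"
    "residually_rational Q R" "valuation_rings_over Q R \<lesssim> carrier (A Quot M)"
    using adm unfolding admissible_ring_def by (elim conjE exE) (rule that)
  have l: "local_ring A M" and n: "noetherian_ring A" and d: "depth A M = 1"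
    using M(1,2) unfolding cohen_macaulay_local_def by auto
  note Mm = maximal_M[OF l]
  have Mi: "ideal M A" using ideal_subring_iff[OF R] Mm(1,2) by simp
  note Mp = Mp_facts[OF Mi]
  obtain x where x: "x \<in> M" "x \<in> Units Q" using ex_regular[OF l d] by blast
  have o: "one_dim Q R M x (ideal_power A M)"
  proof (intro one_dim.intro one_dim_axioms.intro)
    show "cring Q" by (rule is_cring)
    show "subring R Q" by (rule R)
    show "\<exists>s\<in>R \<inter> Units Q. y \<otimes> s \<in> R" if "y \<in> carrier Q" for y using frac[OF that] .
    show "submod R M" "M \<subseteq> R" "\<one> \<notin> M" "x \<in> M" "x \<in> Units Q" using Mm(1-3) x by auto
    show "a \<in> Units Q \<and> inv a \<in> R" if "a \<in> R" "a \<notin> M" for a using local_unit[OF n l that] .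
    show "\<exists>N\<in>F. \<forall>N'\<in>F. N \<subseteq> N' \<longrightarrow> N' = N" if "F \<noteq> {}" "\<And>N. N \<in> F \<Longrightarrow> submod R N \<and> N \<subseteq> R" for F
      using noetherian_maximal[OF n that] .
    show "M \<subseteq> P" if "submod R P" "P \<subseteq> R" "\<one> \<notin> P" "\<And>a b. a \<in> R \<Longrightarrow> b \<in> R \<Longrightarrow> a \<otimes> b \<in> P \<Longrightarrow> a \<in> P \<or> b \<in> P"
      "s \<in> P" "s \<in> Units Q" for P s using prime_dim_one[OF n l M(2) that] .
    show "submod R (ideal_power A M n)" for n by (rule Mp(1))
    show "ideal_power A M 0 = R" by (rule Mp(2))
    show "a \<otimes> b \<in> ideal_power A M (Suc n)" if "a \<in> M" "b \<in> ideal_power A M n" for a b n using Mp(3)[OF that] .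
    show "ideal_power A M (Suc n) \<subseteq> N" if "submod R N" "\<And>a b. a \<in> M \<Longrightarrow> b \<in> ideal_power A M n \<Longrightarrow> a \<otimes> b \<in> N" for N n
      using Mp(4)[OF that] .
    show "u n \<in> ideal_power A M n" if "\<And>n. u n \<in> R" "\<And>n. u (Suc n) \<ominus> u n \<in> ideal_power A M n"
      "\<And>n. u n [^] (e::nat) \<in> ideal_power A M n" for u e n using complete_reduced[OF Mi M(3) that] .
  qed
  interpret O: one_dim Q R M x "ideal_power A M" by (rule o)
  have vr: "valuation_rings_over Q R = {W. O.valring W}"
  proof (rule Set.set_eqI)
    fix W
    have s: "subcring W Q \<longleftrightarrow> subring W Q" using subcringI'[of W] unfolding subcring_def by blast
    show "W \<in> valuation_rings_over Q R \<longleftrightarrow> W \<in> {W. O.valring W}"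
      unfolding valuation_rings_over_def valuation_ring_def O.valring_def mem_Collect_eq s by auto
  qed
  \<comment> \<open>Since V enumerates the valuation rings, the bound on the size of the residue
    field becomes a bound in terms of r.\<close>
  have "{1..r} \<lesssim> carrier (A Quot M)"
    using lepoll_trans1[OF _ M(5), of "{1..r}"] bij unfolding eqpoll_def by blast
  note rc = residue_classes[OF Mm(1) this]
  have "valued_ring Q R M x (ideal_power A M) r V"
  proof (intro valued_ring.intro o valued_ring_axioms.intro)
    show "bij_betw V {1..r} {W. O.valring W}" using bij unfolding vr .
    show "\<exists>a\<in>R. inv t \<otimes> (w \<ominus> a) \<in> W" if "O.valring W" "O.val_uniformizer W t" "w \<in> W" for W t w
      using residual[OF o M(4) that] that(1) vr by blast
    show "\<exists>a\<in>R. \<forall>b\<in>F. a \<ominus> b \<notin> M" if "finite F" "F \<subseteq> R" "card F < r" for F using rc[OF that] .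
  qed
  then show ?thesis by blast
qed

end

theorem theorem2:
  fixes Q :: "('a, 'b) ring_scheme" and R :: "'a set" and J :: "'a set"
    and r :: nat and V :: "nat \<Rightarrow> 'a set"
  assumes "admissible_ring Q R"
    and "bij_betw V {1..r} (valuation_rings_over Q R)"
    and "regular_fractional_ideal Q R J"
  shows "canonical_ideal Q R J \<longleftrightarrow>
    (\<forall>I. regular_fractional_ideal Q R I \<longrightarrow>
       value_set Q r V (ideal_colon Q J I) =
         {\<beta> \<in> int_vectors r.
            fibers r (value_set Q r V I)
              (\<lambda>i\<in>{1..r}. frobenius_vector r (value_set Q r V J) i - \<beta> i) = {}})"
proof -
  have tot: "total_ring_of_fractions Q R" using assms(1) unfolding admissible_ring_def by blast
  interpret F: frac_ring Q R
  proof -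
    have "cring Q" using tot unfolding total_ring_of_fractions_def by blast
    then show "frac_ring Q R" unfolding frac_ring_def frac_ring_axioms_def using tot by blast
  qed
  obtain M x Mp where "valued_ring Q R M x Mp r V" using F.valued_ring_axioms[OF assms(1,2)] by blast
  then interpret valued_ring Q R M x Mp r V .
  \<comment> \<open>The regular elements of Q are its units, which identifies the notions of the
    statement with those developed for units.\<close>
  note regfrac = regular_fractional_ideal_iff[OF F.reg_Q F.reg_A] and val = value_set_eq[OF F.reg_Q]
  have "regfrac J" using assms(3) regfrac by simp
  then show ?thesis
    unfolding canonical_ideal_def regfrac val using canonical_iff_value_duality by simp
qed

end
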